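(* Let $X$ be a UMD Banach space, $1<p<\infty$, and let $L^p(\mathbb{R}^n;X)$ have type $\tau$. For $\alpha\ge1$ let $\mathscr{A}_\alpha$ be the family of operators $$f\mapsto A_B^\alpha f:=1_{\alpha B}\,\frac1{|B|}\int_Bf\,dx,$$ where $B$ runs over all balls in $\mathbb{R}^n$. Then $\mathscr{A}_\alpha$ is $\gamma$-bounded on $L^p(\mathbb{R}^n;X)$ with $\gamma$-bound at most $C(1+\log\alpha)\alpha^{n/\tau}$, where $C$ depends only on $X$, $p$, $\tau$ and $n$.
   Context: $\alpha B$ is the ball with the same centre as $B$ and $\alpha$ times its radius, and $1_{\alpha B}$ is its indicator function. A family $\mathscr{T}$ of bounded linear operators on a Banach space $Y$ is $\gamma$-bounded if there is a constant $C$ such that for all $k\ge1$, $T_1,\dots,T_k\in\mathscr{T}$ and $\xi_1,\dots,\xi_k\in Y$, $\mathbb{E}\|\sum_{j=1}^k\gamma_jT_j\xi_j\|^2\le C^2\,\mathbb{E}\|\sum_{j=1}^k\gamma_j\xi_j\|^2$, where $\gamma_1,\dots,\gamma_k$ are independent standard normal random variables; the least such $C$ is the $\gamma$-bound. *)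

theory Defs
  imports "HOL-Probability.Probability"
begin

section \<open>Bochner integration in an arbitrary Banach space\<close>

text \<open>The library's \<open>has_bochner_integral\<close> requires a second countable target type.
  Here the target is any Banach space, separable or not, so Borel measurability is replaced by
  strong measurability. For second countable targets the notions agree, see
  \<open>has_integral_in_iff\<close> below.\<close>

definition strongly_measurable :: "'m measure \<Rightarrow> ('m \<Rightarrow> 'a::metric_space) \<Rightarrow> bool" where
  "strongly_measurable M f \<longleftrightarrow>
     (\<exists>s. (\<forall>i. simple_function M (s i)) \<and> (\<forall>x\<in>space M. (\<lambda>i. s i x) \<longlonglongrightarrow> f x))"

definition has_integral_in :: "'m measure \<Rightarrow> ('m \<Rightarrow> 'a::real_normed_vector) \<Rightarrow> 'a \<Rightarrow> bool" where
  "has_integral_in M f y \<longleftrightarrow> strongly_measurable M f \<and>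
     (\<exists>s. (\<forall>i. Bochner_Integration.simple_bochner_integrable M (s i)) \<and>
          (\<lambda>i. \<integral>\<^sup>+x. ennreal (norm (f x - s i x)) \<partial>M) \<longlonglongrightarrow> 0 \<and>
          (\<lambda>i. Bochner_Integration.simple_bochner_integral M (s i)) \<longlonglongrightarrow> y)"

definition integral_over :: "'m measure \<Rightarrow> 'm set \<Rightarrow> ('m \<Rightarrow> 'a::real_normed_vector) \<Rightarrow> 'a" where
  "integral_over M A f = (THE y. has_integral_in M (\<lambda>x. indicator A x *\<^sub>R f x) y)"

lemma strongly_measurable_borel:
  assumes "strongly_measurable M f"
  shows "f \<in> borel_measurable M"
proof -
  obtain s where s: "\<forall>i. simple_function M (s i)" "\<forall>x\<in>space M. (\<lambda>i. s i x) \<longlonglongrightarrow> f x"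
    using assms unfolding strongly_measurable_def by (elim exE conjE)
  show ?thesis
  proof (rule borel_measurable_LIMSEQ_metric)
    show "s i \<in> borel_measurable M" for i
      using s(1) by (simp add: borel_measurable_simple_function)
    show "(\<lambda>i. s i x) \<longlonglongrightarrow> f x" if "x \<in> space M" for x
      using s(2) that by simp
  qed
qed

lemma strongly_measurable_iff:
  fixes f :: "'m \<Rightarrow> 'a::{metric_space, second_countable_topology}"
  shows "strongly_measurable M f \<longleftrightarrow> f \<in> borel_measurable M"
proof
  assume "f \<in> borel_measurable M"
  from borel_measurable_implies_sequence_metric[OF this, of undefined]
  show "strongly_measurable M f"
    unfolding strongly_measurable_def by blast
qed (rule strongly_measurable_borel)

lemma has_integral_in_iff:
  fixes f :: "'m \<Rightarrow> 'a::{real_normed_vector, second_countable_topology}"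
  shows "has_integral_in M f y \<longleftrightarrow> has_bochner_integral M f y"
  unfolding has_integral_in_def has_bochner_integral.simps strongly_measurable_iff
  by simp

lemma has_integral_in_unique:
  fixes f :: "'m \<Rightarrow> 'a::real_normed_vector"
  assumes "has_integral_in M f y" "has_integral_in M f z"
  shows "y = z"
proof -
  let ?B = "Bochner_Integration.simple_bochner_integrable M"
  let ?I = "Bochner_Integration.simple_bochner_integral M"
  obtain s where s0: "\<forall>i. ?B (s i)"
    and s: "(\<lambda>i. \<integral>\<^sup>+x. ennreal (norm (f x - s i x)) \<partial>M) \<longlonglongrightarrow> 0" "(\<lambda>i. ?I (s i)) \<longlonglongrightarrow> y"
    using assms(1) unfolding has_integral_in_def by (elim conjE exE)
  obtain t where t0: "\<forall>i. ?B (t i)"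
    and t: "(\<lambda>i. \<integral>\<^sup>+x. ennreal (norm (f x - t i x)) \<partial>M) \<longlonglongrightarrow> 0" "(\<lambda>i. ?I (t i)) \<longlonglongrightarrow> z"
    using assms(2) unfolding has_integral_in_def by (elim conjE exE)
  have s1: "?B (s i)" and t1: "?B (t i)" for i
    using s0 t0 by simp_all
  have fs: "(\<lambda>x. ennreal (norm (f x - g x))) \<in> borel_measurable M"
    if "?B g" for g
  proof -
    have "strongly_measurable M f"
      using assms(1) unfolding has_integral_in_def by (rule conjunct1)
    then obtain u where u: "\<forall>i. simple_function M (u i)" "\<forall>x\<in>space M. (\<lambda>i. u i x) \<longlonglongrightarrow> f x"
      unfolding strongly_measurable_def by (elim exE conjE)
    have g: "simple_function M g"
      using that by (rule Bochner_Integration.simple_bochner_integrable.cases)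
    have "(\<lambda>x. norm (f x - g x)) \<in> borel_measurable M"
    proof (rule borel_measurable_LIMSEQ_metric)
      show "(\<lambda>x. norm (u i x - g x)) \<in> borel_measurable M" for i
        using simple_function_compose2[OF u(1)[rule_format, of i] g, of "\<lambda>a b. norm (a - b)"]
        by (rule borel_measurable_simple_function)
      show "(\<lambda>i. norm (u i x - g x)) \<longlonglongrightarrow> norm (f x - g x)" if "x \<in> space M" for x
        by (intro tendsto_intros u(2)[rule_format] that)
    qed
    then show ?thesis by measurable
  qed
  have bound: "ennreal (norm (?I (s i) - ?I (t i)))
      \<le> (\<integral>\<^sup>+x. ennreal (norm (f x - s i x)) \<partial>M) + (\<integral>\<^sup>+x. ennreal (norm (f x - t i x)) \<partial>M)" for i
  proof -
    have st: "?B (\<lambda>x. s i x - t i x)"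
      by (rule Bochner_Integration.simple_bochner_integrable_compose2[OF _ s1 t1]) simp
    have nst: "?B (\<lambda>x. norm (s i x - t i x))"
      by (rule Bochner_Integration.simple_bochner_integrable_compose2[OF _ s1 t1]) simp
    have "ennreal (norm (?I (s i) - ?I (t i))) = ennreal (norm (?I (\<lambda>x. s i x - t i x)))"
      by (simp add: Bochner_Integration.simple_bochner_integral_diff s1 t1)
    also have "\<dots> \<le> ennreal (?I (\<lambda>x. norm (s i x - t i x)))"
      by (intro ennreal_leI Bochner_Integration.simple_bochner_integral_norm_bound st)
    also have "\<dots> = (\<integral>\<^sup>+x. ennreal (norm (s i x - t i x)) \<partial>M)"
      using nst by (simp add: Bochner_Integration.simple_bochner_integral_eq_nn_integral)
    also have "\<dots> \<le> (\<integral>\<^sup>+x. ennreal (norm (f x - s i x)) + ennreal (norm (f x - t i x)) \<partial>M)"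
    proof (intro nn_integral_mono)
      fix x
      have "norm (s i x - t i x) \<le> norm (f x - s i x) + norm (f x - t i x)"
        using norm_triangle_ineq4[of "f x - t i x" "f x - s i x"] by simp
      then show "ennreal (norm (s i x - t i x)) \<le> ennreal (norm (f x - s i x)) + ennreal (norm (f x - t i x))"
        by (simp flip: ennreal_plus)
    qed
    also have "\<dots> = (\<integral>\<^sup>+x. ennreal (norm (f x - s i x)) \<partial>M) + (\<integral>\<^sup>+x. ennreal (norm (f x - t i x)) \<partial>M)"
      by (intro nn_integral_add fs s1 t1)
    finally show ?thesis .
  qed
  have "(\<lambda>i. (\<integral>\<^sup>+x. ennreal (norm (f x - s i x)) \<partial>M) + (\<integral>\<^sup>+x. ennreal (norm (f x - t i x)) \<partial>M))
      \<longlonglongrightarrow> 0 + 0"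
    by (intro tendsto_add s(1) t(1))
  then have lim: "(\<lambda>i. (\<integral>\<^sup>+x. ennreal (norm (f x - s i x)) \<partial>M) + (\<integral>\<^sup>+x. ennreal (norm (f x - t i x)) \<partial>M))
      \<longlonglongrightarrow> ennreal 0"
    by simp
  have "(\<lambda>i. ennreal (norm (?I (s i) - ?I (t i)))) \<longlonglongrightarrow> ennreal 0"
  proof (rule tendsto_sandwich[OF _ _ _ lim])
    show "\<forall>\<^sub>F i in sequentially. ennreal 0 \<le> ennreal (norm (?I (s i) - ?I (t i)))"
      by simp
    show "\<forall>\<^sub>F i in sequentially. ennreal (norm (?I (s i) - ?I (t i)))
        \<le> (\<integral>\<^sup>+x. ennreal (norm (f x - s i x)) \<partial>M) + (\<integral>\<^sup>+x. ennreal (norm (f x - t i x)) \<partial>M)"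
      by (intro always_eventually allI bound)
  qed (rule tendsto_const)
  then have "(\<lambda>i. norm (?I (s i) - ?I (t i))) \<longlonglongrightarrow> 0"
    by (subst (asm) tendsto_ennreal_iff) simp_all
  moreover have "(\<lambda>i. norm (?I (s i) - ?I (t i))) \<longlonglongrightarrow> norm (y - z)"
    by (intro tendsto_intros s(2) t(2))
  ultimately have "norm (y - z) = 0"
    by (rule LIMSEQ_unique[rotated])
  then show ?thesis by simp
qed

lemma integral_over_eq:
  "has_integral_in M (\<lambda>x. indicator A x *\<^sub>R f x) y \<Longrightarrow> integral_over M A f = y"
  unfolding integral_over_def by (blast intro: has_integral_in_unique)


section \<open>Lebesgue-Bochner spaces\<close>

text \<open>\<open>L\<^sup>p(M;X)\<close> is represented by its functions, with \<open>Lp_norm\<close> as a seminorm; equality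
  in \<open>L\<^sup>p\<close> means that the difference has seminorm 0, i.e. vanishes almost everywhere.\<close>

definition Lp_space :: "real \<Rightarrow> 'm measure \<Rightarrow> ('m \<Rightarrow> 'a::real_normed_vector) set" where
  "Lp_space p M =
     {f. strongly_measurable M f \<and> (\<integral>\<^sup>+x. ennreal (norm (f x) powr p) \<partial>M) < \<infinity>}"

definition Lp_norm :: "real \<Rightarrow> 'm measure \<Rightarrow> ('m \<Rightarrow> 'a::real_normed_vector) \<Rightarrow> real" where
  "Lp_norm p M f = (\<integral>x. norm (f x) powr p \<partial>M) powr (1 / p)"


section \<open>UMD spaces\<close>

text \<open>\<open>d 1, \<dots>, d n\<close> is an \<open>L\<^sup>q\<close>-martingale difference sequence for \<open>F 0, \<dots>, F n\<close>.
  The last conjunct is \<open>E[d k | F (k - 1)] = 0\<close>, spelled out because the library's conditional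
  expectation is only real valued.\<close>

definition martingale_differences ::
    "real \<Rightarrow> 'w measure \<Rightarrow> (nat \<Rightarrow> 'w measure) \<Rightarrow> nat \<Rightarrow> (nat \<Rightarrow> 'w \<Rightarrow> 'a::real_normed_vector) \<Rightarrow> bool" where
  "martingale_differences q M F n d \<longleftrightarrow>
     filtration (space M) F \<and> (\<forall>k. subalgebra M (F k)) \<and>
     (\<forall>k\<in>{1..n}. strongly_measurable (F k) (d k) \<and> d k \<in> Lp_space q M \<and>
        (\<forall>A\<in>sets (F (k - 1)). has_integral_in M (\<lambda>w. indicator A w *\<^sub>R d k w) 0))"

text \<open>HOL cannot quantify over the type of sample points inside a definition. The probability
  measures range over all \<open>\<sigma>\<close>-algebras on the type of real numbers; these realise the joint law of
  every finite sequence of strongly measurable random variables.\<close>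

definition umd :: "'a::banach itself \<Rightarrow> bool" where
  "umd _ \<longleftrightarrow> (\<forall>q>1. \<exists>\<beta>\<ge>0. \<forall>(M :: real measure) F n (d :: nat \<Rightarrow> real \<Rightarrow> 'a) \<epsilon>.
     prob_space M \<longrightarrow> martingale_differences q M F n d \<longrightarrow>
     (\<forall>k\<in>{1..n}. \<epsilon> k \<in> {-1, 1}) \<longrightarrow>
     Lp_norm q M (\<lambda>w. \<Sum>k=1..n. \<epsilon> k *\<^sub>R d k w) \<le> \<beta> * Lp_norm q M (\<lambda>w. \<Sum>k=1..n. d k w))"


section \<open>Type and \<gamma>-boundedness\<close>

text \<open>Here \<open>Y\<close> is a space of functions, given by its carrier \<open>V\<close> and its seminorm \<open>N\<close>.
  Functions at seminorm distance 0 are identified.\<close>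

definition has_type ::
    "('e \<Rightarrow> 'a::real_vector) set \<Rightarrow> (('e \<Rightarrow> 'a) \<Rightarrow> real) \<Rightarrow> real \<Rightarrow> bool" where
  "has_type V N \<tau> \<longleftrightarrow> 1 \<le> \<tau> \<and> \<tau> \<le> 2 \<and>
     (\<exists>C\<ge>0. \<forall>k\<ge>1. \<forall>\<xi> :: nat \<Rightarrow> 'e \<Rightarrow> 'a. (\<forall>j<k. \<xi> j \<in> V) \<longrightarrow>
        \<comment> \<open>the average over all signs is the expectation over independent Rademacher variables\<close>
        sqrt ((\<Sum>\<epsilon> \<in> {..<k} \<rightarrow>\<^sub>E {-1, 1}. (N (\<lambda>x. \<Sum>j<k. \<epsilon> j *\<^sub>R \<xi> j x))\<^sup>2) / 2 ^ k)
          \<le> C * (\<Sum>j<k. N (\<xi> j) powr \<tau>) powr (1 / \<tau>))"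

definition bounded_linear_operator ::
    "('e \<Rightarrow> 'a::real_vector) set \<Rightarrow> (('e \<Rightarrow> 'a) \<Rightarrow> real) \<Rightarrow> (('e \<Rightarrow> 'a) \<Rightarrow> ('e \<Rightarrow> 'a)) \<Rightarrow> bool" where
  "bounded_linear_operator V N T \<longleftrightarrow>
     (\<forall>f\<in>V. T f \<in> V) \<and>
     (\<forall>f\<in>V. \<forall>g\<in>V. N (\<lambda>x. T (\<lambda>y. f y + g y) x - (T f x + T g x)) = 0) \<and>
     (\<forall>a. \<forall>f\<in>V. N (\<lambda>x. T (\<lambda>y. a *\<^sub>R f y) x - a *\<^sub>R T f x) = 0) \<and>
     (\<exists>K. \<forall>f\<in>V. N (T f) \<le> K * N f)"

definition gaussian_square_mean ::
    "(('e \<Rightarrow> 'a::real_vector) \<Rightarrow> real) \<Rightarrow> nat \<Rightarrow> (nat \<Rightarrow> 'e \<Rightarrow> 'a) \<Rightarrow> ennreal" where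
  "gaussian_square_mean N k \<xi> =
     (\<integral>\<^sup>+\<gamma>. ennreal ((N (\<lambda>x. \<Sum>j<k. \<gamma> j *\<^sub>R \<xi> j x))\<^sup>2) \<partial>(\<Pi>\<^sub>M j\<in>{..<k}. std_normal_distribution))"

definition gamma_constants ::
    "('e \<Rightarrow> 'a::real_vector) set \<Rightarrow> (('e \<Rightarrow> 'a) \<Rightarrow> real) \<Rightarrow> (('e \<Rightarrow> 'a) \<Rightarrow> ('e \<Rightarrow> 'a)) set \<Rightarrow> real set" where
  "gamma_constants V N \<T> = {C. 0 \<le> C \<and>
     (\<forall>k\<ge>1. \<forall>T \<xi>. (\<forall>j<k. T j \<in> \<T> \<and> \<xi> j \<in> V) \<longrightarrow>
        gaussian_square_mean N k (\<lambda>j. T j (\<xi> j)) \<le> ennreal (C\<^sup>2) * gaussian_square_mean N k \<xi>)}"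

definition gamma_bounded ::
    "('e \<Rightarrow> 'a::real_vector) set \<Rightarrow> (('e \<Rightarrow> 'a) \<Rightarrow> real) \<Rightarrow> (('e \<Rightarrow> 'a) \<Rightarrow> ('e \<Rightarrow> 'a)) set \<Rightarrow> bool" where
  "gamma_bounded V N \<T> \<longleftrightarrow>
     (\<forall>T\<in>\<T>. bounded_linear_operator V N T) \<and> gamma_constants V N \<T> \<noteq> {}"

definition gamma_bound ::
    "('e \<Rightarrow> 'a::real_vector) set \<Rightarrow> (('e \<Rightarrow> 'a) \<Rightarrow> real) \<Rightarrow> (('e \<Rightarrow> 'a) \<Rightarrow> ('e \<Rightarrow> 'a)) set \<Rightarrow> real" where
  "gamma_bound V N \<T> = Inf (gamma_constants V N \<T>)"


section \<open>Averaging operators\<close>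

text \<open>The operator \<open>A\<^sub>B\<^sup>\<alpha>\<close> for the ball \<open>B\<close> with centre \<open>c\<close> and radius \<open>r\<close>.\<close>

definition ball_average ::
    "real \<Rightarrow> 'e::euclidean_space \<Rightarrow> real \<Rightarrow> ('e \<Rightarrow> 'a::real_normed_vector) \<Rightarrow> ('e \<Rightarrow> 'a)" where
  "ball_average \<alpha> c r f =
     (\<lambda>x. indicator (ball c (\<alpha> * r)) x *\<^sub>R
        ((1 / measure lborel (ball c r)) *\<^sub>R integral_over lborel (ball c r) f))"

definition ball_averages :: "real \<Rightarrow> (('e::euclidean_space \<Rightarrow> 'a::real_normed_vector) \<Rightarrow> ('e \<Rightarrow> 'a)) set" where
  "ball_averages \<alpha> = {ball_average \<alpha> c r | c r. 0 < r}"

end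

theory Submission
  imports Defs
begin

text \<open>Gaussian sums are symmetric, so it suffices to bound the second moment of random sums
  with independent signs (\<open>gaussian_square_mean_le\<close>). By the Kahane-Khintchine inequality
  (\<open>kahane\<close>) this moment may be exchanged for the \<open>p\<close>-th moment, up to a constant. The \<open>p\<close>-th
  moment is a pointwise quantity in \<open>L\<^sup>p(M;X)\<close>: one obtains a contraction principle with
  multipliers that depend on the point (\<open>rad2_contraction\<close>), and Stein's inequality for
  conditional expectations with respect to nested partitions, which is where the UMD property
  enters (\<open>stein_finite\<close>).

  Let every cell of a grid be the union of \<open>K\<close> cells of the generation before, all of
  the same measure. The model of the operator \<open>A\<^sub>B\<^sup>\<alpha>\<close> takes the mean over a cell \<open>z\<close>
  and places it on the parent of \<open>z\<close>. Number the children of each cell and reflect the numbers; this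
  gives \<open>K\<close> involutions that move \<open>z\<close> to each of its siblings exactly once. The mean over \<open>z\<close> placed
  on one fixed reflection of \<open>z\<close> is, up to a factor of at most 2, part of a conditional expectation
  with atoms \<open>{z, sib m z}\<close>. A pair of siblings lies in one parent cell, so the atoms of all
  generations are nested and Stein's inequality gives a bound that is independent of \<open>K\<close>
  (\<open>reflected_average_bound\<close>). The images under the \<open>K\<close> reflections are disjoint. By the contraction
  principle they may be given random signs, and then type \<open>\<tau>\<close> bounds their sum with the factor
  \<open>K powr (1 / \<tau>)\<close> instead of \<open>K\<close> (\<open>rad2_disjoint_sum_type\<close>, \<open>parent_average_bound\<close>).

  For balls, take cubes whose sides are powers of 3. A ball \<open>B\<close> meets boundedly many cubes
  of side comparable to its radius. If each generation of the grid has \<open>3 ^ L\<close> times the side of the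
  one before, with \<open>3 ^ L\<close> comparable to \<open>\<alpha>\<close>, then the dilated ball is small compared with the cubes
  of the next generation, and it lies inside one of them after shifting the grid by half a side in
  suitable directions (\<open>ball_in_shifted_cube\<close>); the odd ratio keeps the shifted grid nested. Thus
  \<open>A\<^sub>B\<^sup>\<alpha>\<close> is a sum of boundedly many models, cut off by bounded multipliers
  (\<open>ball_average_cubes\<close>), with \<open>K = 3 ^ (L * n)\<close>, so that \<open>K powr (1 / \<tau>)\<close> is comparable to
  \<open>\<alpha> powr (n / \<tau>)\<close>. The radii of the balls are arbitrary, whereas the generations of one grid only
  catch one order of magnitude out of \<open>L\<close>. Hence \<open>L\<close> grids are needed, and \<open>L\<close> is comparable to
  \<open>1 + ln \<alpha>\<close> (\<open>rad2_ball_averages\<close>).\<close>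

section \<open>Averages over signs and the Kahane-Khintchine inequality\<close>

definition signs :: "'j set \<Rightarrow> ('j \<Rightarrow> real) set" where
  "signs J = J \<rightarrow>\<^sub>E {-1, 1}"

definition sign_mean :: "'j set \<Rightarrow> (('j \<Rightarrow> real) \<Rightarrow> real) \<Rightarrow> real" where
  "sign_mean J \<Phi> = (\<Sum>\<epsilon>\<in>signs J. \<Phi> \<epsilon>) / 2 ^ card J"

lemma finite_signs [simp]: "finite J \<Longrightarrow> finite (signs J)"
  by (simp add: signs_def finite_PiE)

lemma card_signs [simp]: "finite J \<Longrightarrow> card (signs J) = 2 ^ card J"
  by (simp add: signs_def card_PiE numeral_2_eq_2)

lemma signs_abs: "\<epsilon> \<in> signs J \<Longrightarrow> j \<in> J \<Longrightarrow> \<bar>\<epsilon> j\<bar> = 1"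
  unfolding signs_def by (drule (1) PiE_mem) auto

lemma sign_mean_mono:
  "(\<And>\<epsilon>. \<epsilon> \<in> signs J \<Longrightarrow> \<Phi> \<epsilon> \<le> \<Psi> \<epsilon>) \<Longrightarrow> sign_mean J \<Phi> \<le> sign_mean J \<Psi>"
  unfolding sign_mean_def by (intro divide_right_mono sum_mono) auto

lemma sign_mean_cong:
  "(\<And>\<epsilon>. \<epsilon> \<in> signs J \<Longrightarrow> \<Phi> \<epsilon> = \<Psi> \<epsilon>) \<Longrightarrow> sign_mean J \<Phi> = sign_mean J \<Psi>"
  unfolding sign_mean_def by (simp cong: sum.cong)

lemma sign_mean_nonneg:
  "(\<And>\<epsilon>. \<epsilon> \<in> signs J \<Longrightarrow> 0 \<le> \<Phi> \<epsilon>) \<Longrightarrow> 0 \<le> sign_mean J \<Phi>"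
  unfolding sign_mean_def by (intro divide_nonneg_nonneg sum_nonneg) auto

lemma sign_mean_add: "sign_mean J (\<lambda>\<epsilon>. \<Phi> \<epsilon> + \<Psi> \<epsilon>) = sign_mean J \<Phi> + sign_mean J \<Psi>"
  unfolding sign_mean_def by (simp add: sum.distrib add_divide_distrib)

lemma sign_mean_cmult: "sign_mean J (\<lambda>\<epsilon>. c * \<Phi> \<epsilon>) = c * sign_mean J \<Phi>"
  unfolding sign_mean_def by (simp add: sum_distrib_left)

lemma sign_mean_sum:
  "sign_mean J (\<lambda>\<epsilon>. \<Sum>i\<in>I. \<Phi> i \<epsilon>) = (\<Sum>i\<in>I. sign_mean J (\<Phi> i))"
  unfolding sign_mean_def by (subst sum.swap) (simp add: sum_divide_distrib)

lemma sign_mean_const [simp]: "finite J \<Longrightarrow> sign_mean J (\<lambda>\<epsilon>. c) = c"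
  unfolding sign_mean_def by simp

lemma sign_mean_swap:
  "sign_mean I (\<lambda>\<delta>. sign_mean J (\<lambda>\<epsilon>. \<Phi> \<delta> \<epsilon>)) = sign_mean J (\<lambda>\<epsilon>. sign_mean I (\<lambda>\<delta>. \<Phi> \<delta> \<epsilon>))"
  unfolding sign_mean_def
  by (simp add: sum_divide_distrib[symmetric] mult.commute) (rule sum.swap)

lemma sign_mean_eq_0D:
  assumes "finite J" "sign_mean J \<Phi> = 0" "\<And>\<epsilon>. \<epsilon> \<in> signs J \<Longrightarrow> 0 \<le> \<Phi> \<epsilon>" "\<epsilon> \<in> signs J"
  shows "\<Phi> \<epsilon> = 0"
proof -
  have "(\<Sum>\<epsilon>\<in>signs J. \<Phi> \<epsilon>) = 0"
    using assms(2) by (simp add: sign_mean_def)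
  then show ?thesis
    using assms sum_nonneg_eq_0_iff[of "signs J" \<Phi>] by auto
qed

lemma sign_mean_empty [simp]: "sign_mean {} \<Phi> = \<Phi> (\<lambda>_. undefined)"
  by (simp add: sign_mean_def signs_def)

lemma sign_mean_insert:
  assumes "finite J" "i \<notin> J"
  shows "sign_mean (insert i J) \<Phi> =
    (sign_mean J (\<lambda>\<epsilon>. \<Phi> (\<epsilon>(i := 1))) + sign_mean J (\<lambda>\<epsilon>. \<Phi> (\<epsilon>(i := -1)))) / 2"
proof -
  have "sum \<Phi> (signs (insert i J)) = (\<Sum>(y, \<epsilon>)\<in>{-1, 1} \<times> signs J. \<Phi> (\<epsilon>(i := y)))"
    unfolding signs_def PiE_insert_eq
    using inj_combinator[OF assms(2), of "\<lambda>_. {-1, 1 :: real}"]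
    by (subst sum.reindex) (simp_all add: case_prod_unfold)
  also have "\<dots> = (\<Sum>\<epsilon>\<in>signs J. \<Phi> (\<epsilon>(i := -1))) + (\<Sum>\<epsilon>\<in>signs J. \<Phi> (\<epsilon>(i := 1)))"
    using assms(1) by (subst sum.cartesian_product[symmetric]) simp
  finally show ?thesis
    using assms by (simp add: sign_mean_def add_divide_distrib)
qed

text \<open>The hypothesis is an inequality, so that the lemma also covers norms of sums, where
  \<open>\<Phi>\<close> is only subadditive.\<close>

lemma sign_mean_sq_triangle:
  assumes J: "finite J" and le: "\<And>\<epsilon>. \<epsilon> \<in> signs J \<Longrightarrow> 0 \<le> \<Phi> \<epsilon> \<and> \<Phi> \<epsilon> \<le> \<Psi> \<epsilon> + \<Theta> \<epsilon>"
    and "\<And>\<epsilon>. \<epsilon> \<in> signs J \<Longrightarrow> 0 \<le> \<Psi> \<epsilon> \<and> 0 \<le> \<Theta> \<epsilon>"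
  shows "sqrt (sign_mean J (\<lambda>\<epsilon>. (\<Phi> \<epsilon>)\<^sup>2))
    \<le> sqrt (sign_mean J (\<lambda>\<epsilon>. (\<Psi> \<epsilon>)\<^sup>2)) + sqrt (sign_mean J (\<lambda>\<epsilon>. (\<Theta> \<epsilon>)\<^sup>2))"
proof -
  have *: "sqrt (sign_mean J (\<lambda>\<epsilon>. (F \<epsilon>)\<^sup>2)) = L2_set F (signs J) / sqrt (2 ^ card J)" for F
    by (simp add: sign_mean_def L2_set_def real_sqrt_divide)
  have "L2_set \<Phi> (signs J) \<le> L2_set (\<lambda>\<epsilon>. \<Psi> \<epsilon> + \<Theta> \<epsilon>) (signs J)"
    by (rule L2_set_mono) (use le in auto)
  also have "\<dots> \<le> L2_set \<Psi> (signs J) + L2_set \<Theta> (signs J)"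
    by (rule L2_set_triangle_ineq)
  finally show ?thesis
    unfolding * by (simp add: add_divide_distrib[symmetric] divide_right_mono)
qed

lemma sqrt_sign_mean_scale:
  "0 \<le> k \<Longrightarrow> sqrt (sign_mean J (\<lambda>\<epsilon>. (k * \<Phi> \<epsilon>)\<^sup>2)) = k * sqrt (sign_mean J (\<lambda>\<epsilon>. (\<Phi> \<epsilon>)\<^sup>2))"
  by (simp add: power_mult_distrib sign_mean_cmult real_sqrt_mult)

text \<open>Random sums are studied through \<open>\<phi> a = N (\<Sum>j\<in>J. a j *\<^sub>R \<xi> j)\<close> for a seminorm \<open>N\<close>, as
  functions of the coefficients alone. The Kahane-Khintchine inequality with a constant that is the
  same for all spaces is then a statement about \<open>\<phi>\<close>.\<close>

definition coeff_seminorm :: "(('j \<Rightarrow> real) \<Rightarrow> real) \<Rightarrow> bool" where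
  "coeff_seminorm \<phi> \<longleftrightarrow> (\<forall>a. 0 \<le> \<phi> a) \<and> (\<forall>a b. \<phi> (\<lambda>j. a j + b j) \<le> \<phi> a + \<phi> b) \<and>
     (\<forall>t a. \<phi> (\<lambda>j. t * a j) = \<bar>t\<bar> * \<phi> a)"

lemma even_binomial_part:
  fixes A B :: real
  shows "((A + B) ^ (2 * m) + (A - B) ^ (2 * m)) / 2
    = (\<Sum>i\<le>m. real (2 * m choose (2 * i)) * (A\<^sup>2) ^ (m - i) * (B\<^sup>2) ^ i)"
proof -
  have "((A + B) ^ (2 * m) + (A - B) ^ (2 * m)) / 2
    = (\<Sum>k\<le>2*m. (real (2 * m choose k) * B ^ k * A ^ (2 * m - k)
         + real (2 * m choose k) * (-B) ^ k * A ^ (2 * m - k)) / 2)"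
    using binomial_ring[of B A "2 * m"] binomial_ring[of "-B" A "2 * m"]
    by (simp add: sum.distrib sum_divide_distrib[symmetric] add.commute)
  also have "\<dots> = (\<Sum>k\<in>(\<lambda>i. 2 * i) ` {..m}. real (2 * m choose k) * B ^ k * A ^ (2 * m - k))"
  proof (rule sum.mono_neutral_cong_right)
    show "\<forall>k\<in>{..2*m} - (\<lambda>i. 2 * i) ` {..m}. (real (2 * m choose k) * B ^ k * A ^ (2 * m - k)
         + real (2 * m choose k) * (-B) ^ k * A ^ (2 * m - k)) / 2 = 0"
    proof
      fix k assume k: "k \<in> {..2*m} - (\<lambda>i. 2 * i) ` {..m}"
      have "odd k"
      proof
        assume "even k"
        then obtain i where "k = 2 * i" by (elim evenE)
        with k show False by auto
      qed
      then show "(real (2 * m choose k) * B ^ k * A ^ (2 * m - k)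
         + real (2 * m choose k) * (-B) ^ k * A ^ (2 * m - k)) / 2 = 0"
        by simp
    qed
  qed auto
  also have "\<dots> = (\<Sum>i\<le>m. real (2 * m choose (2 * i)) * B ^ (2 * i) * A ^ (2 * m - 2 * i))"
    by (subst sum.reindex) (auto simp: inj_on_def)
  also have "\<dots> = (\<Sum>i\<le>m. real (2 * m choose (2 * i)) * (A\<^sup>2) ^ (m - i) * (B\<^sup>2) ^ i)"
    by (intro sum.cong refl) (simp only: power_mult[symmetric] diff_mult_distrib2 mult.assoc mult.commute[of "B ^ _"])
  finally show ?thesis .
qed

text \<open>Hypercontractivity on two points: with a contraction factor as small as \<open>1 / (2 * m)\<close> the
  binomial expansions of both sides can be compared term by term, since
  \<open>binomial (2 * m) (2 * i) \<le> (2 * m) ^ (2 * i)\<close>.\<close>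

lemma two_point_hypercontractive:
  fixes u v w1 w2 :: real
  assumes m: "m \<ge> 1" and \<rho>: "\<rho> = 1 / (2 * real m)"
    and nn: "0 \<le> w1" "0 \<le> w2"
    and w1: "w1 \<le> (1 + \<rho>) / 2 * u + (1 - \<rho>) / 2 * v"
    and w2: "w2 \<le> (1 + \<rho>) / 2 * v + (1 - \<rho>) / 2 * u"
  shows "(w1 ^ (2 * m) + w2 ^ (2 * m)) / 2 \<le> ((u\<^sup>2 + v\<^sup>2) / 2) ^ m"
proof -
  define A B where "A = (u + v) / 2" and "B = (u - v) / 2"
  have "w1 \<le> A + \<rho> * B" "w2 \<le> A - \<rho> * B"
    using w1 w2 by (simp_all add: A_def B_def field_simps)
  then have "(w1 ^ (2 * m) + w2 ^ (2 * m)) / 2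
      \<le> ((A + \<rho> * B) ^ (2 * m) + (A - \<rho> * B) ^ (2 * m)) / 2"
    using nn by (intro divide_right_mono add_mono power_mono) auto
  also have "\<dots> = (\<Sum>i\<le>m. real (2 * m choose (2 * i)) * (A\<^sup>2) ^ (m - i) * ((\<rho> * B)\<^sup>2) ^ i)"
    by (rule even_binomial_part)
  also have "\<dots> \<le> (\<Sum>i\<le>m. real (m choose i) * (A\<^sup>2) ^ (m - i) * (B\<^sup>2) ^ i)"
  proof (rule sum_mono)
    fix i assume "i \<in> {..m}"
    then have i: "i \<le> m" by simp
    have "real (2 * m choose (2 * i)) * \<rho> ^ (2 * i) \<le> real ((2 * m) ^ (2 * i)) * \<rho> ^ (2 * i)"
      using i \<rho> by (intro mult_right_mono of_nat_mono binomial_le_pow) auto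
    also have "\<dots> = (real (2 * m) * \<rho>) ^ (2 * i)"
      by (simp only: power_mult_distrib[of "real (2 * m)"] of_nat_power)
    also have "real (2 * m) * \<rho> = 1"
      using m by (simp add: \<rho>)
    also have "(1 :: real) ^ (2 * i) = 1" by simp
    also have "1 \<le> real (m choose i)"
      using i by (simp add: Suc_leI)
    finally have "real (2 * m choose (2 * i)) * \<rho> ^ (2 * i) * ((A\<^sup>2) ^ (m - i) * (B\<^sup>2) ^ i)
        \<le> real (m choose i) * ((A\<^sup>2) ^ (m - i) * (B\<^sup>2) ^ i)"
      by (rule mult_right_mono) simp
    moreover have "((\<rho> * B)\<^sup>2) ^ i = \<rho> ^ (2 * i) * (B\<^sup>2) ^ i"
      by (simp only: power_mult_distrib power_mult)
    ultimately show "real (2 * m choose (2 * i)) * (A\<^sup>2) ^ (m - i) * ((\<rho> * B)\<^sup>2) ^ i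
        \<le> real (m choose i) * (A\<^sup>2) ^ (m - i) * (B\<^sup>2) ^ i"
      by (simp only: mult_ac)
  qed
  also have "\<dots> = (B\<^sup>2 + A\<^sup>2) ^ m"
    by (subst binomial_ring) (simp add: mult_ac)
  also have "B\<^sup>2 + A\<^sup>2 = (u\<^sup>2 + v\<^sup>2) / 2"
    by (simp add: A_def B_def power2_eq_square field_simps)
  finally show ?thesis .
qed

text \<open>By homogeneity, contracting all signs by \<open>\<rho>\<close> takes the factor \<open>\<rho> ^ (2 * m)\<close> out of the
  left-hand side when \<open>b\<close> is 0, which leaves a comparison of moments. The induction over the signs
  uses the two-point inequality for the \<open>L\<^sup>2\<close> seminorm \<open>q\<close> of the remaining signs; the
  entries of \<open>b\<close> stand for coefficients that are already fixed.\<close>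

lemma sign_hypercontractive:
  fixes \<phi> :: "('j \<Rightarrow> real) \<Rightarrow> real"
  assumes \<phi>: "coeff_seminorm \<phi>" and "finite J" and m: "m \<ge> 1" and \<rho>: "\<rho> = 1 / (2 * real m)"
  shows "sign_mean J (\<lambda>\<epsilon>. \<phi> (\<lambda>j. if j \<in> J then \<rho> * \<epsilon> j else b j) ^ (2 * m))
    \<le> (sign_mean J (\<lambda>\<epsilon>. (\<phi> (\<lambda>j. if j \<in> J then \<epsilon> j else b j))\<^sup>2)) ^ m"
  using \<open>finite J\<close>
proof (induction J arbitrary: b)
  case empty
  then show ?case by (simp add: power_mult)
next
  case (insert i J)
  have nn: "0 \<le> \<phi> a" and tri: "\<phi> (\<lambda>j. a j + b j) \<le> \<phi> a + \<phi> b"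
    and hom: "\<phi> (\<lambda>j. t * a j) = \<bar>t\<bar> * \<phi> a" for t a b
    using \<phi> unfolding coeff_seminorm_def by blast+
  have \<rho>01: "0 \<le> \<rho>" "\<rho> \<le> 1" using m by (auto simp: \<rho>)
  define c where "c \<epsilon> s = (\<lambda>j. if j = i then s else if j \<in> J then \<epsilon> j else b j)" for \<epsilon> s
  define q where "q s = sqrt (sign_mean J (\<lambda>\<epsilon>. (\<phi> (c \<epsilon> s))\<^sup>2))" for s
  have q2: "(q s)\<^sup>2 = sign_mean J (\<lambda>\<epsilon>. (\<phi> (c \<epsilon> s))\<^sup>2)" for s
    unfolding q_def by (simp add: sign_mean_nonneg)
  have q0: "0 \<le> q s" for s
    unfolding q_def by (simp add: sign_mean_nonneg)
  have step: "sign_mean J (\<lambda>\<epsilon>. \<phi> (\<lambda>j. if j \<in> insert i J then \<rho> * (\<epsilon>(i := s)) j else b j) ^ (2 * m))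
      \<le> q (\<rho> * s) ^ (2 * m)" for s
  proof -
    have eq: "(\<lambda>j. if j \<in> insert i J then \<rho> * (\<epsilon>(i := s)) j else b j)
       = (\<lambda>j. if j \<in> J then \<rho> * \<epsilon> j else (b(i := \<rho> * s)) j)" for \<epsilon>
      using insert.hyps by auto
    have "sign_mean J (\<lambda>\<epsilon>. \<phi> (\<lambda>j. if j \<in> insert i J then \<rho> * (\<epsilon>(i := s)) j else b j) ^ (2 * m))
      \<le> (sign_mean J (\<lambda>\<epsilon>. (\<phi> (\<lambda>j. if j \<in> J then \<epsilon> j else (b(i := \<rho> * s)) j))\<^sup>2)) ^ m"
      unfolding eq by (rule insert.IH)
    also have "(\<lambda>\<epsilon> j. if j \<in> J then \<epsilon> j else (b(i := \<rho> * s)) j) = (\<lambda>\<epsilon>. c \<epsilon> (\<rho> * s))"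
      using insert.hyps by (auto simp: c_def fun_eq_iff)
    finally show ?thesis
      by (simp only: power_mult q2)
  qed
  \<comment> \<open>\<open>c \<epsilon> t\<close> is a convex combination of \<open>c \<epsilon> 1\<close> and \<open>c \<epsilon> (-1)\<close>.\<close>
  have conv: "q t \<le> (1 + t) / 2 * q 1 + (1 - t) / 2 * q (-1)" if "\<bar>t\<bar> \<le> 1" for t
  proof -
    have "q t \<le> sqrt (sign_mean J (\<lambda>\<epsilon>. ((1 + t) / 2 * \<phi> (c \<epsilon> 1))\<^sup>2))
       + sqrt (sign_mean J (\<lambda>\<epsilon>. ((1 - t) / 2 * \<phi> (c \<epsilon> (-1)))\<^sup>2))"
      unfolding q_def
    proof (rule sign_mean_sq_triangle)
      fix \<epsilon>
      have "c \<epsilon> t = (\<lambda>j. (1 + t) / 2 * c \<epsilon> 1 j + (1 - t) / 2 * c \<epsilon> (-1) j)"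
        by (auto simp: c_def field_simps)
      then have "\<phi> (c \<epsilon> t) \<le> \<phi> (\<lambda>j. (1 + t) / 2 * c \<epsilon> 1 j) + \<phi> (\<lambda>j. (1 - t) / 2 * c \<epsilon> (-1) j)"
        by (simp only: tri)
      also have "\<dots> = (1 + t) / 2 * \<phi> (c \<epsilon> 1) + (1 - t) / 2 * \<phi> (c \<epsilon> (-1))"
        unfolding hom using that by simp
      finally show "0 \<le> \<phi> (c \<epsilon> t) \<and> \<phi> (c \<epsilon> t) \<le> (1 + t) / 2 * \<phi> (c \<epsilon> 1) + (1 - t) / 2 * \<phi> (c \<epsilon> (-1))"
        using nn by simp
      show "0 \<le> (1 + t) / 2 * \<phi> (c \<epsilon> 1) \<and> 0 \<le> (1 - t) / 2 * \<phi> (c \<epsilon> (-1))"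
        using nn that by simp
    qed (use insert.hyps in auto)
    also have "\<dots> = (1 + t) / 2 * q 1 + (1 - t) / 2 * q (-1)"
      unfolding q_def by (intro arg_cong2[of _ _ _ _ "(+)"] sqrt_sign_mean_scale) (use that in auto)
    finally show ?thesis .
  qed
  have "sign_mean (insert i J) (\<lambda>\<epsilon>. \<phi> (\<lambda>j. if j \<in> insert i J then \<rho> * \<epsilon> j else b j) ^ (2 * m))
      \<le> (q (\<rho> * 1) ^ (2 * m) + q (\<rho> * (-1)) ^ (2 * m)) / 2"
    unfolding sign_mean_insert[OF insert.hyps]
    by (rule divide_right_mono[OF add_mono[OF step step]]) simp
  also have "\<dots> \<le> (((q 1)\<^sup>2 + (q (-1))\<^sup>2) / 2) ^ m"
  proof (rule two_point_hypercontractive[OF m \<rho>])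
    show "q (\<rho> * 1) \<le> (1 + \<rho>) / 2 * q 1 + (1 - \<rho>) / 2 * q (-1)"
      using conv[of \<rho>] \<rho>01 by simp
    show "q (\<rho> * (-1)) \<le> (1 + \<rho>) / 2 * q (-1) + (1 - \<rho>) / 2 * q 1"
      using conv[of "-\<rho>"] \<rho>01 by simp
  qed (use q0 in auto)
  also have "((q 1)\<^sup>2 + (q (-1))\<^sup>2) / 2
      = sign_mean (insert i J) (\<lambda>\<epsilon>. (\<phi> (\<lambda>j. if j \<in> insert i J then \<epsilon> j else b j))\<^sup>2)"
  proof -
    have "(\<lambda>j. if j \<in> insert i J then (\<epsilon>(i := s)) j else b j) = c \<epsilon> s" for \<epsilon> s
      by (auto simp: c_def)
    then show ?thesis
      unfolding sign_mean_insert[OF insert.hyps] q2 by (simp only:)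
  qed
  finally show ?case .
qed

text \<open>Sign vectors are \<open>undefined\<close> outside \<open>J\<close>, so only seminorms with this property are meaningful
  on them.\<close>

definition depends_on :: "'j set \<Rightarrow> (('j \<Rightarrow> real) \<Rightarrow> real) \<Rightarrow> bool" where
  "depends_on J \<phi> \<longleftrightarrow> (\<forall>a b. (\<forall>j\<in>J. a j = b j) \<longrightarrow> \<phi> a = \<phi> b)"

lemma kahane_even:
  fixes \<phi> :: "('j \<Rightarrow> real) \<Rightarrow> real"
  assumes \<phi>: "coeff_seminorm \<phi>" "depends_on J \<phi>" and J: "finite J" and m: "m \<ge> 1"
  shows "sign_mean J (\<lambda>\<epsilon>. \<phi> \<epsilon> ^ (2 * m)) \<le> (2 * real m) ^ (2 * m) * (sign_mean J (\<lambda>\<epsilon>. (\<phi> \<epsilon>)\<^sup>2)) ^ m"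
proof -
  define \<rho> where "\<rho> = 1 / (2 * real m)"
  have \<rho>0: "\<rho> > 0" using m by (simp add: \<rho>_def)
  have hom: "\<phi> (\<lambda>j. t * a j) = \<bar>t\<bar> * \<phi> a" for t a
    using \<phi> unfolding coeff_seminorm_def by blast+
  have *: "\<phi> (\<lambda>j. if j \<in> J then \<epsilon> j else 0) = \<phi> \<epsilon>" for \<epsilon>
    by (rule \<phi>(2)[unfolded depends_on_def, rule_format]) simp
  have **: "\<phi> (\<lambda>j. if j \<in> J then \<rho> * \<epsilon> j else 0) = \<rho> * \<phi> \<epsilon>" for \<epsilon>
  proof -
    have "\<phi> (\<lambda>j. if j \<in> J then \<rho> * \<epsilon> j else 0) = \<phi> (\<lambda>j. \<rho> * \<epsilon> j)"
      by (rule \<phi>(2)[unfolded depends_on_def, rule_format]) simp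
    also have "\<dots> = \<bar>\<rho>\<bar> * \<phi> \<epsilon>" by (rule hom)
    finally show ?thesis using \<rho>0 by simp
  qed
  have "\<rho> ^ (2 * m) * sign_mean J (\<lambda>\<epsilon>. \<phi> \<epsilon> ^ (2 * m)) \<le> (sign_mean J (\<lambda>\<epsilon>. (\<phi> \<epsilon>)\<^sup>2)) ^ m"
    using sign_hypercontractive[OF \<phi>(1) J m \<rho>_def, of "\<lambda>_. 0"]
    unfolding ** power_mult_distrib sign_mean_cmult unfolding * .
  then have "(2 * real m) ^ (2 * m) * (\<rho> ^ (2 * m) * sign_mean J (\<lambda>\<epsilon>. \<phi> \<epsilon> ^ (2 * m)))
     \<le> (2 * real m) ^ (2 * m) * (sign_mean J (\<lambda>\<epsilon>. (\<phi> \<epsilon>)\<^sup>2)) ^ m"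
    by (rule mult_left_mono) simp
  moreover have "2 * real m * \<rho> = 1"
    using m by (simp add: \<rho>_def)
  then have "(2 * real m) ^ (2 * m) * \<rho> ^ (2 * m) = 1"
    by (simp only: power_mult_distrib[symmetric] power_one)
  ultimately show ?thesis
    by (simp only: mult.assoc[symmetric] mult_1)
qed

text \<open>Normalise the second moment to 1. Then the upper bound compares \<open>t powr p\<close> with
  \<open>1 + t ^ (2 * m)\<close>. The lower bound holds because a bounded fourth moment prevents the
  mass of the second moment from sitting where \<open>\<phi>\<close> is large, or where it is small.\<close>

lemma kahane:
  assumes p: "1 \<le> p"
  shows "\<exists>A\<ge>1. \<forall>(J :: 'j set) \<phi>. finite J \<longrightarrow> coeff_seminorm \<phi> \<longrightarrow> depends_on J \<phi> \<longrightarrow>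
    (sign_mean J (\<lambda>\<epsilon>. \<phi> \<epsilon> powr p)) powr (1 / p) \<le> A * sqrt (sign_mean J (\<lambda>\<epsilon>. (\<phi> \<epsilon>)\<^sup>2)) \<and>
    sqrt (sign_mean J (\<lambda>\<epsilon>. (\<phi> \<epsilon>)\<^sup>2)) \<le> A * (sign_mean J (\<lambda>\<epsilon>. \<phi> \<epsilon> powr p)) powr (1 / p)"
proof -
  define m where "m = nat \<lceil>p\<rceil>"
  have m: "m \<ge> 1" "p \<le> 2 * real m" using p by (auto simp: m_def) linarith+
  define A1 where "A1 = 1 + (2 * real m) ^ (2 * m)"
  define A where "A = max A1 2048"
  have A1: "1 \<le> A1" by (simp add: A1_def)
  have "(sign_mean J (\<lambda>\<epsilon>. \<phi> \<epsilon> powr p)) powr (1 / p) \<le> A * sqrt (sign_mean J (\<lambda>\<epsilon>. (\<phi> \<epsilon>)\<^sup>2)) \<and>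
        sqrt (sign_mean J (\<lambda>\<epsilon>. (\<phi> \<epsilon>)\<^sup>2)) \<le> A * (sign_mean J (\<lambda>\<epsilon>. \<phi> \<epsilon> powr p)) powr (1 / p)"
    if J: "finite J" and \<phi>: "coeff_seminorm \<phi>" "depends_on J \<phi>" for J :: "'j set" and \<phi>
  proof -
    define D where "D = sqrt (sign_mean J (\<lambda>\<epsilon>. (\<phi> \<epsilon>)\<^sup>2))"
    have nn: "0 \<le> \<phi> a" for a using \<phi> unfolding coeff_seminorm_def by blast+
    have D0: "0 \<le> D" and D2: "D\<^sup>2 = sign_mean J (\<lambda>\<epsilon>. (\<phi> \<epsilon>)\<^sup>2)"
      by (simp_all add: D_def sign_mean_nonneg)
    show ?thesis
    proof (cases "D = 0")
      case True
      then have "sign_mean J (\<lambda>\<epsilon>. (\<phi> \<epsilon>)\<^sup>2) = 0" using D2 by simp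
      then have "\<phi> \<epsilon> = 0" if "\<epsilon> \<in> signs J" for \<epsilon>
        using sign_mean_eq_0D[OF J _ _ that, of "\<lambda>\<epsilon>. (\<phi> \<epsilon>)\<^sup>2"] by simp
      then have "sign_mean J (\<lambda>\<epsilon>. \<phi> \<epsilon> powr p) = sign_mean J (\<lambda>\<epsilon>. 0)"
        by (intro sign_mean_cong) simp
      then show ?thesis using True J by (simp add: D_def)
    next
      case False
      then have D: "D > 0" using D0 by simp
      define t where "t \<epsilon> = \<phi> \<epsilon> / D" for \<epsilon>
      have t0: "0 \<le> t \<epsilon>" for \<epsilon> using nn D by (simp add: t_def)
      have t2: "sign_mean J (\<lambda>\<epsilon>. (t \<epsilon>)\<^sup>2) = 1"
        using sign_mean_cmult[of J "1 / D\<^sup>2" "\<lambda>\<epsilon>. (\<phi> \<epsilon>)\<^sup>2"] D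
        by (simp add: t_def power_divide flip: D2)
      have teven: "sign_mean J (\<lambda>\<epsilon>. t \<epsilon> ^ (2 * l)) \<le> (2 * real l) ^ (2 * l)" if "l \<ge> 1" for l
      proof -
        have "sign_mean J (\<lambda>\<epsilon>. t \<epsilon> ^ (2 * l)) = (1 / D ^ (2 * l)) * sign_mean J (\<lambda>\<epsilon>. \<phi> \<epsilon> ^ (2 * l))"
          unfolding sign_mean_cmult[symmetric] by (simp add: t_def power_divide)
        also have "\<dots> \<le> (1 / D ^ (2 * l)) * ((2 * real l) ^ (2 * l) * (D\<^sup>2) ^ l)"
          using kahane_even[OF \<phi> J that] D D2 by (intro mult_left_mono) auto
        also have "\<dots> = (2 * real l) ^ (2 * l)"
          using D by (simp add: power_mult)
        finally show ?thesis .
      qed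
      define P where "P = sign_mean J (\<lambda>\<epsilon>. t \<epsilon> powr p)"
      have P0: "0 \<le> P" unfolding P_def by (intro sign_mean_nonneg) simp
      have \<phi>t: "sign_mean J (\<lambda>\<epsilon>. \<phi> \<epsilon> powr p) = D powr p * P"
        unfolding P_def sign_mean_cmult[symmetric]
        by (intro sign_mean_cong) (use D nn in \<open>simp add: t_def powr_divide\<close>)
      have root: "(sign_mean J (\<lambda>\<epsilon>. \<phi> \<epsilon> powr p)) powr (1 / p) = D * P powr (1 / p)"
        unfolding \<phi>t using D P0 p by (simp add: powr_mult powr_powr)
      have "P \<le> sign_mean J (\<lambda>\<epsilon>. 1 + t \<epsilon> ^ (2 * m))"
        unfolding P_def
      proof (rule sign_mean_mono)
        fix \<epsilon>
        show "t \<epsilon> powr p \<le> 1 + t \<epsilon> ^ (2 * m)"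
        proof (cases "t \<epsilon> \<le> 1")
          case True
          then have "t \<epsilon> powr p \<le> 1" using t0 p by (simp add: powr_le1)
          then show ?thesis using t0[of \<epsilon>] by (simp add: add_increasing2)
        next
          case False
          then have "t \<epsilon> powr p \<le> t \<epsilon> powr (2 * real m)" using m by (intro powr_mono) auto
          also have "\<dots> = t \<epsilon> ^ (2 * m)" using False by (simp add: powr_realpow[symmetric])
          finally show ?thesis by simp
        qed
      qed
      also have "\<dots> \<le> A1"
        using teven[OF m(1)] J by (simp add: sign_mean_add A1_def)
      finally have "P \<le> A1" .
      then have "P powr (1 / p) \<le> A1 powr (1 / p)"
        using P0 p by (intro powr_mono2) auto
      also have "\<dots> \<le> A1 powr 1" using A1 p by (intro powr_mono) auto
      also have "\<dots> \<le> A" using A1 by (simp add: A_def)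
      finally have up: "P powr (1 / p) \<le> A" .
      have t4: "sign_mean J (\<lambda>\<epsilon>. t \<epsilon> ^ 4) \<le> 256"
        using teven[of 2] by simp
      \<comment> \<open>Where \<open>t\<close> exceeds 512, its square is at most \<open>t ^ 4 / 512\<close>, of mean at most
        \<open>256 / 512 = 1 / 2\<close>. The other half of the second moment is at most 512 times the mean.\<close>
      have "sign_mean J (\<lambda>\<epsilon>. (t \<epsilon>)\<^sup>2) \<le> sign_mean J (\<lambda>\<epsilon>. 512 * t \<epsilon> + 1 / 512 * t \<epsilon> ^ 4)"
      proof (rule sign_mean_mono)
        fix \<epsilon>
        show "(t \<epsilon>)\<^sup>2 \<le> 512 * t \<epsilon> + 1 / 512 * t \<epsilon> ^ 4"
        proof (cases "t \<epsilon> \<le> 512")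
          case True
          then have "t \<epsilon> * t \<epsilon> \<le> 512 * t \<epsilon>" by (rule mult_right_mono[OF _ t0])
          then show ?thesis using t0[of \<epsilon>] by (simp add: power2_eq_square add_increasing2)
        next
          case False
          then have "512 * 1 \<le> t \<epsilon> * t \<epsilon>" by (intro mult_mono) auto
          then have "512 * (t \<epsilon>)\<^sup>2 \<le> (t \<epsilon> * t \<epsilon>) * (t \<epsilon>)\<^sup>2"
            by (intro mult_right_mono) auto
          also have "\<dots> = t \<epsilon> ^ 4" by (simp add: power2_eq_square power4_eq_xxxx)
          finally show ?thesis using t0[of \<epsilon>] by simp
        qed
      qed
      also have "\<dots> = 512 * sign_mean J t + 1 / 512 * sign_mean J (\<lambda>\<epsilon>. t \<epsilon> ^ 4)"
        unfolding sign_mean_add sign_mean_cmult ..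
      finally have Et: "1 / 1024 \<le> sign_mean J t" using t4 t2 by simp
      \<comment> \<open>At least half of the mean comes from signs with \<open>t \<epsilon> > d\<close>, where \<open>t\<close> is controlled by its power.\<close>
      define d :: real where "d = 1 / 2048"
      have d: "d > 0" "2 * d = 1 / 1024" by (auto simp: d_def)
      have "2 * d \<le> sign_mean J (\<lambda>\<epsilon>. d + d powr (1 - p) * t \<epsilon> powr p)"
        unfolding d(2)
      proof (rule order_trans[OF Et sign_mean_mono])
        fix \<epsilon>
        show "t \<epsilon> \<le> d + d powr (1 - p) * t \<epsilon> powr p"
        proof (cases "t \<epsilon> \<le> d")
          case True
          then show ?thesis by (simp add: add_increasing2)
        next
          case False
          then have t: "t \<epsilon> > 0" using d by simp
          have "1 \<le> (t \<epsilon> / d) powr (p - 1)"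
            using False d p by (intro ge_one_powr_ge_zero) auto
          then have "t \<epsilon> * 1 \<le> t \<epsilon> * (t \<epsilon> / d) powr (p - 1)"
            using t by (intro mult_left_mono) auto
          also have "\<dots> = d powr (1 - p) * t \<epsilon> powr p"
            using t d by (simp add: powr_divide powr_diff field_simps)
          finally show ?thesis using d by simp
        qed
      qed
      also have "\<dots> = d + d powr (1 - p) * P"
        unfolding sign_mean_add sign_mean_cmult P_def using J by simp
      finally have "d \<le> d powr (1 - p) * P" by simp
      then have "d powr p \<le> P"
        using d by (simp add: powr_diff field_simps)
      then have "(d powr p) powr (1 / p) \<le> P powr (1 / p)"
        using p d by (intro powr_mono2) auto
      then have "d \<le> P powr (1 / p)"
        using p d by (simp add: powr_powr)
      then have "1 \<le> 2048 * P powr (1 / p)" by (simp add: d_def)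
      also have "\<dots> \<le> A * P powr (1 / p)" by (intro mult_right_mono) (auto simp: A_def)
      finally have lo: "1 \<le> A * P powr (1 / p)" .
      have "D * P powr (1 / p) \<le> D * A" using up D by (intro mult_left_mono) auto
      moreover have "D * 1 \<le> D * (A * P powr (1 / p))" using lo D by (intro mult_left_mono) auto
      ultimately show ?thesis
        unfolding root D_def[symmetric] by (simp add: mult_ac)
    qed
  qed
  moreover have "A \<ge> 1" by (simp add: A_def)
  ultimately show ?thesis by blast
qed

section \<open>Strong measurability and Bochner integrals\<close>

lemma strongly_measurable_const: "strongly_measurable M (\<lambda>x. c)"
  unfolding strongly_measurable_def by (intro exI[of _ "\<lambda>i x. c"]) auto

lemma strongly_measurable_add:
  fixes f g :: "'m \<Rightarrow> 'a::real_normed_vector"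
  assumes "strongly_measurable M f" "strongly_measurable M g"
  shows "strongly_measurable M (\<lambda>x. f x + g x)"
proof -
  obtain s t where s: "\<forall>i. simple_function M (s i)" "\<forall>x\<in>space M. (\<lambda>i. s i x) \<longlonglongrightarrow> f x"
    and t: "\<forall>i. simple_function M (t i)" "\<forall>x\<in>space M. (\<lambda>i. t i x) \<longlonglongrightarrow> g x"
    using assms unfolding strongly_measurable_def by auto
  show ?thesis
    unfolding strongly_measurable_def
    using s t
    by (intro exI[of _ "\<lambda>i x. s i x + t i x"] conjI)
       (auto intro: simple_function_compose2[where h = "(+)"] tendsto_add)
qed

lemma strongly_measurable_scaleR:
  fixes f :: "'m \<Rightarrow> 'a::real_normed_vector" and a :: "'m \<Rightarrow> real"
  assumes "a \<in> borel_measurable M" "strongly_measurable M f"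
  shows "strongly_measurable M (\<lambda>x. a x *\<^sub>R f x)"
proof -
  have "strongly_measurable M a" using assms(1) by (simp add: strongly_measurable_iff)
  then obtain s t where s: "\<forall>i. simple_function M (s i)" "\<forall>x\<in>space M. (\<lambda>i. s i x) \<longlonglongrightarrow> a x"
    and t: "\<forall>i. simple_function M (t i)" "\<forall>x\<in>space M. (\<lambda>i. t i x) \<longlonglongrightarrow> f x"
    using assms(2) unfolding strongly_measurable_def by auto
  show ?thesis
    unfolding strongly_measurable_def
    using s t
    by (intro exI[of _ "\<lambda>i x. s i x *\<^sub>R t i x"] conjI)
       (auto intro: simple_function_compose2[where h = "(*\<^sub>R)"] tendsto_scaleR)
qed

lemma strongly_measurable_norm:
  "strongly_measurable M f \<Longrightarrow> (\<lambda>x. norm (f x)) \<in> borel_measurable M"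
  by (rule measurable_compose[OF strongly_measurable_borel borel_measurable_norm])

abbreviation "step_integrable \<equiv> Bochner_Integration.simple_bochner_integrable"
abbreviation "step_integral \<equiv> Bochner_Integration.simple_bochner_integral"

lemma step_integrable_strongly_measurable:
  "step_integrable M s \<Longrightarrow> strongly_measurable M s"
  unfolding strongly_measurable_def
  by (intro exI[of _ "\<lambda>_. s"]) (auto elim: Bochner_Integration.simple_bochner_integrable.cases)

lemma has_integral_in_simple:
  assumes "step_integrable M s"
  shows "has_integral_in M s (step_integral M s)"
  unfolding has_integral_in_def using assms step_integrable_strongly_measurable[OF assms]
  by (intro conjI exI[of _ "\<lambda>i. s"]) auto

lemma strongly_measurable_norm_diff:
  fixes f g :: "'m \<Rightarrow> 'a::real_normed_vector"
  assumes "strongly_measurable M f" "strongly_measurable M g"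
  shows "(\<lambda>x. norm (f x - g x)) \<in> borel_measurable M"
proof -
  have "strongly_measurable M (\<lambda>x. f x + (-1) *\<^sub>R g x)"
    by (intro strongly_measurable_add strongly_measurable_scaleR assms) simp
  then show ?thesis by (auto dest: strongly_measurable_norm)
qed

lemma step_integral_dist_le:
  fixes f :: "'m \<Rightarrow> 'a::real_normed_vector"
  assumes f: "strongly_measurable M f" and s: "step_integrable M s" and t: "step_integrable M t"
  shows "ennreal (dist (step_integral M s) (step_integral M t))
    \<le> (\<integral>\<^sup>+x. ennreal (norm (f x - s x)) \<partial>M) + (\<integral>\<^sup>+x. ennreal (norm (f x - t x)) \<partial>M)"
proof -
  have [measurable]: "(\<lambda>x. norm (f x - s x)) \<in> borel_measurable M" "(\<lambda>x. norm (f x - t x)) \<in> borel_measurable M"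
    using f s t by (auto intro: strongly_measurable_norm_diff step_integrable_strongly_measurable)
  have d: "step_integrable M (\<lambda>x. s x - t x)" and nd: "step_integrable M (\<lambda>x. norm (s x - t x))"
    by (rule Bochner_Integration.simple_bochner_integrable_compose2[OF _ s t], simp)+
  have "ennreal (dist (step_integral M s) (step_integral M t)) = ennreal (norm (step_integral M (\<lambda>x. s x - t x)))"
    by (simp add: dist_norm Bochner_Integration.simple_bochner_integral_diff s t)
  also have "\<dots> \<le> ennreal (step_integral M (\<lambda>x. norm (s x - t x)))"
    by (intro ennreal_leI Bochner_Integration.simple_bochner_integral_norm_bound d)
  also have "\<dots> = (\<integral>\<^sup>+x. ennreal (norm (s x - t x)) \<partial>M)"
    using nd by (simp add: Bochner_Integration.simple_bochner_integral_eq_nn_integral)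
  also have "\<dots> \<le> (\<integral>\<^sup>+x. ennreal (norm (f x - s x)) + ennreal (norm (f x - t x)) \<partial>M)"
  proof (intro nn_integral_mono)
    fix x
    have "norm (s x - t x) \<le> norm (f x - s x) + norm (f x - t x)"
      using norm_triangle_ineq4[of "f x - t x" "f x - s x"] by simp
    then show "ennreal (norm (s x - t x)) \<le> ennreal (norm (f x - s x)) + ennreal (norm (f x - t x))"
      by (simp flip: ennreal_plus)
  qed
  also have "\<dots> = (\<integral>\<^sup>+x. ennreal (norm (f x - s x)) \<partial>M) + (\<integral>\<^sup>+x. ennreal (norm (f x - t x)) \<partial>M)"
    by (intro nn_integral_add) measurable
  finally show ?thesis .
qed

text \<open>For a strongly measurable limit of simple functions, those values that exceed twice the
  limit in norm are reset to 0. The truncated functions still converge, and \<open>3 * norm (f x)\<close>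
  dominates the error.\<close>

lemma has_integral_in_exists:
  fixes f :: "'m \<Rightarrow> 'a::banach"
  assumes sm: "strongly_measurable M f" and fin: "(\<integral>\<^sup>+x. ennreal (norm (f x)) \<partial>M) < \<infinity>"
  shows "\<exists>y. has_integral_in M f y"
proof -
  obtain u where u: "\<And>i. simple_function M (u i)" "\<And>x. x \<in> space M \<Longrightarrow> (\<lambda>i. u i x) \<longlonglongrightarrow> f x"
    using sm unfolding strongly_measurable_def by auto
  have nf[measurable]: "(\<lambda>x. norm (f x)) \<in> borel_measurable M"
    using sm by (rule strongly_measurable_norm)
  have nu[measurable]: "(\<lambda>x. norm (u i x)) \<in> borel_measurable M" for i
    using simple_function_compose1[OF u(1), of norm] by (rule borel_measurable_simple_function)
  define s where "s i x = (if norm (u i x) \<le> 2 * norm (f x) then u i x else 0)" for i x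
  have sf: "simple_function M (s i)" for i
    unfolding s_def by (intro simple_function_If u(1) simple_function_const) measurable
  have slim: "(\<lambda>i. s i x) \<longlonglongrightarrow> f x" if "x \<in> space M" for x
  proof (cases "f x = 0")
    case True
    then have "s i x = 0" for i by (simp add: s_def)
    then show ?thesis using True by simp
  next
    case False
    have "(\<lambda>i. norm (u i x)) \<longlonglongrightarrow> norm (f x)" by (intro tendsto_norm u(2) that)
    moreover have "norm (f x) < 2 * norm (f x)" using False by simp
    ultimately have "\<forall>\<^sub>F i in sequentially. norm (u i x) < 2 * norm (f x)"
      by (rule order_tendstoD(2))
    then have "\<forall>\<^sub>F i in sequentially. u i x = s i x"
      by eventually_elim (simp add: s_def)
    then show ?thesis by (rule Lim_transform_eventually[OF u(2)[OF that]])
  qed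
  have snorm: "norm (s i x) \<le> 2 * norm (f x)" for i x by (simp add: s_def)
  have sint: "step_integrable M (s i)" for i
  proof (rule Bochner_Integration.simple_bochner_integrableI_bounded[OF sf])
    have "(\<integral>\<^sup>+x. ennreal (norm (s i x)) \<partial>M) \<le> (\<integral>\<^sup>+x. 2 * ennreal (norm (f x)) \<partial>M)"
      by (intro nn_integral_mono) (simp add: snorm ennreal_mult'[symmetric] flip: ennreal_numeral)
    also have "\<dots> = 2 * (\<integral>\<^sup>+x. ennreal (norm (f x)) \<partial>M)"
      by (intro nn_integral_cmult) measurable
    also have "\<dots> < \<infinity>" using fin by (simp add: ennreal_mult_less_top)
    finally show "(\<integral>\<^sup>+x. ennreal (norm (s i x)) \<partial>M) < \<infinity>" .
  qed
  have [measurable]: "(\<lambda>x. norm (f x - s i x)) \<in> borel_measurable M" for i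
    by (intro strongly_measurable_norm_diff sm step_integrable_strongly_measurable sint)
  have lim0: "(\<lambda>i. \<integral>\<^sup>+x. ennreal (norm (f x - s i x)) \<partial>M) \<longlonglongrightarrow> (\<integral>\<^sup>+x. 0 \<partial>M)"
  proof (rule nn_integral_dominated_convergence[where w = "\<lambda>x. ennreal (3 * norm (f x))"])
    fix i
    show "AE x in M. ennreal (norm (f x - s i x)) \<le> ennreal (3 * norm (f x))"
    proof (rule AE_I2, rule ennreal_leI)
      fix x
      show "norm (f x - s i x) \<le> 3 * norm (f x)"
        using norm_triangle_ineq4[of "f x" "s i x"] snorm[of i x] by simp
    qed
  next
    have "(\<integral>\<^sup>+x. ennreal (3 * norm (f x)) \<partial>M) = 3 * (\<integral>\<^sup>+x. ennreal (norm (f x)) \<partial>M)"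
      by (subst nn_integral_cmult[symmetric]) (auto simp: ennreal_mult' intro!: nn_integral_cong)
    also have "\<dots> < \<infinity>" using fin by (simp add: ennreal_mult_less_top)
    finally show "(\<integral>\<^sup>+x. ennreal (3 * norm (f x)) \<partial>M) < \<infinity>" .
    show "AE x in M. (\<lambda>i. ennreal (norm (f x - s i x))) \<longlonglongrightarrow> 0"
    proof (rule AE_I2)
      fix x assume "x \<in> space M"
      then have "(\<lambda>i. norm (f x - s i x)) \<longlonglongrightarrow> norm (f x - f x)"
        by (intro tendsto_intros slim)
      then show "(\<lambda>i. ennreal (norm (f x - s i x))) \<longlonglongrightarrow> 0"
        by (simp add: ennreal_0[symmetric] del: ennreal_0)
    qed
  qed measurable
  then have lim0: "(\<lambda>i. \<integral>\<^sup>+x. ennreal (norm (f x - s i x)) \<partial>M) \<longlonglongrightarrow> 0" by simp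
  have "Cauchy (\<lambda>i. step_integral M (s i))"
  proof (rule metric_CauchyI)
    fix e :: real assume e: "0 < e"
    then have "\<forall>\<^sub>F i in sequentially. (\<integral>\<^sup>+x. ennreal (norm (f x - s i x)) \<partial>M) < ennreal (e / 2)"
      by (intro order_tendstoD(2)[OF lim0]) simp
    then obtain N where N: "\<And>i. i \<ge> N \<Longrightarrow> (\<integral>\<^sup>+x. ennreal (norm (f x - s i x)) \<partial>M) < ennreal (e / 2)"
      by (auto simp: eventually_sequentially)
    show "\<exists>N. \<forall>m\<ge>N. \<forall>n\<ge>N. dist (step_integral M (s m)) (step_integral M (s n)) < e"
    proof (intro exI[of _ N] allI impI)
      fix i j assume "N \<le> i" "N \<le> j"
      then have "ennreal (dist (step_integral M (s i)) (step_integral M (s j)))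
          < ennreal (e / 2) + ennreal (e / 2)"
        by (intro le_less_trans[OF step_integral_dist_le[OF sm sint sint]] add_strict_mono N)
      also have "\<dots> = ennreal e" using e by (simp flip: ennreal_plus)
      finally show "dist (step_integral M (s i)) (step_integral M (s j)) < e"
        using e by (simp add: ennreal_less_iff)
    qed
  qed
  then obtain y where "(\<lambda>i. step_integral M (s i)) \<longlonglongrightarrow> y"
    using Cauchy_convergent_iff convergent_def by metis
  then show ?thesis
    unfolding has_integral_in_def using sm sint lim0 by blast
qed

lemma has_integral_in_zero: "has_integral_in M (\<lambda>x. 0 :: 'b::real_normed_vector) 0"
  and step_integrable_zero: "step_integrable M (\<lambda>x. 0 :: 'b)"
  and step_integral_zero: "step_integral M (\<lambda>x. 0 :: 'b) = 0"
proof -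
  show i: "step_integrable M (\<lambda>x. 0 :: 'b)"
    by (intro Bochner_Integration.simple_bochner_integrable.intros) auto
  show z: "step_integral M (\<lambda>x. 0 :: 'b) = 0"
    unfolding Bochner_Integration.simple_bochner_integral_def by (rule sum.neutral) auto
  show "has_integral_in M (\<lambda>x. 0 :: 'b) 0"
    using has_integral_in_simple[OF i] by (simp only: z)
qed

lemma has_integral_in_norm_le:
  fixes f :: "'m \<Rightarrow> 'a::real_normed_vector"
  assumes "has_integral_in M f y"
  shows "ennreal (norm y) \<le> (\<integral>\<^sup>+x. ennreal (norm (f x)) \<partial>M)"
proof -
  have sm: "strongly_measurable M f" using assms by (simp add: has_integral_in_def)
  obtain s where s: "\<And>i. step_integrable M (s i)"
    and s0: "(\<lambda>i. \<integral>\<^sup>+x. ennreal (norm (f x - s i x)) \<partial>M) \<longlonglongrightarrow> 0"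
    and sy: "(\<lambda>i. step_integral M (s i)) \<longlonglongrightarrow> y"
    using assms unfolding has_integral_in_def by auto
  have bound: "ennreal (norm (step_integral M (s i)))
      \<le> (\<integral>\<^sup>+x. ennreal (norm (f x - s i x)) \<partial>M) + (\<integral>\<^sup>+x. ennreal (norm (f x)) \<partial>M)" for i
    using step_integral_dist_le[OF sm s step_integrable_zero, of i] by (simp add: step_integral_zero)
  have "(\<lambda>i. ennreal (norm (step_integral M (s i)))) \<longlonglongrightarrow> ennreal (norm y)"
    by (intro tendsto_ennrealI tendsto_norm sy)
  moreover have "(\<lambda>i. (\<integral>\<^sup>+x. ennreal (norm (f x - s i x)) \<partial>M) + (\<integral>\<^sup>+x. ennreal (norm (f x)) \<partial>M))
      \<longlonglongrightarrow> 0 + (\<integral>\<^sup>+x. ennreal (norm (f x)) \<partial>M)"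
    by (intro tendsto_add tendsto_const s0)
  ultimately have "ennreal (norm y) \<le> 0 + (\<integral>\<^sup>+x. ennreal (norm (f x)) \<partial>M)"
    by (rule LIMSEQ_le) (use bound in blast)
  then show ?thesis by simp
qed

lemma has_integral_in_add:
  fixes f g :: "'m \<Rightarrow> 'a::real_normed_vector"
  assumes "has_integral_in M f y" "has_integral_in M g z"
  shows "has_integral_in M (\<lambda>x. f x + g x) (y + z)"
proof -
  have sm: "strongly_measurable M f" "strongly_measurable M g"
    using assms by (simp_all add: has_integral_in_def)
  obtain s where s: "\<And>i. step_integrable M (s i)"
    and s0: "(\<lambda>i. \<integral>\<^sup>+x. ennreal (norm (f x - s i x)) \<partial>M) \<longlonglongrightarrow> 0"
    and sy: "(\<lambda>i. step_integral M (s i)) \<longlonglongrightarrow> y"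
    using assms(1) unfolding has_integral_in_def by auto
  obtain t where t: "\<And>i. step_integrable M (t i)"
    and t0: "(\<lambda>i. \<integral>\<^sup>+x. ennreal (norm (g x - t i x)) \<partial>M) \<longlonglongrightarrow> 0"
    and tz: "(\<lambda>i. step_integral M (t i)) \<longlonglongrightarrow> z"
    using assms(2) unfolding has_integral_in_def by auto
  have [measurable]: "(\<lambda>x. norm (f x - s i x)) \<in> borel_measurable M"
    "(\<lambda>x. norm (g x - t i x)) \<in> borel_measurable M" for i
    using sm s t by (auto intro: strongly_measurable_norm_diff step_integrable_strongly_measurable)
  have st: "step_integrable M (\<lambda>x. s i x + t i x)" for i
    by (rule Bochner_Integration.simple_bochner_integrable_compose2[OF _ s t]) simp
  have "(\<lambda>i. \<integral>\<^sup>+x. ennreal (norm ((f x + g x) - (s i x + t i x))) \<partial>M) \<longlonglongrightarrow> 0"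
  proof (rule tendsto_sandwich[of "\<lambda>_. 0", OF _ _ tendsto_const])
    show "\<forall>\<^sub>F i in sequentially. (\<integral>\<^sup>+x. ennreal (norm ((f x + g x) - (s i x + t i x))) \<partial>M)
      \<le> (\<integral>\<^sup>+x. ennreal (norm (f x - s i x)) \<partial>M) + (\<integral>\<^sup>+x. ennreal (norm (g x - t i x)) \<partial>M)"
    proof (intro always_eventually allI)
      fix i
      have "(\<integral>\<^sup>+x. ennreal (norm ((f x + g x) - (s i x + t i x))) \<partial>M)
        \<le> (\<integral>\<^sup>+x. ennreal (norm (f x - s i x)) + ennreal (norm (g x - t i x)) \<partial>M)"
        by (intro nn_integral_mono) (simp add: norm_diff_triangle_ineq flip: ennreal_plus)
      also have "\<dots> = (\<integral>\<^sup>+x. ennreal (norm (f x - s i x)) \<partial>M) + (\<integral>\<^sup>+x. ennreal (norm (g x - t i x)) \<partial>M)"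
        by (intro nn_integral_add) measurable
      finally show "(\<integral>\<^sup>+x. ennreal (norm ((f x + g x) - (s i x + t i x))) \<partial>M) \<le> \<dots>" .
    qed
    show "(\<lambda>i. (\<integral>\<^sup>+x. ennreal (norm (f x - s i x)) \<partial>M) + (\<integral>\<^sup>+x. ennreal (norm (g x - t i x)) \<partial>M)) \<longlonglongrightarrow> 0"
      using tendsto_add[OF s0 t0] by simp
  qed simp
  moreover have "(\<lambda>i. step_integral M (\<lambda>x. s i x + t i x)) \<longlonglongrightarrow> y + z"
    unfolding Bochner_Integration.simple_bochner_integral_add[OF s t] by (intro tendsto_add sy tz)
  ultimately show ?thesis
    unfolding has_integral_in_def
    by (intro conjI strongly_measurable_add sm exI[of _ "\<lambda>i x. s i x + t i x"] allI st)
qed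

lemma has_integral_in_scaleR:
  fixes f :: "'m \<Rightarrow> 'a::real_normed_vector"
  assumes "has_integral_in M f y"
  shows "has_integral_in M (\<lambda>x. c *\<^sub>R f x) (c *\<^sub>R y)"
proof -
  have sm: "strongly_measurable M f"
    using assms by (simp_all add: has_integral_in_def)
  obtain s where s: "\<And>i. step_integrable M (s i)"
    and s0: "(\<lambda>i. \<integral>\<^sup>+x. ennreal (norm (f x - s i x)) \<partial>M) \<longlonglongrightarrow> 0"
    and sy: "(\<lambda>i. step_integral M (s i)) \<longlonglongrightarrow> y"
    using assms(1) unfolding has_integral_in_def by auto
  have [measurable]: "(\<lambda>x. norm (f x - s i x)) \<in> borel_measurable M" for i
    by (intro strongly_measurable_norm_diff sm step_integrable_strongly_measurable s)
  have cs: "step_integrable M (\<lambda>x. c *\<^sub>R s i x)" for i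
    by (rule Bochner_Integration.simple_bochner_integrable_compose2[where p = "\<lambda>u v. c *\<^sub>R u", OF _ s s]) simp
  have "(\<integral>\<^sup>+x. ennreal (norm (c *\<^sub>R f x - c *\<^sub>R s i x)) \<partial>M)
      = ennreal \<bar>c\<bar> * (\<integral>\<^sup>+x. ennreal (norm (f x - s i x)) \<partial>M)" for i
    by (subst nn_integral_cmult[symmetric])
       (auto simp: scaleR_diff_right[symmetric] ennreal_mult intro!: nn_integral_cong)
  moreover have "(\<lambda>i. ennreal \<bar>c\<bar> * (\<integral>\<^sup>+x. ennreal (norm (f x - s i x)) \<partial>M)) \<longlonglongrightarrow> ennreal \<bar>c\<bar> * 0"
    by (intro ennreal_tendsto_cmult s0) simp
  ultimately have "(\<lambda>i. \<integral>\<^sup>+x. ennreal (norm (c *\<^sub>R f x - c *\<^sub>R s i x)) \<partial>M) \<longlonglongrightarrow> 0"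
    by simp
  moreover have "(\<lambda>i. step_integral M (\<lambda>x. c *\<^sub>R s i x)) \<longlonglongrightarrow> c *\<^sub>R y"
    unfolding Bochner_Integration.simple_bochner_integral_linear[OF linear_scaleR s] by (intro tendsto_scaleR tendsto_const sy)
  ultimately show ?thesis
    unfolding has_integral_in_def
    by (intro conjI strongly_measurable_scaleR sm exI[of _ "\<lambda>i x. c *\<^sub>R s i x"] allI cs) auto
qed

lemma has_integral_in_sum:
  fixes f :: "'i \<Rightarrow> 'm \<Rightarrow> 'a::real_normed_vector"
  assumes "\<And>i. i \<in> I \<Longrightarrow> has_integral_in M (f i) (y i)"
  shows "has_integral_in M (\<lambda>x. \<Sum>i\<in>I. f i x) (\<Sum>i\<in>I. y i)"
  using assms
  by (induction I rule: infinite_finite_induct)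
     (auto intro: has_integral_in_zero has_integral_in_add)

section \<open>The Lebesgue-Bochner seminorm\<close>

lemma powr_tangent:
  fixes t c p :: real
  assumes p: "1 \<le> p" and t: "0 \<le> t" and c: "0 < c"
  shows "c powr p + p * c powr (p - 1) * (t - c) \<le> t powr p"
proof (cases "t = 0")
  case True
  have "c powr p = c * c powr (p - 1)" using c by (simp add: powr_diff)
  then show ?thesis using True p c by (simp add: mult_left_mono algebra_simps)
next
  case False
  then have t: "t > 0" using t by simp
  have "t * c powr (p - 1) = (t powr p) powr (1 / p) * (c powr p) powr (1 - 1 / p)"
    using p t c by (simp add: powr_powr right_diff_distrib)
  also have "\<dots> \<le> 1 / p * t powr p + (1 - 1 / p) * c powr p"
    using p t c by (intro Youngs_inequality_0) auto
  finally have "p * (t * c powr (p - 1)) \<le> p * (1 / p * t powr p + (1 - 1 / p) * c powr p)"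
    using p by (intro mult_left_mono) auto
  also have "\<dots> = t powr p + (p - 1) * c powr p"
    using p by (simp add: field_simps)
  finally have "p * (t * c powr (p - 1)) \<le> t powr p + (p - 1) * c powr p" .
  moreover have "c powr p = c * c powr (p - 1)" using c by (simp add: powr_diff)
  ultimately show ?thesis by (simp only: ring_distribs) (simp add: algebra_simps)
qed

lemma le_one_plus_powr:
  fixes t p :: real
  assumes "1 \<le> p" "0 \<le> t"
  shows "t \<le> 1 + t powr p"
proof (cases "t \<le> 1")
  case False
  have "1 + p * (t - 1) \<le> t powr p"
    using powr_tangent[OF assms, of 1] by simp
  moreover have "1 * (t - 1) \<le> p * (t - 1)" using False assms by (intro mult_right_mono) auto
  ultimately show ?thesis by simp
qed (simp add: add_increasing2)

lemma convex_powr: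
  fixes a b l p :: real
  assumes p: "1 \<le> p" and "0 \<le> a" "0 \<le> b" "0 \<le> l" "l \<le> 1"
  shows "(l * a + (1 - l) * b) powr p \<le> l * a powr p + (1 - l) * b powr p"
proof -
  define c where "c = l * a + (1 - l) * b"
  have "0 \<le> c" using assms by (simp add: c_def)
  show ?thesis
  proof (cases "c = 0")
    case True
    then show ?thesis using assms by (simp add: c_def[symmetric])
  next
    case False
    then have c: "0 < c" using \<open>0 \<le> c\<close> by simp
    define k where "k = p * c powr (p - 1)"
    have "l * (c powr p + k * (a - c)) + (1 - l) * (c powr p + k * (b - c))
        \<le> l * a powr p + (1 - l) * b powr p"
      unfolding k_def using assms c by (intro add_mono mult_left_mono powr_tangent) auto
    also have "l * (c powr p + k * (a - c)) + (1 - l) * (c powr p + k * (b - c))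
        = c powr p + k * (l * a + (1 - l) * b - c)"
      by (simp add: algebra_simps)
    finally show ?thesis by (simp add: c_def)
  qed
qed

lemma convex_norm_powr:
  fixes u v :: "'a::real_normed_vector"
  assumes p: "1 \<le> p" and "0 \<le> l" "l \<le> 1"
  shows "norm (l *\<^sub>R u + (1 - l) *\<^sub>R v) powr p \<le> l * norm u powr p + (1 - l) * norm v powr p"
proof -
  have "norm (l *\<^sub>R u + (1 - l) *\<^sub>R v) \<le> l * norm u + (1 - l) * norm v"
    using norm_triangle_ineq[of "l *\<^sub>R u" "(1 - l) *\<^sub>R v"] assms by simp
  then have "norm (l *\<^sub>R u + (1 - l) *\<^sub>R v) powr p \<le> (l * norm u + (1 - l) * norm v) powr p"
    using p by (intro powr_mono2) auto
  also have "\<dots> \<le> l * norm u powr p + (1 - l) * norm v powr p"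
    using assms by (intro convex_powr) auto
  finally show ?thesis .
qed

lemma norm_mean_powr_le:
  fixes x :: "'i \<Rightarrow> 'a::real_normed_vector"
  assumes p: "1 \<le> p" and I: "finite I" "I \<noteq> {}"
  shows "norm ((\<Sum>i\<in>I. x i) /\<^sub>R card I) powr p \<le> (\<Sum>i\<in>I. norm (x i) powr p) / card I"
proof -
  define c where "c = (\<Sum>i\<in>I. norm (x i)) / card I"
  have n: "real (card I) > 0" using I by (simp add: card_gt_0_iff)
  have c0: "0 \<le> c" by (simp add: c_def sum_nonneg)
  have "norm ((\<Sum>i\<in>I. x i) /\<^sub>R card I) \<le> c"
    using n norm_sum[of x I] by (simp add: c_def divide_inverse mult.commute mult_left_mono)
  then have "norm ((\<Sum>i\<in>I. x i) /\<^sub>R card I) powr p \<le> c powr p"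
    using p by (intro powr_mono2) auto
  also have "c powr p \<le> (\<Sum>i\<in>I. norm (x i) powr p) / card I"
  proof (cases "c = 0")
    case True
    then show ?thesis by (simp add: sum_nonneg)
  next
    case False
    then have c: "c > 0" using c0 by simp
    have "real (card I) * c powr p = (\<Sum>i\<in>I. c powr p + p * c powr (p - 1) * (norm (x i) - c))"
      using n by (simp add: sum.distrib sum_distrib_left[symmetric] sum_subtractf c_def)
    also have "\<dots> \<le> (\<Sum>i\<in>I. norm (x i) powr p)"
      using p c by (intro sum_mono powr_tangent) auto
    finally show ?thesis using n by (simp add: field_simps)
  qed
  finally show ?thesis .
qed

lemma Lp_space_iff:
  "f \<in> Lp_space p M \<longleftrightarrow> strongly_measurable M f \<and> integrable M (\<lambda>x. norm (f x) powr p)"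
proof -
  have "(\<lambda>x. norm (f x) powr p) \<in> borel_measurable M" if "strongly_measurable M f"
    using strongly_measurable_norm[OF that] by measurable
  then show ?thesis
    unfolding Lp_space_def by (auto simp: integrable_iff_bounded)
qed

lemma Lp_norm_nonneg [simp]: "0 \<le> Lp_norm p M f"
  by (simp add: Lp_norm_def)

lemma Lp_norm_powr: "0 < p \<Longrightarrow> Lp_norm p M f powr p = (\<integral>x. norm (f x) powr p \<partial>M)"
  by (simp add: Lp_norm_def powr_powr)

lemma Lp_norm_scaleR:
  assumes "0 < p"
  shows "Lp_norm p M (\<lambda>x. c *\<^sub>R f x) = \<bar>c\<bar> * Lp_norm p M f"
  using assms by (simp add: Lp_norm_def powr_mult powr_powr)

lemma Lp_space_zero: "(\<lambda>x. 0) \<in> Lp_space p M"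
  by (simp add: Lp_space_iff strongly_measurable_const)

lemma Lp_space_mult:
  fixes f :: "'m \<Rightarrow> 'a::real_normed_vector"
  assumes p: "0 < p" and f: "f \<in> Lp_space p M" and a: "a \<in> borel_measurable M"
    and c: "\<And>x. \<bar>a x\<bar> \<le> c"
  shows "(\<lambda>x. a x *\<^sub>R f x) \<in> Lp_space p M"
proof -
  have sm: "strongly_measurable M (\<lambda>x. a x *\<^sub>R f x)"
    using f a by (auto simp: Lp_space_iff intro: strongly_measurable_scaleR)
  have "integrable M (\<lambda>x. norm (a x *\<^sub>R f x) powr p)"
  proof (rule Bochner_Integration.integrable_bound)
    show "integrable M (\<lambda>x. c powr p * norm (f x) powr p)"
      using f by (simp add: Lp_space_iff)
    show "(\<lambda>x. norm (a x *\<^sub>R f x) powr p) \<in> borel_measurable M"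
      using strongly_measurable_norm[OF sm] by measurable
    show "AE x in M. norm (norm (a x *\<^sub>R f x) powr p) \<le> norm (c powr p * norm (f x) powr p)"
    proof (rule AE_I2)
      fix x
      have "\<bar>a x\<bar> powr p \<le> c powr p" using c p by (intro powr_mono2) auto
      then show "norm (norm (a x *\<^sub>R f x) powr p) \<le> norm (c powr p * norm (f x) powr p)"
        by (simp add: powr_mult mult_right_mono)
    qed
  qed
  with sm show ?thesis by (simp add: Lp_space_iff)
qed

lemma Lp_space_scaleR:
  "0 < p \<Longrightarrow> f \<in> Lp_space p M \<Longrightarrow> (\<lambda>x. c *\<^sub>R f x) \<in> Lp_space p M"
  by (rule Lp_space_mult[where c = "\<bar>c\<bar>"]) auto

lemma Lp_space_add:
  fixes f g :: "'m \<Rightarrow> 'a::real_normed_vector"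
  assumes p: "1 \<le> p" and f: "f \<in> Lp_space p M" and g: "g \<in> Lp_space p M"
  shows "(\<lambda>x. f x + g x) \<in> Lp_space p M"
proof -
  have sm: "strongly_measurable M (\<lambda>x. f x + g x)"
    using f g by (auto simp: Lp_space_iff intro: strongly_measurable_add)
  have "integrable M (\<lambda>x. norm (f x + g x) powr p)"
  proof (rule Bochner_Integration.integrable_bound)
    show "integrable M (\<lambda>x. 2 powr p * (1 / 2 * norm (f x) powr p + (1 - 1 / 2) * norm (g x) powr p))"
      using f g by (auto simp: Lp_space_iff)
    show "(\<lambda>x. norm (f x + g x) powr p) \<in> borel_measurable M"
      using strongly_measurable_norm[OF sm] by measurable
    show "AE x in M. norm (norm (f x + g x) powr p)
      \<le> norm (2 powr p * (1 / 2 * norm (f x) powr p + (1 - 1 / 2) * norm (g x) powr p))"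
    proof (rule AE_I2)
      fix x
      have "norm (f x + g x) = 2 * norm ((1 / 2) *\<^sub>R f x + (1 - 1 / 2) *\<^sub>R g x)"
        by (simp flip: scaleR_add_right)
      then have "norm (f x + g x) powr p = 2 powr p * norm ((1 / 2) *\<^sub>R f x + (1 - 1 / 2) *\<^sub>R g x) powr p"
        by (simp only: powr_mult)
      also have "\<dots> \<le> 2 powr p * (1 / 2 * norm (f x) powr p + (1 - 1 / 2) * norm (g x) powr p)"
        using p by (intro mult_left_mono convex_norm_powr) auto
      finally show "norm (norm (f x + g x) powr p)
        \<le> norm (2 powr p * (1 / 2 * norm (f x) powr p + (1 - 1 / 2) * norm (g x) powr p))"
        by simp
    qed
  qed
  with sm show ?thesis by (simp add: Lp_space_iff)
qed

lemma Lp_space_sum: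
  fixes f :: "'i \<Rightarrow> 'm \<Rightarrow> 'a::real_normed_vector"
  assumes "1 \<le> p" "\<And>i. i \<in> I \<Longrightarrow> f i \<in> Lp_space p M"
  shows "(\<lambda>x. \<Sum>i\<in>I. f i x) \<in> Lp_space p M"
  using assms(2)
  by (induction I rule: infinite_finite_induct) (auto intro: Lp_space_zero Lp_space_add[OF assms(1)])

text \<open>Minkowski's inequality: for \<open>a > Lp_norm p M f\<close> and \<open>b > Lp_norm p M g\<close> write
  \<open>(f + g) / (a + b)\<close> as the convex combination of \<open>f / a\<close> and \<open>g / b\<close> with weights
  \<open>a / (a + b)\<close> and \<open>b / (a + b)\<close>.\<close>

lemma Lp_norm_triangle:
  fixes f g :: "'m \<Rightarrow> 'a::real_normed_vector"
  assumes p: "1 \<le> p" and f: "f \<in> Lp_space p M" and g: "g \<in> Lp_space p M"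
  shows "Lp_norm p M (\<lambda>x. f x + g x) \<le> Lp_norm p M f + Lp_norm p M g"
proof (rule field_le_epsilon)
  fix e :: real assume e: "0 < e"
  define a b where "a = Lp_norm p M f + e / 2" and "b = Lp_norm p M g + e / 2"
  have a: "a > 0" "Lp_norm p M f \<le> a" and b: "b > 0" "Lp_norm p M g \<le> b"
    using e by (auto simp: a_def b_def intro!: add_nonneg_pos)
  have p0: "0 < p" using p by simp
  define l where "l = a / (a + b)"
  have l: "0 \<le> l" "l \<le> 1" "1 - l = b / (a + b)" using a b by (auto simp: l_def field_simps)
  have I: "(\<integral>x. norm (h x) powr p \<partial>M) \<le> c powr p" if "Lp_norm p M h \<le> c" for h :: "'m \<Rightarrow> 'a" and c
    unfolding Lp_norm_powr[OF p0, symmetric] using that p0 by (intro powr_mono2) auto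
  have int: "integrable M (\<lambda>x. norm (f x) powr p)" "integrable M (\<lambda>x. norm (g x) powr p)"
    "integrable M (\<lambda>x. norm (f x + g x) powr p)"
    using f g Lp_space_add[OF p f g] by (auto simp: Lp_space_iff)
  have "Lp_norm p M (\<lambda>x. f x + g x) powr p
      \<le> (\<integral>x. (a + b) powr p * (l * (norm (f x) powr p / a powr p) + (1 - l) * (norm (g x) powr p / b powr p)) \<partial>M)"
    unfolding Lp_norm_powr[OF p0]
  proof (rule integral_mono)
    fix x
    have "f x + g x = (a + b) *\<^sub>R (l *\<^sub>R (f x /\<^sub>R a) + (1 - l) *\<^sub>R (g x /\<^sub>R b))"
      using a b unfolding l(3) by (simp add: l_def scaleR_add_right)
    then have "norm (f x + g x) powr p
        = (a + b) powr p * norm (l *\<^sub>R (f x /\<^sub>R a) + (1 - l) *\<^sub>R (g x /\<^sub>R b)) powr p"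
      using a b by (simp add: powr_mult)
    also have "\<dots> \<le> (a + b) powr p * (l * norm (f x /\<^sub>R a) powr p + (1 - l) * norm (g x /\<^sub>R b) powr p)"
      using p l by (intro mult_left_mono convex_norm_powr) auto
    also have "norm (f x /\<^sub>R a) powr p = norm (f x) powr p / a powr p"
      using a by (simp add: powr_mult inverse_powr divide_inverse)
    also have "norm (g x /\<^sub>R b) powr p = norm (g x) powr p / b powr p"
      using b by (simp add: powr_mult inverse_powr divide_inverse)
    finally show "norm (f x + g x) powr p
      \<le> (a + b) powr p * (l * (norm (f x) powr p / a powr p) + (1 - l) * (norm (g x) powr p / b powr p))" .
  qed (use int in auto)
  also have "\<dots> = (a + b) powr p * (l * ((\<integral>x. norm (f x) powr p \<partial>M) / a powr p)
      + (1 - l) * ((\<integral>x. norm (g x) powr p \<partial>M) / b powr p))"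
    using int by simp
  also have "\<dots> \<le> (a + b) powr p * (l * 1 + (1 - l) * 1)"
    using l I[OF a(2)] I[OF b(2)] a b by (intro mult_left_mono add_mono) auto
  finally have "Lp_norm p M (\<lambda>x. f x + g x) powr p \<le> (a + b) powr p" by simp
  then have "Lp_norm p M (\<lambda>x. f x + g x) \<le> a + b"
    using p0 a b by (metis add_nonneg_nonneg less_imp_le not_le powr_less_mono2)
  then show "Lp_norm p M (\<lambda>x. f x + g x) \<le> Lp_norm p M f + Lp_norm p M g + e"
    by (simp add: a_def b_def)
qed

text \<open>Jensen's inequality, by integrating over \<open>A\<close> the tangent of \<open>t powr p\<close> at the mean of the
  norm of \<open>f\<close>.\<close>

lemma has_integral_in_jensen:
  fixes f :: "'m \<Rightarrow> 'a::real_normed_vector"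
  assumes p: "1 \<le> p" and f: "f \<in> Lp_space p M" and A: "A \<in> sets M" "emeasure M A < \<infinity>"
    and v: "measure M A = v" "0 < v"
    and y: "has_integral_in M (\<lambda>x. indicator A x *\<^sub>R f x) y"
  shows "v * norm (y /\<^sub>R v) powr p \<le> (\<integral>x. indicator A x * norm (f x) powr p \<partial>M)"
proof -
  have p0: "0 < p" using p by simp
  have intp: "integrable M (\<lambda>x. indicator A x * norm (f x) powr p)"
    using f A by (intro integrable_real_mult_indicator[where f = "\<lambda>x. norm (f x) powr p", simplified mult.commute])
       (auto simp: Lp_space_iff)
  have intA: "integrable M (\<lambda>x. indicator A x :: real)" using A by simp
  have [measurable]: "(\<lambda>x. norm (f x)) \<in> borel_measurable M"
    using f by (auto simp: Lp_space_iff intro: strongly_measurable_norm)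
  note le1 = le_one_plus_powr[OF p]
  have int1: "integrable M (\<lambda>x. indicator A x * norm (f x))"
  proof (rule Bochner_Integration.integrable_bound)
    show "integrable M (\<lambda>x. indicator A x + indicator A x * norm (f x) powr p)"
      by (intro Bochner_Integration.integrable_add intA intp)
    show "AE x in M. norm (indicator A x * norm (f x)) \<le> norm (indicator A x + indicator A x * norm (f x) powr p)"
      using le1 by (intro AE_I2) (auto simp: indicator_def)
  qed (use A in measurable)
  define c where "c = (\<integral>x. indicator A x * norm (f x) \<partial>M) / v"
  have c0: "0 \<le> c" unfolding c_def using v by (intro divide_nonneg_nonneg integral_nonneg) auto
  have "ennreal (norm y) \<le> (\<integral>\<^sup>+x. ennreal (norm (indicator A x *\<^sub>R f x)) \<partial>M)"
    by (rule has_integral_in_norm_le[OF y])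
  also have "\<dots> = (\<integral>\<^sup>+x. ennreal (indicator A x * norm (f x)) \<partial>M)" by simp
  also have "\<dots> = ennreal (\<integral>x. indicator A x * norm (f x) \<partial>M)"
    by (intro nn_integral_eq_integral int1) auto
  finally have "norm y \<le> v * c"
    using v by (subst (asm) ennreal_le_iff) (auto simp: c_def intro!: integral_nonneg)
  then have "norm (y /\<^sub>R v) \<le> c" using v by (simp add: field_simps)
  then have le: "norm (y /\<^sub>R v) powr p \<le> c powr p" using p by (intro powr_mono2) auto
  have "v * c powr p \<le> (\<integral>x. indicator A x * norm (f x) powr p \<partial>M)"
  proof (cases "c = 0")
    case True
    then show ?thesis by (auto intro!: integral_nonneg)
  next
    case False
    then have c: "c > 0" using c0 by simp
    define k where "k = p * c powr (p - 1)"
    have "v * c powr p = (\<integral>x. (c powr p - k * c) * indicator A x + k * (indicator A x * norm (f x)) \<partial>M)"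
      using int1 intA v A by (simp add: c_def algebra_simps)
    also have "\<dots> \<le> (\<integral>x. indicator A x * norm (f x) powr p \<partial>M)"
    proof (rule integral_mono)
      fix x
      show "(c powr p - k * c) * indicator A x + k * (indicator A x * norm (f x)) \<le> indicator A x * norm (f x) powr p"
        using powr_tangent[OF p norm_ge_zero c, of "f x"]
        by (auto simp: indicator_def k_def algebra_simps)
    qed (use int1 intA intp in auto)
    finally show ?thesis .
  qed
  moreover have "v * norm (y /\<^sub>R v) powr p \<le> v * c powr p"
    using v by (intro mult_left_mono le) auto
  ultimately show ?thesis by linarith
qed

text \<open>On a set of finite measure the integrable function \<open>1 + norm (f x) powr p\<close> dominates the
  norm of \<open>f\<close>.\<close>

lemma Lp_space_integral_exists:
  fixes f :: "'m \<Rightarrow> 'a::banach"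
  assumes p: "1 \<le> p" and f: "f \<in> Lp_space p M" and A: "A \<in> sets M" "emeasure M A < \<infinity>"
  shows "has_integral_in M (\<lambda>x. indicator A x *\<^sub>R f x) (integral_over M A f)"
proof -
  have [measurable]: "(\<lambda>x. norm (f x)) \<in> borel_measurable M"
    using f by (auto simp: Lp_space_iff intro: strongly_measurable_norm)
  note le1 = le_one_plus_powr[OF p]
  have "(\<integral>\<^sup>+x. ennreal (norm (indicator A x *\<^sub>R f x)) \<partial>M)
      \<le> (\<integral>\<^sup>+x. indicator A x + ennreal (norm (f x) powr p) \<partial>M)"
    using le1 by (intro nn_integral_mono) (auto simp: indicator_def ennreal_leI simp flip: ennreal_1 ennreal_plus)
  also have "\<dots> = emeasure M A + (\<integral>\<^sup>+x. ennreal (norm (f x) powr p) \<partial>M)"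
    using A by (subst nn_integral_add) auto
  also have "\<dots> < \<infinity>" using A f by (simp add: Lp_space_def)
  finally have fin: "(\<integral>\<^sup>+x. ennreal (norm (indicator A x *\<^sub>R f x)) \<partial>M) < \<infinity>" .
  have "strongly_measurable M (\<lambda>x. indicator A x *\<^sub>R f x)"
    using f A by (auto simp: Lp_space_iff intro!: strongly_measurable_scaleR)
  from has_integral_in_exists[OF this fin]
  obtain y where "has_integral_in M (\<lambda>x. indicator A x *\<^sub>R f x) y" ..
  then show ?thesis using integral_over_eq by metis
qed

section \<open>Stein's inequality on a finite uniform space\<close>

text \<open>A difference sequence \<open>D\<close> on the points of \<open>S\<close> with equal weights. The level sets of \<open>h t\<close>
  are the atoms of the \<open>\<sigma>\<close>-algebra at time \<open>t\<close>, and the sets \<open>h (t - 1) -` L\<close> are the events at time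
  \<open>t - 1\<close>.\<close>

definition finite_martingale ::
    "'s set \<Rightarrow> (nat \<Rightarrow> 's \<Rightarrow> 'h) \<Rightarrow> nat \<Rightarrow> (nat \<Rightarrow> 's \<Rightarrow> 'x::real_vector) \<Rightarrow> bool" where
  "finite_martingale S h n D \<longleftrightarrow> finite S \<and>
     (\<forall>t. \<forall>s\<in>S. \<forall>s'\<in>S. h (Suc t) s = h (Suc t) s' \<longrightarrow> h t s = h t s') \<and>
     (\<forall>t\<in>{1..n}. (\<forall>s\<in>S. \<forall>s'\<in>S. h t s = h t s' \<longrightarrow> D t s = D t s') \<and>
        (\<forall>L. (\<Sum>s | s \<in> S \<and> h (t - 1) s \<in> L. D t s) = 0))"

text \<open>The points of \<open>S\<close> are encoded injectively as real numbers, since the UMD inequality concerns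
  probability measures on the reals, and the \<open>\<sigma>\<close>-algebras are pulled back along \<open>h\<close>. The common
  weight of the points cancels.\<close>

lemma umd_finite_martingale:
  assumes umd: "umd TYPE('x::banach)" and p: "1 < p"
  shows "\<exists>\<beta>\<ge>0. \<forall>(S :: 's set) (h :: nat \<Rightarrow> 's \<Rightarrow> 'h) n (D :: nat \<Rightarrow> 's \<Rightarrow> 'x) \<eta>.
    finite_martingale S h n D \<longrightarrow> (\<forall>t. \<eta> t \<in> {-1, 1}) \<longrightarrow>
    (\<Sum>s\<in>S. norm (\<Sum>t=1..n. \<eta> t *\<^sub>R D t s) powr p) \<le> \<beta> * (\<Sum>s\<in>S. norm (\<Sum>t=1..n. D t s) powr p)"
proof -
  obtain b where b: "b \<ge> 0" and bI: "\<And>(M :: real measure) F n (d :: nat \<Rightarrow> real \<Rightarrow> 'x) \<epsilon>.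
     prob_space M \<Longrightarrow> martingale_differences p M F n d \<Longrightarrow>
     (\<forall>k\<in>{1..n}. \<epsilon> k \<in> {-1, 1}) \<Longrightarrow>
     Lp_norm p M (\<lambda>w. \<Sum>k=1..n. \<epsilon> k *\<^sub>R d k w) \<le> b * Lp_norm p M (\<lambda>w. \<Sum>k=1..n. d k w)"
    using umd p unfolding umd_def by blast
  show ?thesis
  proof (intro exI[of _ "b powr p"] conjI allI impI)
    fix S :: "'s set" and h :: "nat \<Rightarrow> 's \<Rightarrow> 'h" and n and D :: "nat \<Rightarrow> 's \<Rightarrow> 'x" and \<eta> :: "nat \<Rightarrow> real"
    assume fm: "finite_martingale S h n D" and \<eta>: "\<forall>t. \<eta> t \<in> {-1, 1}"
    then have S: "finite S"
      and ref: "\<And>t s s'. s \<in> S \<Longrightarrow> s' \<in> S \<Longrightarrow> h (Suc t) s = h (Suc t) s' \<Longrightarrow> h t s = h t s'"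
      and dep: "\<And>t s s'. t \<in> {1..n} \<Longrightarrow> s \<in> S \<Longrightarrow> s' \<in> S \<Longrightarrow> h t s = h t s' \<Longrightarrow> D t s = D t s'"
      and zero: "\<And>t L. t \<in> {1..n} \<Longrightarrow> (\<Sum>s | s \<in> S \<and> h (t - 1) s \<in> L. D t s) = 0"
      unfolding finite_martingale_def by blast+
    show "(\<Sum>s\<in>S. norm (\<Sum>t=1..n. \<eta> t *\<^sub>R D t s) powr p)
        \<le> b powr p * (\<Sum>s\<in>S. norm (\<Sum>t=1..n. D t s) powr p)"
    proof (cases "S = {}")
      case False
      obtain e :: "'s \<Rightarrow> nat" where e: "inj_on e S"
        using finite_imp_inj_to_nat_seg[OF S] by auto
      define E where "E s = real (e s)" for s
      have E: "inj_on E S" using e by (auto simp: E_def inj_on_def)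
      define A where "A = E ` S"
      define dec where "dec = inv_into S E"
      have decE: "dec (E s) = s" if "s \<in> S" for s using E that by (simp add: dec_def)
      have Edec: "dec x \<in> S" "E (dec x) = x" if "x \<in> A" for x
        using that unfolding A_def dec_def by (auto intro: inv_into_into f_inv_into_f)
      have A: "finite A" "A \<noteq> {}" using S False by (auto simp: A_def)
      have cA: "real (card A) > 0" using A by (simp add: card_gt_0_iff)
      define M where "M = uniform_count_measure A"
      have spM: "space M = A" and seM: "sets M = Pow A"
        by (simp_all add: M_def space_uniform_count_measure sets_uniform_count_measure)
      have sumA: "(\<Sum>x\<in>A. f (dec x)) = (\<Sum>s\<in>S. f s)" for f :: "'s \<Rightarrow> 'b::comm_monoid_add"
        unfolding A_def by (subst sum.reindex[OF E]) (auto simp: decE)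
      interpret prob_space M
        unfolding M_def by (rule prob_space_uniform_count_measure[OF A])
      define F where "F t = vimage_algebra A (\<lambda>x. h t (dec x)) (count_space UNIV)" for t
      have spF: "space (F t) = A" for t by (simp add: F_def)
      have seF: "sets (F t) = {(\<lambda>x. h t (dec x)) -` L \<inter> A | L. True}" for t
        by (auto simp: F_def sets_vimage_algebra2)
      have ref': "h t s = h t s'" if "t \<le> t'" "s \<in> S" "s' \<in> S" "h t' s = h t' s'" for t t' s s'
        using that(1,4)
        by (induction rule: dec_induct) (use ref that(2,3) in blast)+
      have monoF: "sets (F t) \<subseteq> sets (F t')" if "t \<le> t'" for t t'
      proof
        fix B assume "B \<in> sets (F t)"
        then obtain L where L: "B = (\<lambda>x. h t (dec x)) -` L \<inter> A" by (auto simp: seF)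
        have "B = (\<lambda>x. h t' (dec x)) -` (h t' ` {s\<in>S. h t s \<in> L}) \<inter> A"
          unfolding L using ref'[OF that] Edec by (auto simp: image_iff) metis
        then show "B \<in> sets (F t')" unfolding seF by blast
      qed
      have filt: "filtration (space M) F"
        by standard (use monoF spF spM in auto)
      have sub: "subalgebra M (F t)" for t
        unfolding subalgebra_def using spF spM seM by (auto simp: seF)
      define d where "d t x = D t (dec x)" for t x
      have simpleM: "simple_function M f" for f :: "real \<Rightarrow> 'c"
        unfolding simple_function_def spM seM using A by auto
      have smM: "strongly_measurable M f" for f :: "real \<Rightarrow> 'x"
        unfolding strongly_measurable_def by (intro exI[of _ "\<lambda>_. f"]) (use simpleM in auto)
      have LpM: "f \<in> Lp_space p M" for f :: "real \<Rightarrow> 'x"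
        unfolding Lp_space_iff using smM A
        by (auto simp: M_def uniform_count_measure_def intro: integrable_point_measure_finite)
      have sbi: "Bochner_Integration.simple_bochner_integrable M f" for f :: "real \<Rightarrow> 'x"
        by (intro Bochner_Integration.simple_bochner_integrable.intros simpleM) simp
      have integ: "has_integral_in M f ((\<Sum>x\<in>A. f x) /\<^sub>R card A)" for f :: "real \<Rightarrow> 'x"
      proof -
        have "Bochner_Integration.simple_bochner_integral M f
          = (\<Sum>y\<in>(\<lambda>x. x) ` space M. measure M {x\<in>space M. x = y} *\<^sub>R f y)"
          by (rule Bochner_Integration.simple_bochner_integral_partition[OF sbi simpleM]) auto
        also have "\<dots> = (\<Sum>y\<in>A. (1 / card A) *\<^sub>R f y)"
        proof (intro sum.cong)
          fix y assume y: "y \<in> A"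
          then have "{x\<in>space M. x = y} = {y}" by (auto simp: spM)
          then have "measure M {x\<in>space M. x = y} = 1 / card A"
            using y A by (simp add: M_def measure_uniform_count_measure)
          then show "measure M {x\<in>space M. x = y} *\<^sub>R f y = (1 / card A) *\<^sub>R f y" by simp
        qed (simp add: spM)
        also have "\<dots> = (\<Sum>x\<in>A. f x) /\<^sub>R card A"
          by (simp add: scaleR_sum_right divide_inverse)
        finally show ?thesis using has_integral_in_simple[OF sbi, of f] by simp
      qed
      have mart: "martingale_differences p M F n d"
        unfolding martingale_differences_def
      proof (intro conjI filt ballI allI sub LpM)
        fix t assume t: "t \<in> {1..n}"
        have "simple_function (F t) (d t)"
          unfolding simple_function_def
        proof (intro conjI ballI)
          show "finite (d t ` space (F t))" using A by (simp add: spF)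
          fix y
          have "d t -` {y} \<inter> space (F t) = (\<lambda>x. h t (dec x)) -` (h t ` {s\<in>S. D t s = y}) \<inter> A"
            unfolding spF d_def using dep[OF t] Edec by (auto simp: image_iff) metis
          then show "d t -` {y} \<inter> space (F t) \<in> sets (F t)" unfolding seF by blast
        qed
        then show "strongly_measurable (F t) (d t)"
          unfolding strongly_measurable_def by (intro exI[of _ "\<lambda>_. d t"]) auto
        fix B assume "B \<in> sets (F (t - 1))"
        then obtain L where L: "B = (\<lambda>x. h (t - 1) (dec x)) -` L \<inter> A" by (auto simp: seF)
        have "(\<Sum>x\<in>A. indicator B x *\<^sub>R d t x)
            = (\<Sum>x\<in>A. (if h (t - 1) (dec x) \<in> L then D t (dec x) else 0))"
          by (intro sum.cong refl) (auto simp: L d_def indicator_def)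
        also have "\<dots> = (\<Sum>s\<in>S. if h (t - 1) s \<in> L then D t s else 0)" by (rule sumA)
        also have "\<dots> = (\<Sum>s | s \<in> S \<and> h (t - 1) s \<in> L. D t s)"
          using S by (simp add: sum.inter_filter)
        also have "\<dots> = 0" by (rule zero[OF t])
        finally show "has_integral_in M (\<lambda>w. indicator B w *\<^sub>R d t w) 0"
          using integ[of "\<lambda>w. indicator B w *\<^sub>R d t w"] by simp
      qed
      have N: "Lp_norm p M (\<lambda>w. f (dec w)) powr p = (\<Sum>s\<in>S. norm (f s) powr p) / card A" for f :: "'s \<Rightarrow> 'x"
        using p sumA[of "\<lambda>s. norm (f s) powr p"] A
        by (simp add: Lp_norm_powr M_def integral_uniform_count_measure)
      have "Lp_norm p M (\<lambda>w. \<Sum>t=1..n. \<eta> t *\<^sub>R d t w) \<le> b * Lp_norm p M (\<lambda>w. \<Sum>t=1..n. d t w)"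
        by (rule bI[OF prob_space_axioms mart]) (use \<eta> in auto)
      then have "Lp_norm p M (\<lambda>w. \<Sum>t=1..n. \<eta> t *\<^sub>R d t w) powr p
          \<le> (b * Lp_norm p M (\<lambda>w. \<Sum>t=1..n. d t w)) powr p"
        using p by (intro powr_mono2) auto
      also have "\<dots> = b powr p * Lp_norm p M (\<lambda>w. \<Sum>t=1..n. d t w) powr p"
        using b by (simp add: powr_mult)
      finally show ?thesis
        unfolding d_def N[of "\<lambda>s. \<Sum>t=1..n. D t s"] N[of "\<lambda>s. \<Sum>t=1..n. \<eta> t *\<^sub>R D t s"]
        using cA by (simp add: field_simps)
    qed simp
  qed simp
qed

definition atom_mean :: "'o set \<Rightarrow> ('o \<Rightarrow> 'l) \<Rightarrow> ('o \<Rightarrow> 'x::real_vector) \<Rightarrow> 'o \<Rightarrow> 'x" where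
  "atom_mean \<Omega> \<pi> f \<omega> = (\<Sum>\<omega>' | \<omega>' \<in> \<Omega> \<and> \<pi> \<omega>' = \<pi> \<omega>. f \<omega>') /\<^sub>R card {\<omega>'\<in>\<Omega>. \<pi> \<omega>' = \<pi> \<omega>}"

lemma atom_mean_cong: "\<pi> \<omega> = \<pi> \<omega>' \<Longrightarrow> atom_mean \<Omega> \<pi> f \<omega> = atom_mean \<Omega> \<pi> f \<omega>'"
  by (simp add: atom_mean_def)

lemma atom_mean_linear:
  "atom_mean \<Omega> \<pi> (\<lambda>\<omega>. \<Sum>j\<in>J. a j *\<^sub>R f j \<omega>) \<omega> = (\<Sum>j\<in>J. a j *\<^sub>R atom_mean \<Omega> \<pi> (f j) \<omega>)"
  unfolding atom_mean_def
  by (subst sum.swap) (simp add: scaleR_sum_right mult.commute)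

text \<open>This property characterises conditional expectations: \<open>P\<close> describes an event that is a union of
  atoms.\<close>

lemma atom_mean_sum:
  fixes f :: "'o \<Rightarrow> 'x::real_vector"
  assumes \<Omega>: "finite \<Omega>" and P: "\<And>\<omega> \<omega>'. \<pi> \<omega> = \<pi> \<omega>' \<Longrightarrow> P \<omega> = P \<omega>'"
  shows "(\<Sum>\<omega> | \<omega> \<in> \<Omega> \<and> P \<omega>. atom_mean \<Omega> \<pi> f \<omega>) = (\<Sum>\<omega> | \<omega> \<in> \<Omega> \<and> P \<omega>. f \<omega>)"
proof -
  define c where "c \<omega> = card {\<omega>'\<in>\<Omega>. \<pi> \<omega>' = \<pi> \<omega>}" for \<omega>
  define Q where "Q = {\<omega>\<in>\<Omega>. P \<omega>}"
  have Q: "finite Q" using \<Omega> by (simp add: Q_def)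
  have "(\<Sum>\<omega>\<in>Q. atom_mean \<Omega> \<pi> f \<omega>) = (\<Sum>\<omega>\<in>Q. \<Sum>\<omega>'\<in>Q. if \<pi> \<omega>' = \<pi> \<omega> then f \<omega>' /\<^sub>R c \<omega>' else 0)"
  proof (intro sum.cong refl)
    fix \<omega> assume "\<omega> \<in> Q"
    then have eq: "{\<omega>'\<in>\<Omega>. \<pi> \<omega>' = \<pi> \<omega>} = {\<omega>'\<in>Q. \<pi> \<omega>' = \<pi> \<omega>}"
      using P unfolding Q_def by blast
    have "atom_mean \<Omega> \<pi> f \<omega> = (\<Sum>\<omega>' | \<omega>' \<in> Q \<and> \<pi> \<omega>' = \<pi> \<omega>. f \<omega>' /\<^sub>R c \<omega>')"
      unfolding atom_mean_def eq scaleR_sum_right by (intro sum.cong refl) (auto simp: c_def eq)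
    also have "\<dots> = (\<Sum>\<omega>'\<in>Q. if \<pi> \<omega>' = \<pi> \<omega> then f \<omega>' /\<^sub>R c \<omega>' else 0)"
      using Q by (simp add: sum.inter_filter)
    finally show "atom_mean \<Omega> \<pi> f \<omega> = \<dots>" .
  qed
  also have "\<dots> = (\<Sum>\<omega>'\<in>Q. \<Sum>\<omega>\<in>Q. if \<pi> \<omega>' = \<pi> \<omega> then f \<omega>' /\<^sub>R c \<omega>' else 0)"
    by (rule sum.swap)
  also have "\<dots> = (\<Sum>\<omega>'\<in>Q. f \<omega>')"
  proof (intro sum.cong refl)
    fix \<omega>' assume \<omega>': "\<omega>' \<in> Q"
    have "P \<omega>" if "\<pi> \<omega> = \<pi> \<omega>'" for \<omega>
      using P[OF that] \<omega>' by (simp add: Q_def)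
    then have eq: "{\<omega>\<in>Q. \<pi> \<omega>' = \<pi> \<omega>} = {\<omega>\<in>\<Omega>. \<pi> \<omega> = \<pi> \<omega>'}"
      unfolding Q_def by auto
    have "(\<Sum>\<omega>\<in>Q. if \<pi> \<omega>' = \<pi> \<omega> then f \<omega>' /\<^sub>R c \<omega>' else 0) = real (c \<omega>') *\<^sub>R (f \<omega>' /\<^sub>R c \<omega>')"
      using Q by (simp add: sum.inter_filter[symmetric] eq c_def sum_constant_scaleR)
    also have "c \<omega>' > 0"
      using \<omega>' \<Omega> unfolding c_def Q_def by (auto simp: card_gt_0_iff)
    then have "real (c \<omega>') *\<^sub>R (f \<omega>' /\<^sub>R c \<omega>') = f \<omega>'" by simp
    finally show "(\<Sum>\<omega>\<in>Q. if \<pi> \<omega>' = \<pi> \<omega> then f \<omega>' /\<^sub>R c \<omega>' else 0) = f \<omega>'" .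
  qed
  finally show ?thesis by (simp add: Q_def)
qed

lemma atom_mean_contractive:
  fixes f :: "'o \<Rightarrow> 'x::real_normed_vector"
  assumes \<Omega>: "finite \<Omega>" and p: "1 \<le> p"
  shows "(\<Sum>\<omega>\<in>\<Omega>. norm (atom_mean \<Omega> \<pi> f \<omega>) powr p) \<le> (\<Sum>\<omega>\<in>\<Omega>. norm (f \<omega>) powr p)"
proof -
  have "(\<Sum>\<omega>\<in>\<Omega>. norm (atom_mean \<Omega> \<pi> f \<omega>) powr p) \<le> (\<Sum>\<omega>\<in>\<Omega>. atom_mean \<Omega> \<pi> (\<lambda>\<omega>. norm (f \<omega>) powr p) \<omega>)"
  proof (rule sum_mono)
    fix \<omega> assume "\<omega> \<in> \<Omega>"
    then have "{\<omega>'\<in>\<Omega>. \<pi> \<omega>' = \<pi> \<omega>} \<noteq> {}" by auto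
    from norm_mean_powr_le[OF p _ this, of f]
    show "norm (atom_mean \<Omega> \<pi> f \<omega>) powr p \<le> atom_mean \<Omega> \<pi> (\<lambda>\<omega>. norm (f \<omega>) powr p) \<omega>"
      unfolding atom_mean_def using \<Omega> by (simp add: divide_inverse mult.commute)
  qed
  also have "\<dots> = (\<Sum>\<omega>\<in>\<Omega>. norm (f \<omega>) powr p)"
    using atom_mean_sum[OF \<Omega>, of \<pi> "\<lambda>_. True"] by simp
  finally show ?thesis .
qed

lemma signs_flip_cancel:
  assumes j: "j \<in> J" and P: "\<And>\<epsilon> s. P (\<epsilon>(j := s)) = P \<epsilon>"
  shows "(\<Sum>\<epsilon> | \<epsilon> \<in> signs J \<and> P \<epsilon>. \<epsilon> j) = 0"
proof -
  have "(\<Sum>\<epsilon> | \<epsilon> \<in> signs J \<and> P \<epsilon>. \<epsilon> j) = (\<Sum>\<epsilon> | \<epsilon> \<in> signs J \<and> P \<epsilon>. - \<epsilon> j)"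
    by (rule sum.reindex_bij_witness[where i = "\<lambda>\<epsilon>. \<epsilon>(j := - \<epsilon> j)" and j = "\<lambda>\<epsilon>. \<epsilon>(j := - \<epsilon> j)"])
       (use j P in \<open>auto simp: signs_def PiE_iff extensional_def\<close>)
  also have "\<dots> = - (\<Sum>\<epsilon> | \<epsilon> \<in> signs J \<and> P \<epsilon>. \<epsilon> j)" by (rule sum_negf)
  finally show ?thesis by simp
qed

text \<open>Stein's inequality, by revealing alternately the next finer partition and the signs of
  that level. The differences of the martingale of \<open>\<Sum>j\<in>J. \<epsilon> j *\<^sub>R g j\<close> at the second kind of
  step add up to the random sum of the conditional expectations, and their sum is half of the sum
  of the martingale and of its transform by alternating signs. The UMD property bounds the
  transform. The martingale ends with the mean of \<open>\<Sum>j\<in>J. \<epsilon> j *\<^sub>R g j\<close> over the finest atoms,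
  and taking means is contractive.\<close>

lemma stein_finite:
  assumes umd: "umd TYPE('x::banach)" and p: "1 < p"
  shows "\<exists>\<beta>\<ge>0. \<forall>(\<Omega> :: 'o set) (J :: 'j set) (\<pi> :: nat \<Rightarrow> 'o \<Rightarrow> 'l) (g :: 'j \<Rightarrow> 'o \<Rightarrow> 'x) l n.
    finite \<Omega> \<longrightarrow> finite J \<longrightarrow>
    (\<forall>s \<omega> \<omega>'. \<pi> (Suc s) \<omega> = \<pi> (Suc s) \<omega>' \<longrightarrow> \<pi> s \<omega> = \<pi> s \<omega>') \<longrightarrow>
    (\<forall>j\<in>J. l j \<in> {1..n}) \<longrightarrow>
    sign_mean J (\<lambda>\<epsilon>. \<Sum>\<omega>\<in>\<Omega>. norm (\<Sum>j\<in>J. \<epsilon> j *\<^sub>R atom_mean \<Omega> (\<pi> (l j)) (g j) \<omega>) powr p)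
    \<le> \<beta> * sign_mean J (\<lambda>\<epsilon>. \<Sum>\<omega>\<in>\<Omega>. norm (\<Sum>j\<in>J. \<epsilon> j *\<^sub>R g j \<omega>) powr p)"
proof -
  obtain b where b: "0 \<le> b" and bI:
    "\<And>(S :: ('o \<times> ('j \<Rightarrow> real)) set) (h :: nat \<Rightarrow> ('o \<times> ('j \<Rightarrow> real)) \<Rightarrow> 'l \<times> ('j \<Rightarrow> real)) n
        (D :: nat \<Rightarrow> ('o \<times> ('j \<Rightarrow> real)) \<Rightarrow> 'x) \<eta>.
      finite_martingale S h n D \<Longrightarrow> (\<forall>t. \<eta> t \<in> {-1, 1}) \<Longrightarrow>
      (\<Sum>s\<in>S. norm (\<Sum>t=1..n. \<eta> t *\<^sub>R D t s) powr p) \<le> b * (\<Sum>s\<in>S. norm (\<Sum>t=1..n. D t s) powr p)"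
    using umd_finite_martingale[OF umd p] by blast
  show ?thesis
  proof (intro exI[of _ "(1 + b) / 2"] conjI allI impI)
    show "0 \<le> (1 + b) / 2" using b by simp
  next
    fix \<Omega> :: "'o set" and J :: "'j set" and \<pi> :: "nat \<Rightarrow> 'o \<Rightarrow> 'l" and g :: "'j \<Rightarrow> 'o \<Rightarrow> 'x" and l :: "'j \<Rightarrow> nat" and n
    assume \<Omega>: "finite \<Omega>" and J: "finite J"
      and ref0: "\<forall>s \<omega> \<omega>'. \<pi> (Suc s) \<omega> = \<pi> (Suc s) \<omega>' \<longrightarrow> \<pi> s \<omega> = \<pi> s \<omega>'"
      and l0: "\<forall>j\<in>J. l j \<in> {1..n}"
    have ref: "\<pi> s \<omega> = \<pi> s \<omega>'" if "\<pi> (Suc s) \<omega> = \<pi> (Suc s) \<omega>'" for s \<omega> \<omega>'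
      using ref0 that by blast
    have l: "l j \<in> {1..n}" if "j \<in> J" for j using l0 that by blast
    define a where "a s j = atom_mean \<Omega> (\<pi> s) (g j)" for s j
    define S where "S = \<Omega> \<times> signs J"
    have S: "finite S" using \<Omega> J by (simp add: S_def)
    \<comment> \<open>At time \<open>2 * s - 1\<close> the partition of level \<open>s\<close> is revealed, at time \<open>2 * s\<close> the signs of the
      indices \<open>j\<close> with \<open>l j = s\<close>. The differences are \<open>Do s\<close> and \<open>De s\<close>, for odd and even times.\<close>
    define h :: "nat \<Rightarrow> 'o \<times> ('j \<Rightarrow> real) \<Rightarrow> 'l \<times> ('j \<Rightarrow> real)" where
      "h t = (\<lambda>(\<omega>, \<epsilon>). (\<pi> ((t + 1) div 2) \<omega>, restrict \<epsilon> {j\<in>J. l j \<le> t div 2}))" for t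
    define De :: "nat \<Rightarrow> 'o \<times> ('j \<Rightarrow> real) \<Rightarrow> 'x" where
      "De s = (\<lambda>(\<omega>, \<epsilon>). \<Sum>j | j \<in> J \<and> l j = s. \<epsilon> j *\<^sub>R a s j \<omega>)" for s
    define Do :: "nat \<Rightarrow> 'o \<times> ('j \<Rightarrow> real) \<Rightarrow> 'x" where
      "Do s = (\<lambda>(\<omega>, \<epsilon>). \<Sum>j | j \<in> J \<and> l j < s. \<epsilon> j *\<^sub>R (a s j \<omega> - a (s - 1) j \<omega>))" for s
    define D where "D t = (if even t then De (t div 2) else Do ((t + 1) div 2))" for t
    define \<eta> :: "nat \<Rightarrow> real" where "\<eta> t = (if even t then 1 else -1)" for t
    have aref: "a s j \<omega> = a s j \<omega>'" if "\<pi> s \<omega> = \<pi> s \<omega>'" for s j \<omega> \<omega>'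
      unfolding a_def by (rule atom_mean_cong) (rule that)
    have cases_t: "(\<exists>s\<ge>1. t = 2 * s) \<or> (\<exists>s\<ge>1. t = 2 * s - 1)" if "t \<ge> 1" for t :: nat
      using that by presburger
    have Deven: "D (2 * s) = De s" for s by (simp add: D_def)
    have Dodd: "D (2 * s - 1) = Do s" if "s \<ge> 1" for s
      using that by (simp add: D_def)
    have "finite_martingale S h (2 * n) D"
      unfolding finite_martingale_def
    proof (intro conjI S allI ballI impI)
      fix t s s' assume "s \<in> S" "s' \<in> S" and eq: "h (Suc t) s = h (Suc t) s'"
      obtain \<omega> \<epsilon> \<omega>' \<epsilon>' where s: "s = (\<omega>, \<epsilon>)" "s' = (\<omega>', \<epsilon>')" by (cases s, cases s') auto
      have "\<pi> ((t + 1) div 2) \<omega> = \<pi> ((t + 1) div 2) \<omega>'"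
      proof (cases "even t")
        case True
        then have "(Suc t + 1) div 2 = Suc ((t + 1) div 2)" by presburger
        then have "\<pi> (Suc ((t + 1) div 2)) \<omega> = \<pi> (Suc ((t + 1) div 2)) \<omega>'"
          using eq by (simp add: h_def s)
        then show ?thesis by (rule ref)
      next
        case False
        then have "(Suc t + 1) div 2 = (t + 1) div 2" by presburger
        then show ?thesis using eq by (simp add: h_def s)
      qed
      moreover have "restrict \<epsilon> {j\<in>J. l j \<le> t div 2} = restrict \<epsilon>' {j\<in>J. l j \<le> t div 2}"
      proof
        fix j
        have "restrict \<epsilon> {j\<in>J. l j \<le> Suc t div 2} j = restrict \<epsilon>' {j\<in>J. l j \<le> Suc t div 2} j"
          using eq by (simp add: h_def s)
        moreover have "l j \<le> Suc t div 2" if "l j \<le> t div 2"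
          using that div_le_mono[of t "Suc t" 2] by linarith
        ultimately show "restrict \<epsilon> {j\<in>J. l j \<le> t div 2} j = restrict \<epsilon>' {j\<in>J. l j \<le> t div 2} j"
          by (auto simp: restrict_def split: if_splits)
      qed
      ultimately show "h t s = h t s'" by (simp add: h_def s)
    next
      fix t s s' assume t: "t \<in> {1..2*n}" and "s \<in> S" "s' \<in> S" and eq: "h t s = h t s'"
      obtain \<omega> \<epsilon> \<omega>' \<epsilon>' where s: "s = (\<omega>, \<epsilon>)" "s' = (\<omega>', \<epsilon>')" by (cases s, cases s') auto
      consider (e) k where "k \<ge> 1" "t = 2 * k" | (o) k where "k \<ge> 1" "t = 2 * k - 1"
        using cases_t[of t] t by auto
      then show "D t s = D t s'"
      proof cases
        case e
        then have \<pi>: "\<pi> k \<omega> = \<pi> k \<omega>'" and r: "restrict \<epsilon> {j\<in>J. l j \<le> k} = restrict \<epsilon>' {j\<in>J. l j \<le> k}"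
          using eq by (simp_all add: h_def s)
        have "\<epsilon> j = \<epsilon>' j" if "j \<in> J" "l j = k" for j
          using fun_cong[OF r, of j] that by simp
        then show ?thesis
          unfolding e(2) Deven De_def s prod.case
          by (intro sum.cong refl) (auto simp: aref[OF \<pi>])
      next
        case o
        then have k: "(t + 1) div 2 = k" "t div 2 = k - 1" by auto
        have \<pi>: "\<pi> k \<omega> = \<pi> k \<omega>'"
          and r: "restrict \<epsilon> {j\<in>J. l j \<le> k - 1} = restrict \<epsilon>' {j\<in>J. l j \<le> k - 1}"
          using eq k by (simp_all add: h_def s)
        have \<pi>': "\<pi> (k - 1) \<omega> = \<pi> (k - 1) \<omega>'" by (rule ref) (use \<pi> o in simp)
        have "\<epsilon> j = \<epsilon>' j" if "j \<in> J" "l j < k" for j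
          using fun_cong[OF r, of j] that by (simp split: if_splits)
        then show ?thesis
          unfolding o(2) Dodd[OF o(1)] Do_def s prod.case
          by (intro sum.cong refl) (auto simp: aref[OF \<pi>] aref[OF \<pi>'] simp del: One_nat_def)
      qed
    next
      fix t and L assume t: "t \<in> {1..2*n}"
      have split: "(\<Sum>s | s \<in> S \<and> h (t - 1) s \<in> L. G s)
        = (\<Sum>\<omega>\<in>\<Omega>. \<Sum>\<epsilon> | \<epsilon> \<in> signs J \<and> h (t - 1) (\<omega>, \<epsilon>) \<in> L. G (\<omega>, \<epsilon>))"
        "(\<Sum>s | s \<in> S \<and> h (t - 1) s \<in> L. G s)
        = (\<Sum>\<epsilon>\<in>signs J. \<Sum>\<omega> | \<omega> \<in> \<Omega> \<and> h (t - 1) (\<omega>, \<epsilon>) \<in> L. G (\<omega>, \<epsilon>))" for G :: "_ \<Rightarrow> 'x"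
      proof -
        have "(\<Sum>s | s \<in> S \<and> h (t - 1) s \<in> L. G s) = (\<Sum>s\<in>S. if h (t - 1) s \<in> L then G s else 0)"
          using S by (simp add: sum.inter_filter)
        also have "\<dots> = (\<Sum>\<omega>\<in>\<Omega>. \<Sum>\<epsilon>\<in>signs J. if h (t - 1) (\<omega>, \<epsilon>) \<in> L then G (\<omega>, \<epsilon>) else 0)"
          unfolding S_def by (subst sum.cartesian_product) (auto intro!: sum.cong)
        finally have 1: "(\<Sum>s | s \<in> S \<and> h (t - 1) s \<in> L. G s) = \<dots>" .
        show "(\<Sum>s | s \<in> S \<and> h (t - 1) s \<in> L. G s)
          = (\<Sum>\<omega>\<in>\<Omega>. \<Sum>\<epsilon> | \<epsilon> \<in> signs J \<and> h (t - 1) (\<omega>, \<epsilon>) \<in> L. G (\<omega>, \<epsilon>))"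
          unfolding 1 using J by (simp add: sum.inter_filter)
        show "(\<Sum>s | s \<in> S \<and> h (t - 1) s \<in> L. G s)
          = (\<Sum>\<epsilon>\<in>signs J. \<Sum>\<omega> | \<omega> \<in> \<Omega> \<and> h (t - 1) (\<omega>, \<epsilon>) \<in> L. G (\<omega>, \<epsilon>))"
          unfolding 1 by (subst sum.swap) (use \<Omega> in \<open>simp add: sum.inter_filter\<close>)
      qed
      consider (e) k where "k \<ge> 1" "t = 2 * k" | (o) k where "k \<ge> 1" "t = 2 * k - 1"
        using cases_t[of t] t by auto
      then show "(\<Sum>s | s \<in> S \<and> h (t - 1) s \<in> L. D t s) = 0"
      proof cases
        case e
        show ?thesis
          unfolding split(1)
        proof (rule sum.neutral, rule ballI)
          fix \<omega> assume "\<omega> \<in> \<Omega>"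
          let ?E = "{\<epsilon>. \<epsilon> \<in> signs J \<and> h (t - 1) (\<omega>, \<epsilon>) \<in> L}"
          have "(\<Sum>\<epsilon>\<in>?E. D t (\<omega>, \<epsilon>)) = (\<Sum>\<epsilon>\<in>?E. \<Sum>j | j \<in> J \<and> l j = k. \<epsilon> j *\<^sub>R a k j \<omega>)"
            by (simp add: e Deven De_def)
          also have "\<dots> = (\<Sum>j | j \<in> J \<and> l j = k. (\<Sum>\<epsilon>\<in>?E. \<epsilon> j) *\<^sub>R a k j \<omega>)"
            by (subst sum.swap) (simp add: scaleR_sum_left)
          also have "\<dots> = 0"
          proof (rule sum.neutral, rule ballI)
            fix j assume j: "j \<in> {j \<in> J. l j = k}"
            have "h (t - 1) (\<omega>, \<epsilon>(j := s)) = h (t - 1) (\<omega>, \<epsilon>)" for \<epsilon> s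
            proof -
              have "(t - 1) div 2 = k - 1" using e by auto
              then have "\<not> l j \<le> (t - 1) div 2" using j e by auto
              then have "restrict (\<epsilon>(j := s)) {j\<in>J. l j \<le> (t - 1) div 2} = restrict \<epsilon> {j\<in>J. l j \<le> (t - 1) div 2}"
                by (intro restrict_ext) auto
              then show ?thesis by (simp only: h_def prod.case)
            qed
            then have "(\<Sum>\<epsilon>\<in>?E. \<epsilon> j) = 0"
              using j by (intro signs_flip_cancel) (simp_all only: mem_Collect_eq)
            then show "(\<Sum>\<epsilon>\<in>?E. \<epsilon> j) *\<^sub>R a k j \<omega> = 0" by simp
          qed
          finally show "(\<Sum>\<epsilon>\<in>?E. D t (\<omega>, \<epsilon>)) = 0" .
        qed
      next
        case o
        show ?thesis
          unfolding split(2)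
        proof (rule sum.neutral, rule ballI)
          fix \<epsilon> assume "\<epsilon> \<in> signs J"
          let ?W = "{\<omega>. \<omega> \<in> \<Omega> \<and> h (t - 1) (\<omega>, \<epsilon>) \<in> L}"
          have t1: "(t - 1 + 1) div 2 = k - 1" using o by auto
          have "(\<Sum>\<omega>\<in>?W. D t (\<omega>, \<epsilon>))
              = (\<Sum>\<omega>\<in>?W. \<Sum>j | j \<in> J \<and> l j < k. \<epsilon> j *\<^sub>R (a k j \<omega> - a (k - 1) j \<omega>))"
            unfolding o(2) Dodd[OF o(1)] Do_def prod.case ..
          also have "\<dots> = (\<Sum>j | j \<in> J \<and> l j < k. \<epsilon> j *\<^sub>R ((\<Sum>\<omega>\<in>?W. a k j \<omega>) - (\<Sum>\<omega>\<in>?W. a (k - 1) j \<omega>)))"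
            by (subst sum.swap) (simp only: scaleR_sum_right[symmetric] sum_subtractf)
          also have "\<dots> = 0"
          proof (rule sum.neutral, rule ballI)
            fix j
            have P: "(h (t - 1) (\<omega>, \<epsilon>) \<in> L) = (h (t - 1) (\<omega>', \<epsilon>) \<in> L)" if "\<pi> (k - 1) \<omega> = \<pi> (k - 1) \<omega>'" for \<omega> \<omega>'
              by (simp only: h_def prod.case t1 that)
            have "(\<Sum>\<omega>\<in>?W. a k j \<omega>) = (\<Sum>\<omega>\<in>?W. g j \<omega>)"
              unfolding a_def
            proof (rule atom_mean_sum[OF \<Omega>])
              fix \<omega> \<omega>' assume "\<pi> k \<omega> = \<pi> k \<omega>'"
              then have "\<pi> (Suc (k - 1)) \<omega> = \<pi> (Suc (k - 1)) \<omega>'"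
                using o by simp
              then have "\<pi> (k - 1) \<omega> = \<pi> (k - 1) \<omega>'"
                by (rule ref)
              then show "(h (t - 1) (\<omega>, \<epsilon>) \<in> L) = (h (t - 1) (\<omega>', \<epsilon>) \<in> L)"
                by (rule P)
            qed
            moreover have "(\<Sum>\<omega>\<in>?W. a (k - 1) j \<omega>) = (\<Sum>\<omega>\<in>?W. g j \<omega>)"
              unfolding a_def by (rule atom_mean_sum[OF \<Omega> P])
            ultimately show "\<epsilon> j *\<^sub>R ((\<Sum>\<omega>\<in>?W. a k j \<omega>) - (\<Sum>\<omega>\<in>?W. a (k - 1) j \<omega>)) = 0" by simp
          qed
          finally show "(\<Sum>\<omega>\<in>?W. D t (\<omega>, \<epsilon>)) = 0" .
        qed
      qed
    qed
    then have ineq: "(\<Sum>s\<in>S. norm (\<Sum>t=1..2*n. \<eta> t *\<^sub>R D t s) powr p)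
        \<le> b * (\<Sum>s\<in>S. norm (\<Sum>t=1..2*n. D t s) powr p)"
      by (rule bI) (auto simp: \<eta>_def)
    have two: "(\<Sum>t=1..2 * Suc m. G t) = (\<Sum>t=1..2 * m. G t) + (G (2 * Suc m - 1) + G (2 * Suc m))"
      for m and G :: "nat \<Rightarrow> 'x"
      by (simp add: add.assoc)
    have full: "(\<Sum>t=1..2*m. D t (\<omega>, \<epsilon>)) = (\<Sum>j | j \<in> J \<and> l j \<le> m. \<epsilon> j *\<^sub>R a m j \<omega>)" for m \<omega> \<epsilon>
    proof (induction m)
      case 0
      have e: "{j\<in>J. l j \<le> 0} = {}" using l by force
      show ?case unfolding e by simp
    next
      case (Suc m)
      have J': "{j\<in>J. l j \<le> Suc m} = {j\<in>J. l j \<le> m} \<union> {j\<in>J. l j = Suc m}" by auto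
      have "(\<Sum>j | j \<in> J \<and> l j \<le> Suc m. \<epsilon> j *\<^sub>R a (Suc m) j \<omega>)
          = (\<Sum>j | j \<in> J \<and> l j \<le> m. \<epsilon> j *\<^sub>R a (Suc m) j \<omega>) + (\<Sum>j | j \<in> J \<and> l j = Suc m. \<epsilon> j *\<^sub>R a (Suc m) j \<omega>)"
        unfolding J' using J by (intro sum.union_disjoint) auto
      moreover have "D (2 * Suc m - 1) (\<omega>, \<epsilon>)
          = (\<Sum>j | j \<in> J \<and> l j \<le> m. \<epsilon> j *\<^sub>R a (Suc m) j \<omega>) - (\<Sum>j | j \<in> J \<and> l j \<le> m. \<epsilon> j *\<^sub>R a m j \<omega>)"
        using Dodd[of "Suc m"] by (simp add: Do_def less_Suc_eq_le sum_subtractf scaleR_diff_right)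
      moreover have "D (2 * Suc m) (\<omega>, \<epsilon>) = (\<Sum>j | j \<in> J \<and> l j = Suc m. \<epsilon> j *\<^sub>R a (Suc m) j \<omega>)"
        unfolding Deven De_def by simp
      ultimately show ?case
        unfolding two Suc.IH by (simp only:) simp
    qed
    have alt: "(\<Sum>t=1..2*m. D t (\<omega>, \<epsilon>)) + (\<Sum>t=1..2*m. \<eta> t *\<^sub>R D t (\<omega>, \<epsilon>))
        = 2 *\<^sub>R (\<Sum>j | j \<in> J \<and> l j \<le> m. \<epsilon> j *\<^sub>R a (l j) j \<omega>)" for m \<omega> \<epsilon>
    proof (induction m)
      case 0
      have e: "{j\<in>J. l j \<le> 0} = {}" using l by force
      show ?case unfolding e by simp
    next
      case (Suc m)
      have J': "{j\<in>J. l j \<le> Suc m} = {j\<in>J. l j \<le> m} \<union> {j\<in>J. l j = Suc m}" by auto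
      have s: "(\<Sum>j | j \<in> J \<and> l j \<le> Suc m. \<epsilon> j *\<^sub>R a (l j) j \<omega>)
          = (\<Sum>j | j \<in> J \<and> l j \<le> m. \<epsilon> j *\<^sub>R a (l j) j \<omega>) + D (2 * Suc m) (\<omega>, \<epsilon>)"
        unfolding J' Deven De_def prod.case using J
        by (subst sum.union_disjoint) (auto intro!: sum.cong)
      have \<eta>s: "\<eta> (2 * Suc m - 1) = -1" "\<eta> (2 * Suc m) = 1" by (simp_all add: \<eta>_def)
      have "(\<Sum>t=1..2*Suc m. D t (\<omega>, \<epsilon>)) + (\<Sum>t=1..2*Suc m. \<eta> t *\<^sub>R D t (\<omega>, \<epsilon>))
         = ((\<Sum>t=1..2*m. D t (\<omega>, \<epsilon>)) + (\<Sum>t=1..2*m. \<eta> t *\<^sub>R D t (\<omega>, \<epsilon>))) + 2 *\<^sub>R D (2 * Suc m) (\<omega>, \<epsilon>)"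
        unfolding two \<eta>s by (simp add: scaleR_2 del: mult_Suc_right)
      then show ?case
        unfolding Suc.IH s by (simp only: scaleR_add_right)
    qed
    have Jn: "{j\<in>J. l j \<le> n} = J" using l by auto
    have "(\<Sum>(\<omega>, \<epsilon>)\<in>S. norm (\<Sum>j\<in>J. \<epsilon> j *\<^sub>R a (l j) j \<omega>) powr p)
        \<le> (\<Sum>s\<in>S. (1 / 2) * norm (\<Sum>t=1..2*n. D t s) powr p
            + (1 - 1 / 2) * norm (\<Sum>t=1..2*n. \<eta> t *\<^sub>R D t s) powr p)"
    proof (rule sum_mono, clarify)
      fix \<omega> \<epsilon>
      have "(\<Sum>j\<in>J. \<epsilon> j *\<^sub>R a (l j) j \<omega>)
          = (1 / 2) *\<^sub>R ((\<Sum>t=1..2*n. D t (\<omega>, \<epsilon>)) + (\<Sum>t=1..2*n. \<eta> t *\<^sub>R D t (\<omega>, \<epsilon>)))"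
        unfolding alt Jn by simp
      then have "(\<Sum>j\<in>J. \<epsilon> j *\<^sub>R a (l j) j \<omega>)
          = (1 / 2) *\<^sub>R (\<Sum>t=1..2*n. D t (\<omega>, \<epsilon>)) + (1 - 1 / 2) *\<^sub>R (\<Sum>t=1..2*n. \<eta> t *\<^sub>R D t (\<omega>, \<epsilon>))"
        by (simp add: scaleR_add_right)
      then show "norm (\<Sum>j\<in>J. \<epsilon> j *\<^sub>R a (l j) j \<omega>) powr p
          \<le> (1 / 2) * norm (\<Sum>t=1..2*n. D t (\<omega>, \<epsilon>)) powr p
            + (1 - 1 / 2) * norm (\<Sum>t=1..2*n. \<eta> t *\<^sub>R D t (\<omega>, \<epsilon>)) powr p"
        using p by (simp only:) (intro convex_norm_powr, auto)
    qed
    also have "\<dots> = (1 / 2) * (\<Sum>s\<in>S. norm (\<Sum>t=1..2*n. D t s) powr p)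
        + (1 / 2) * (\<Sum>s\<in>S. norm (\<Sum>t=1..2*n. \<eta> t *\<^sub>R D t s) powr p)"
      by (simp add: sum.distrib sum_distrib_left)
    also have "\<dots> \<le> (1 + b) / 2 * (\<Sum>s\<in>S. norm (\<Sum>t=1..2*n. D t s) powr p)"
      using ineq by (simp add: field_simps)
    also have "(\<Sum>s\<in>S. norm (\<Sum>t=1..2*n. D t s) powr p)
        = (\<Sum>\<epsilon>\<in>signs J. \<Sum>\<omega>\<in>\<Omega>. norm (atom_mean \<Omega> (\<pi> n) (\<lambda>\<omega>. \<Sum>j\<in>J. \<epsilon> j *\<^sub>R g j \<omega>) \<omega>) powr p)"
      unfolding atom_mean_linear S_def
      by (subst sum.swap, subst sum.cartesian_product)
         (auto intro!: sum.cong simp: full[unfolded One_nat_def] Jn a_def)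
    also have "\<dots> \<le> (\<Sum>\<epsilon>\<in>signs J. \<Sum>\<omega>\<in>\<Omega>. norm (\<Sum>j\<in>J. \<epsilon> j *\<^sub>R g j \<omega>) powr p)"
      by (intro sum_mono atom_mean_contractive \<Omega>) (use p in simp)
    also have "(\<Sum>(\<omega>, \<epsilon>)\<in>S. norm (\<Sum>j\<in>J. \<epsilon> j *\<^sub>R a (l j) j \<omega>) powr p)
        = (\<Sum>\<epsilon>\<in>signs J. \<Sum>\<omega>\<in>\<Omega>. norm (\<Sum>j\<in>J. \<epsilon> j *\<^sub>R a (l j) j \<omega>) powr p)"
      unfolding S_def by (subst sum.swap, subst sum.cartesian_product) simp
    finally have fin: "(\<Sum>\<epsilon>\<in>signs J. \<Sum>\<omega>\<in>\<Omega>. norm (\<Sum>j\<in>J. \<epsilon> j *\<^sub>R a (l j) j \<omega>) powr p)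
        \<le> (1 + b) / 2 * (\<Sum>\<epsilon>\<in>signs J. \<Sum>\<omega>\<in>\<Omega>. norm (\<Sum>j\<in>J. \<epsilon> j *\<^sub>R g j \<omega>) powr p)"
      using b by (simp add: mult_left_mono)
    then have "(\<Sum>\<epsilon>\<in>signs J. \<Sum>\<omega>\<in>\<Omega>. norm (\<Sum>j\<in>J. \<epsilon> j *\<^sub>R a (l j) j \<omega>) powr p) / 2 ^ card J
        \<le> (1 + b) / 2 * (\<Sum>\<epsilon>\<in>signs J. \<Sum>\<omega>\<in>\<Omega>. norm (\<Sum>j\<in>J. \<epsilon> j *\<^sub>R g j \<omega>) powr p) / 2 ^ card J"
      by (rule divide_right_mono) simp
    then show "sign_mean J (\<lambda>\<epsilon>. \<Sum>\<omega>\<in>\<Omega>. norm (\<Sum>j\<in>J. \<epsilon> j *\<^sub>R atom_mean \<Omega> (\<pi> (l j)) (g j) \<omega>) powr p)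
        \<le> (1 + b) / 2 * sign_mean J (\<lambda>\<epsilon>. \<Sum>\<omega>\<in>\<Omega>. norm (\<Sum>j\<in>J. \<epsilon> j *\<^sub>R g j \<omega>) powr p)"
      by (simp add: sign_mean_def a_def)
  qed
qed

section \<open>Random sums in Lebesgue-Bochner spaces\<close>

text \<open>The \<open>p\<close>-th moment \<open>radp\<close> can be computed pointwise by Fubini's theorem, which suits
  contractions and Stein's inequality. The second moment \<open>rad2\<close> is the one that occurs in the notion
  of type and in \<open>\<gamma>\<close>-bounds. Kahane's inequality links the two.\<close>

definition radp :: "real \<Rightarrow> 'm measure \<Rightarrow> 'j set \<Rightarrow> ('j \<Rightarrow> 'm \<Rightarrow> 'a::real_normed_vector) \<Rightarrow> real" where
  "radp p M J \<xi> = sign_mean J (\<lambda>\<epsilon>. \<integral>x. norm (\<Sum>j\<in>J. \<epsilon> j *\<^sub>R \<xi> j x) powr p \<partial>M)"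

definition rad2 :: "real \<Rightarrow> 'm measure \<Rightarrow> 'j set \<Rightarrow> ('j \<Rightarrow> 'm \<Rightarrow> 'a::real_normed_vector) \<Rightarrow> real" where
  "rad2 p M J \<xi> = sqrt (sign_mean J (\<lambda>\<epsilon>. (Lp_norm p M (\<lambda>x. \<Sum>j\<in>J. \<epsilon> j *\<^sub>R \<xi> j x))\<^sup>2))"

lemma rad2_nonneg [simp]: "0 \<le> rad2 p M J \<xi>"
  unfolding rad2_def by (simp add: sign_mean_nonneg)

lemma radp_nonneg [simp]: "0 \<le> radp p M J \<xi>"
  unfolding radp_def by (intro sign_mean_nonneg integral_nonneg) auto

lemma rad2_sq: "(rad2 p M J \<xi>)\<^sup>2 = sign_mean J (\<lambda>\<epsilon>. (Lp_norm p M (\<lambda>x. \<Sum>j\<in>J. \<epsilon> j *\<^sub>R \<xi> j x))\<^sup>2)"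
  unfolding rad2_def by (simp add: sign_mean_nonneg)

lemma rad2_cong:
  assumes "\<And>j x. j \<in> J \<Longrightarrow> \<xi> j x = \<eta> j x"
  shows "rad2 p M J \<xi> = rad2 p M J \<eta>"
  unfolding rad2_def using assms by simp

lemma Lp_space_lincomb:
  fixes \<xi> :: "'j \<Rightarrow> 'm \<Rightarrow> 'a::real_normed_vector"
  assumes "1 \<le> p" "\<And>j. j \<in> J \<Longrightarrow> \<xi> j \<in> Lp_space p M"
  shows "(\<lambda>x. \<Sum>j\<in>J. a j *\<^sub>R \<xi> j x) \<in> Lp_space p M"
  using assms by (intro Lp_space_sum Lp_space_scaleR) auto

lemma coeff_seminorm_Lp:
  fixes \<xi> :: "'j \<Rightarrow> 'm \<Rightarrow> 'a::real_normed_vector"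
  assumes p: "1 \<le> p" and \<xi>: "\<And>j. j \<in> J \<Longrightarrow> \<xi> j \<in> Lp_space p M"
  shows "coeff_seminorm (\<lambda>a. Lp_norm p M (\<lambda>x. \<Sum>j\<in>J. a j *\<^sub>R \<xi> j x))"
    and "depends_on J (\<lambda>a. Lp_norm p M (\<lambda>x. \<Sum>j\<in>J. a j *\<^sub>R \<xi> j x))"
proof -
  show "coeff_seminorm (\<lambda>a. Lp_norm p M (\<lambda>x. \<Sum>j\<in>J. a j *\<^sub>R \<xi> j x))"
    unfolding coeff_seminorm_def
  proof (intro conjI allI)
    fix a b :: "'j \<Rightarrow> real"
    have "Lp_norm p M (\<lambda>x. \<Sum>j\<in>J. (a j + b j) *\<^sub>R \<xi> j x)
      = Lp_norm p M (\<lambda>x. (\<Sum>j\<in>J. a j *\<^sub>R \<xi> j x) + (\<Sum>j\<in>J. b j *\<^sub>R \<xi> j x))"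
      by (simp add: scaleR_add_left sum.distrib)
    also have "\<dots> \<le> Lp_norm p M (\<lambda>x. \<Sum>j\<in>J. a j *\<^sub>R \<xi> j x) + Lp_norm p M (\<lambda>x. \<Sum>j\<in>J. b j *\<^sub>R \<xi> j x)"
      by (intro Lp_norm_triangle Lp_space_lincomb p \<xi>)
    finally show "Lp_norm p M (\<lambda>x. \<Sum>j\<in>J. (a j + b j) *\<^sub>R \<xi> j x) \<le> \<dots>" .
  next
    fix t :: real and a :: "'j \<Rightarrow> real"
    have "(\<Sum>j\<in>J. (t * a j) *\<^sub>R \<xi> j x) = t *\<^sub>R (\<Sum>j\<in>J. a j *\<^sub>R \<xi> j x)" for x
      by (simp add: scaleR_sum_right)
    then show "Lp_norm p M (\<lambda>x. \<Sum>j\<in>J. (t * a j) *\<^sub>R \<xi> j x) = \<bar>t\<bar> * Lp_norm p M (\<lambda>x. \<Sum>j\<in>J. a j *\<^sub>R \<xi> j x)"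
      using p by (simp add: Lp_norm_scaleR)
  qed simp
  show "depends_on J (\<lambda>a. Lp_norm p M (\<lambda>x. \<Sum>j\<in>J. a j *\<^sub>R \<xi> j x))"
    unfolding depends_on_def by simp
qed

lemma kahane_Lp:
  assumes p: "1 \<le> p"
  shows "\<exists>A\<ge>1. \<forall>(M :: 'm measure) (J :: 'j set) (\<xi> :: 'j \<Rightarrow> 'm \<Rightarrow> 'a::real_normed_vector).
    finite J \<longrightarrow> (\<forall>j\<in>J. \<xi> j \<in> Lp_space p M) \<longrightarrow>
    radp p M J \<xi> powr (1 / p) \<le> A * rad2 p M J \<xi> \<and> rad2 p M J \<xi> \<le> A * radp p M J \<xi> powr (1 / p)"
proof -
  obtain A :: real where A: "A \<ge> 1" and K:
    "\<And>(J :: 'j set) \<phi>. finite J \<Longrightarrow> coeff_seminorm \<phi> \<Longrightarrow> depends_on J \<phi> \<Longrightarrow>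
        (sign_mean J (\<lambda>\<epsilon>. \<phi> \<epsilon> powr p)) powr (1 / p) \<le> A * sqrt (sign_mean J (\<lambda>\<epsilon>. (\<phi> \<epsilon>)\<^sup>2)) \<and>
        sqrt (sign_mean J (\<lambda>\<epsilon>. (\<phi> \<epsilon>)\<^sup>2)) \<le> A * (sign_mean J (\<lambda>\<epsilon>. \<phi> \<epsilon> powr p)) powr (1 / p)"
    using kahane[OF p] by blast
  have "radp p M J \<xi> powr (1 / p) \<le> A * rad2 p M J \<xi> \<and> rad2 p M J \<xi> \<le> A * radp p M J \<xi> powr (1 / p)"
    if J: "finite J" and \<xi>: "\<forall>j\<in>J. \<xi> j \<in> Lp_space p M"
    for M and J :: "'j set" and \<xi> :: "'j \<Rightarrow> 'm \<Rightarrow> 'a"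
  proof -
    let ?\<phi> = "\<lambda>a. Lp_norm p M (\<lambda>x. \<Sum>j\<in>J. a j *\<^sub>R \<xi> j x)"
    have "radp p M J \<xi> = sign_mean J (\<lambda>\<epsilon>. ?\<phi> \<epsilon> powr p)"
      using p by (simp add: radp_def Lp_norm_powr)
    moreover have "coeff_seminorm ?\<phi>" "depends_on J ?\<phi>"
      using coeff_seminorm_Lp[OF p, of J \<xi> M] \<xi> by auto
    ultimately show ?thesis
      using K[OF J, of ?\<phi>] by (simp only: rad2_def)
  qed
  with A show ?thesis by blast
qed

text \<open>Kahane's contraction principle. Changing one coefficient at a time, it is the convexity of
  \<open>t \<mapsto> norm (w + t *\<^sub>R x) powr p + norm (w - t *\<^sub>R x) powr p\<close>.\<close>

lemma sign_contraction:
  fixes x :: "'j \<Rightarrow> 'a::real_normed_vector"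
  assumes p: "1 \<le> p" and J: "finite J" and a: "\<And>j. j \<in> J \<Longrightarrow> \<bar>a j\<bar> \<le> 1"
  shows "sign_mean J (\<lambda>\<epsilon>. norm (u + (\<Sum>j\<in>J. \<epsilon> j *\<^sub>R a j *\<^sub>R x j)) powr p)
    \<le> sign_mean J (\<lambda>\<epsilon>. norm (u + (\<Sum>j\<in>J. \<epsilon> j *\<^sub>R x j)) powr p)"
  using J a
proof (induction J arbitrary: u)
  case (insert i J)
  have eq: "u + (\<Sum>j\<in>insert i J. (\<epsilon>(i := s)) j *\<^sub>R y j) = (u + s *\<^sub>R y i) + (\<Sum>j\<in>J. \<epsilon> j *\<^sub>R y j)"
    for \<epsilon> s and y :: "'j \<Rightarrow> 'a"
    using insert.hyps by (auto intro!: sum.cong)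
  have IH: "sign_mean J (\<lambda>\<epsilon>. norm (v + (\<Sum>j\<in>J. \<epsilon> j *\<^sub>R a j *\<^sub>R x j)) powr p)
    \<le> sign_mean J (\<lambda>\<epsilon>. norm (v + (\<Sum>j\<in>J. \<epsilon> j *\<^sub>R x j)) powr p)" for v
    using insert by auto
  define t where "t = a i"
  have t: "\<bar>t\<bar> \<le> 1" using insert.prems by (simp add: t_def)
  have two: "norm (w + 1 *\<^sub>R t *\<^sub>R x i) powr p + norm (w + (-1) *\<^sub>R t *\<^sub>R x i) powr p
      \<le> norm (w + 1 *\<^sub>R x i) powr p + norm (w + (-1) *\<^sub>R x i) powr p" for w
  proof -
    have c: "norm (w + s *\<^sub>R x i) powr p
        \<le> (1 + s) / 2 * norm (w + x i) powr p + (1 - (1 + s) / 2) * norm (w + (-1) *\<^sub>R x i) powr p"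
      if "\<bar>s\<bar> \<le> 1" for s
    proof -
      have "w + s *\<^sub>R x i = ((1 + s) / 2) *\<^sub>R (w + x i) + (1 - (1 + s) / 2) *\<^sub>R (w + (-1) *\<^sub>R x i)"
      proof -
        have "b *\<^sub>R (w + x i) + d *\<^sub>R (w + (-1) *\<^sub>R x i) = (b + d) *\<^sub>R w + (b - d) *\<^sub>R x i" for b d
          by (simp add: algebra_simps)
        then have "((1 + s) / 2) *\<^sub>R (w + x i) + (1 - (1 + s) / 2) *\<^sub>R (w + (-1) *\<^sub>R x i)
          = ((1 + s) / 2 + (1 - (1 + s) / 2)) *\<^sub>R w + ((1 + s) / 2 - (1 - (1 + s) / 2)) *\<^sub>R x i" .
        also have "(1 + s) / 2 + (1 - (1 + s) / 2) = 1" by simp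
        also have "(1 + s) / 2 - (1 - (1 + s) / 2) = s" by (simp add: field_simps)
        finally show ?thesis by simp
      qed
      then show ?thesis
        using that p by (simp only:) (intro convex_norm_powr, auto simp: abs_le_iff)
    qed
    have "norm (w + t *\<^sub>R x i) powr p + norm (w + (- t) *\<^sub>R x i) powr p
      \<le> ((1 + t) / 2 * norm (w + x i) powr p + (1 - (1 + t) / 2) * norm (w + (-1) *\<^sub>R x i) powr p)
       + ((1 + (- t)) / 2 * norm (w + x i) powr p + (1 - (1 + (- t)) / 2) * norm (w + (-1) *\<^sub>R x i) powr p)"
      using t by (intro add_mono c) auto
    also have "\<dots> = norm (w + x i) powr p + norm (w + (-1) *\<^sub>R x i) powr p"
      by (simp add: field_simps)
    finally show ?thesis by simp
  qed
  have swap: "(u + c) + (\<Sum>j\<in>J. \<epsilon> j *\<^sub>R x j) = (u + (\<Sum>j\<in>J. \<epsilon> j *\<^sub>R x j)) + c" for c and \<epsilon> :: "'j \<Rightarrow> real"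
    by (simp only: add_ac)
  have "sign_mean (insert i J) (\<lambda>\<epsilon>. norm (u + (\<Sum>j\<in>insert i J. \<epsilon> j *\<^sub>R a j *\<^sub>R x j)) powr p)
    = (sign_mean J (\<lambda>\<epsilon>. norm ((u + 1 *\<^sub>R t *\<^sub>R x i) + (\<Sum>j\<in>J. \<epsilon> j *\<^sub>R a j *\<^sub>R x j)) powr p)
     + sign_mean J (\<lambda>\<epsilon>. norm ((u + (-1) *\<^sub>R t *\<^sub>R x i) + (\<Sum>j\<in>J. \<epsilon> j *\<^sub>R a j *\<^sub>R x j)) powr p)) / 2"
    unfolding sign_mean_insert[OF insert.hyps] eq t_def ..
  also have "\<dots> \<le> (sign_mean J (\<lambda>\<epsilon>. norm ((u + 1 *\<^sub>R t *\<^sub>R x i) + (\<Sum>j\<in>J. \<epsilon> j *\<^sub>R x j)) powr p)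
     + sign_mean J (\<lambda>\<epsilon>. norm ((u + (-1) *\<^sub>R t *\<^sub>R x i) + (\<Sum>j\<in>J. \<epsilon> j *\<^sub>R x j)) powr p)) / 2"
    by (rule divide_right_mono[OF add_mono[OF IH IH]]) simp
  also have "\<dots> = sign_mean J (\<lambda>\<epsilon>. norm ((u + (\<Sum>j\<in>J. \<epsilon> j *\<^sub>R x j)) + 1 *\<^sub>R t *\<^sub>R x i) powr p
     + norm ((u + (\<Sum>j\<in>J. \<epsilon> j *\<^sub>R x j)) + (-1) *\<^sub>R t *\<^sub>R x i) powr p) / 2"
    unfolding sign_mean_add swap ..
  also have "\<dots> \<le> sign_mean J (\<lambda>\<epsilon>. norm ((u + (\<Sum>j\<in>J. \<epsilon> j *\<^sub>R x j)) + 1 *\<^sub>R x i) powr p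
     + norm ((u + (\<Sum>j\<in>J. \<epsilon> j *\<^sub>R x j)) + (-1) *\<^sub>R x i) powr p) / 2"
    by (rule divide_right_mono[OF sign_mean_mono[OF two]]) simp
  also have "\<dots> = (sign_mean J (\<lambda>\<epsilon>. norm ((u + 1 *\<^sub>R x i) + (\<Sum>j\<in>J. \<epsilon> j *\<^sub>R x j)) powr p)
     + sign_mean J (\<lambda>\<epsilon>. norm ((u + (-1) *\<^sub>R x i) + (\<Sum>j\<in>J. \<epsilon> j *\<^sub>R x j)) powr p)) / 2"
    unfolding sign_mean_add swap ..
  also have "\<dots> = sign_mean (insert i J) (\<lambda>\<epsilon>. norm (u + (\<Sum>j\<in>insert i J. \<epsilon> j *\<^sub>R x j)) powr p)"
    unfolding sign_mean_insert[OF insert.hyps] eq ..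
  finally show ?case .
qed simp

lemma sign_contraction_scaled:
  fixes x :: "'j \<Rightarrow> 'a::real_normed_vector"
  assumes p: "1 \<le> p" and J: "finite J" and c: "0 < c" and a: "\<And>j. j \<in> J \<Longrightarrow> \<bar>a j\<bar> \<le> c"
  shows "sign_mean J (\<lambda>\<epsilon>. norm (\<Sum>j\<in>J. \<epsilon> j *\<^sub>R a j *\<^sub>R x j) powr p)
    \<le> c powr p * sign_mean J (\<lambda>\<epsilon>. norm (\<Sum>j\<in>J. \<epsilon> j *\<^sub>R x j) powr p)"
proof -
  have "norm (\<Sum>j\<in>J. \<epsilon> j *\<^sub>R a j *\<^sub>R x j) powr p = c powr p * norm (\<Sum>j\<in>J. \<epsilon> j *\<^sub>R (a j / c) *\<^sub>R x j) powr p" for \<epsilon>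
  proof -
    have "(\<Sum>j\<in>J. \<epsilon> j *\<^sub>R a j *\<^sub>R x j) = c *\<^sub>R (\<Sum>j\<in>J. \<epsilon> j *\<^sub>R (a j / c) *\<^sub>R x j)"
      using c by (simp add: scaleR_sum_right)
    then show ?thesis using c by (simp add: powr_mult)
  qed
  then have "sign_mean J (\<lambda>\<epsilon>. norm (\<Sum>j\<in>J. \<epsilon> j *\<^sub>R a j *\<^sub>R x j) powr p)
    = c powr p * sign_mean J (\<lambda>\<epsilon>. norm (\<Sum>j\<in>J. \<epsilon> j *\<^sub>R (a j / c) *\<^sub>R x j) powr p)"
    by (simp only: sign_mean_cmult)
  also have "\<dots> \<le> c powr p * sign_mean J (\<lambda>\<epsilon>. norm (\<Sum>j\<in>J. \<epsilon> j *\<^sub>R x j) powr p)"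
    using sign_contraction[OF p J, of "\<lambda>j. a j / c" 0 x] a c by (intro mult_left_mono) auto
  finally show ?thesis .
qed

lemma radp_eq_integral:
  fixes \<xi> :: "'j \<Rightarrow> 'm \<Rightarrow> 'a::real_normed_vector"
  assumes p: "1 \<le> p" and \<xi>: "\<And>j. j \<in> J \<Longrightarrow> \<xi> j \<in> Lp_space p M"
  shows "radp p M J \<xi> = (\<integral>x. sign_mean J (\<lambda>\<epsilon>. norm (\<Sum>j\<in>J. \<epsilon> j *\<^sub>R \<xi> j x) powr p) \<partial>M)"
    and "integrable M (\<lambda>x. sign_mean J (\<lambda>\<epsilon>. norm (\<Sum>j\<in>J. \<epsilon> j *\<^sub>R \<xi> j x) powr p))"
proof -
  have int: "integrable M (\<lambda>x. norm (\<Sum>j\<in>J. \<epsilon> j *\<^sub>R \<xi> j x) powr p)" for \<epsilon>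
    using Lp_space_lincomb[OF p, of J \<xi> M \<epsilon>] \<xi> by (simp add: Lp_space_iff)
  show "integrable M (\<lambda>x. sign_mean J (\<lambda>\<epsilon>. norm (\<Sum>j\<in>J. \<epsilon> j *\<^sub>R \<xi> j x) powr p))"
    unfolding sign_mean_def using int by (intro integrable_divide Bochner_Integration.integrable_sum)
  show "radp p M J \<xi> = (\<integral>x. sign_mean J (\<lambda>\<epsilon>. norm (\<Sum>j\<in>J. \<epsilon> j *\<^sub>R \<xi> j x) powr p) \<partial>M)"
    unfolding radp_def sign_mean_def using int by (simp add: Bochner_Integration.integral_sum)
qed

lemma radp_contraction:
  fixes \<xi> :: "'j \<Rightarrow> 'm \<Rightarrow> 'a::real_normed_vector"
  assumes p: "1 \<le> p" and J: "finite J" and \<xi>: "\<And>j. j \<in> J \<Longrightarrow> \<xi> j \<in> Lp_space p M"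
    and a: "\<And>j. j \<in> J \<Longrightarrow> a j \<in> borel_measurable M" and c: "0 < c" "\<And>j x. j \<in> J \<Longrightarrow> \<bar>a j x\<bar> \<le> c"
  shows "radp p M J (\<lambda>j x. a j x *\<^sub>R \<xi> j x) \<le> c powr p * radp p M J \<xi>"
proof -
  have a\<xi>: "(\<lambda>x. a j x *\<^sub>R \<xi> j x) \<in> Lp_space p M" if "j \<in> J" for j
    using p c that by (intro Lp_space_mult[where c = c] \<xi> a) auto
  have "radp p M J (\<lambda>j x. a j x *\<^sub>R \<xi> j x)
      = (\<integral>x. sign_mean J (\<lambda>\<epsilon>. norm (\<Sum>j\<in>J. \<epsilon> j *\<^sub>R a j x *\<^sub>R \<xi> j x) powr p) \<partial>M)"
    by (rule radp_eq_integral(1)[OF p]) (rule a\<xi>)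
  also have "\<dots> \<le> (\<integral>x. c powr p * sign_mean J (\<lambda>\<epsilon>. norm (\<Sum>j\<in>J. \<epsilon> j *\<^sub>R \<xi> j x) powr p) \<partial>M)"
  proof (rule integral_mono)
    show "integrable M (\<lambda>x. sign_mean J (\<lambda>\<epsilon>. norm (\<Sum>j\<in>J. \<epsilon> j *\<^sub>R a j x *\<^sub>R \<xi> j x) powr p))"
      by (rule radp_eq_integral(2)[OF p]) (rule a\<xi>)
    show "integrable M (\<lambda>x. c powr p * sign_mean J (\<lambda>\<epsilon>. norm (\<Sum>j\<in>J. \<epsilon> j *\<^sub>R \<xi> j x) powr p))"
      by (intro integrable_mult_right radp_eq_integral(2)[OF p] \<xi>)
    show "sign_mean J (\<lambda>\<epsilon>. norm (\<Sum>j\<in>J. \<epsilon> j *\<^sub>R a j x *\<^sub>R \<xi> j x) powr p)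
        \<le> c powr p * sign_mean J (\<lambda>\<epsilon>. norm (\<Sum>j\<in>J. \<epsilon> j *\<^sub>R \<xi> j x) powr p)" for x
      by (rule sign_contraction_scaled[OF p J c(1)]) (rule c(2))
  qed
  also have "\<dots> = c powr p * radp p M J \<xi>"
    using radp_eq_integral(1)[OF p, of J \<xi> M] \<xi> by simp
  finally show ?thesis .
qed

text \<open>Multipliers may depend on the point of \<open>M\<close>, because the contraction principle is applied to
  \<open>p\<close>-th moments at each point separately. The passage from second moments to \<open>p\<close>-th moments and
  back costs \<open>A\<close>.\<close>

lemma rad2_contraction:
  assumes p: "1 \<le> p"
  shows "\<exists>A\<ge>1. \<forall>(M :: 'm measure) (J :: 'j set) (\<xi> :: 'j \<Rightarrow> 'm \<Rightarrow> 'a::real_normed_vector) a c.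
    finite J \<longrightarrow> (\<forall>j\<in>J. \<xi> j \<in> Lp_space p M) \<longrightarrow> (\<forall>j\<in>J. a j \<in> borel_measurable M) \<longrightarrow>
    0 < c \<longrightarrow> (\<forall>j\<in>J. \<forall>x. \<bar>a j x\<bar> \<le> c) \<longrightarrow>
    rad2 p M J (\<lambda>j x. a j x *\<^sub>R \<xi> j x) \<le> A * c * rad2 p M J \<xi>"
proof -
  obtain A where A: "A \<ge> 1" and K:
    "\<And>(M :: 'm measure) (J :: 'j set) (\<xi> :: 'j \<Rightarrow> 'm \<Rightarrow> 'a).
    finite J \<Longrightarrow> (\<forall>j\<in>J. \<xi> j \<in> Lp_space p M) \<Longrightarrow>
    radp p M J \<xi> powr (1 / p) \<le> A * rad2 p M J \<xi> \<and> rad2 p M J \<xi> \<le> A * radp p M J \<xi> powr (1 / p)"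
    using kahane_Lp[OF p] by blast
  have "rad2 p M J (\<lambda>j x. a j x *\<^sub>R \<xi> j x) \<le> (A * A) * c * rad2 p M J \<xi>"
    if J: "finite J" and \<xi>: "\<forall>j\<in>J. \<xi> j \<in> Lp_space p M" and a: "\<forall>j\<in>J. a j \<in> borel_measurable M"
      and c: "0 < c" "\<forall>j\<in>J. \<forall>x. \<bar>a j x\<bar> \<le> c"
    for M and J :: "'j set" and \<xi> :: "'j \<Rightarrow> 'm \<Rightarrow> 'a" and a c
  proof -
    have a\<xi>: "\<forall>j\<in>J. (\<lambda>x. a j x *\<^sub>R \<xi> j x) \<in> Lp_space p M"
      using p c \<xi> a by (intro ballI Lp_space_mult[where c = c]) auto
    have "rad2 p M J (\<lambda>j x. a j x *\<^sub>R \<xi> j x) \<le> A * radp p M J (\<lambda>j x. a j x *\<^sub>R \<xi> j x) powr (1 / p)"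
      using K[OF J a\<xi>] by simp
    also have "\<dots> \<le> A * (c powr p * radp p M J \<xi>) powr (1 / p)"
    proof (rule mult_left_mono[OF powr_mono2])
      show "radp p M J (\<lambda>j x. a j x *\<^sub>R \<xi> j x) \<le> c powr p * radp p M J \<xi>"
        by (rule radp_contraction[OF p J]) (use \<xi> a c in auto)
    qed (use A p in auto)
    also have "\<dots> = A * c * radp p M J \<xi> powr (1 / p)"
      using p c by (simp add: powr_mult powr_powr)
    also have "\<dots> \<le> A * c * (A * rad2 p M J \<xi>)"
      by (rule mult_left_mono) (use A c K[OF J \<xi>] in auto)
    finally show ?thesis by (simp only: mult_ac)
  qed
  moreover have "A * A \<ge> 1" using A mult_mono[of 1 A 1 A] by simp
  ultimately show ?thesis by (intro exI[of _ "A * A"]) blast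
qed

lemma rad2_sum:
  fixes \<xi> :: "'i \<Rightarrow> 'j \<Rightarrow> 'm \<Rightarrow> 'a::real_normed_vector"
  assumes p: "1 \<le> p" and J: "finite J" and "\<And>i j. i \<in> I \<Longrightarrow> j \<in> J \<Longrightarrow> \<xi> i j \<in> Lp_space p M"
  shows "rad2 p M J (\<lambda>j x. \<Sum>i\<in>I. \<xi> i j x) \<le> (\<Sum>i\<in>I. rad2 p M J (\<xi> i))"
  using assms(3)
proof (induction I rule: infinite_finite_induct)
  case (insert i I)
  let ?S = "\<lambda>j x. \<Sum>i\<in>I. \<xi> i j x"
  have S: "?S j \<in> Lp_space p M" if "j \<in> J" for j
    using insert.prems that by (intro Lp_space_sum p) auto
  have "rad2 p M J (\<lambda>j x. \<xi> i j x + ?S j x) \<le> rad2 p M J (\<xi> i) + rad2 p M J ?S"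
    unfolding rad2_def
  proof (rule sign_mean_sq_triangle[OF J])
    fix \<epsilon>
    have "Lp_norm p M (\<lambda>x. \<Sum>j\<in>J. \<epsilon> j *\<^sub>R (\<xi> i j x + ?S j x))
      = Lp_norm p M (\<lambda>x. (\<Sum>j\<in>J. \<epsilon> j *\<^sub>R \<xi> i j x) + (\<Sum>j\<in>J. \<epsilon> j *\<^sub>R ?S j x))"
      by (simp add: scaleR_add_right sum.distrib)
    also have "\<dots> \<le> Lp_norm p M (\<lambda>x. \<Sum>j\<in>J. \<epsilon> j *\<^sub>R \<xi> i j x) + Lp_norm p M (\<lambda>x. \<Sum>j\<in>J. \<epsilon> j *\<^sub>R ?S j x)"
      using insert.prems S by (intro Lp_norm_triangle Lp_space_lincomb p) auto
    finally show "0 \<le> Lp_norm p M (\<lambda>x. \<Sum>j\<in>J. \<epsilon> j *\<^sub>R (\<xi> i j x + ?S j x)) \<and>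
      Lp_norm p M (\<lambda>x. \<Sum>j\<in>J. \<epsilon> j *\<^sub>R (\<xi> i j x + ?S j x)) \<le>
      Lp_norm p M (\<lambda>x. \<Sum>j\<in>J. \<epsilon> j *\<^sub>R \<xi> i j x) + Lp_norm p M (\<lambda>x. \<Sum>j\<in>J. \<epsilon> j *\<^sub>R ?S j x)"
      by simp
  qed simp
  also have "rad2 p M J ?S \<le> (\<Sum>i\<in>I. rad2 p M J (\<xi> i))"
    using insert by auto
  finally show ?case using insert.hyps by simp
qed (auto simp: rad2_def Lp_norm_def sign_mean_def)

text \<open>If the functions \<open>F m j\<close>, \<open>m < K\<close>, have disjoint supports for each fixed \<open>j\<close>, then their
  sum over \<open>m\<close> may be given arbitrary signs by the contraction principle, with multipliers that
  depend on \<open>j\<close> and on the point. Averaging over these signs brings in the type.\<close>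

lemma rad2_disjoint_sum_type:
  assumes p: "1 < p" and type: "has_type (Lp_space p M :: ('m \<Rightarrow> 'a::real_normed_vector) set) (Lp_norm p M) \<tau>"
  shows "\<exists>C\<ge>0. \<forall>(J :: 'j set) (K :: nat) (F :: nat \<Rightarrow> 'j \<Rightarrow> 'm \<Rightarrow> 'a) R.
    finite J \<longrightarrow> 1 \<le> K \<longrightarrow> (\<forall>m<K. \<forall>j\<in>J. F m j \<in> Lp_space p M) \<longrightarrow>
    (\<forall>j\<in>J. \<forall>x. \<forall>m<K. \<forall>m'<K. F m j x \<noteq> 0 \<longrightarrow> F m' j x \<noteq> 0 \<longrightarrow> m = m') \<longrightarrow>
    (\<forall>m<K. rad2 p M J (F m) \<le> R) \<longrightarrow>
    rad2 p M J (\<lambda>j x. \<Sum>m<K. F m j x) \<le> C * real K powr (1 / \<tau>) * R"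
proof -
  have p1: "1 \<le> p" using p by simp
  obtain A where A: "A \<ge> 1" and contr:
    "\<And>(M :: 'm measure) (J :: 'j set) (\<xi> :: 'j \<Rightarrow> 'm \<Rightarrow> 'a) a c.
    finite J \<Longrightarrow> (\<forall>j\<in>J. \<xi> j \<in> Lp_space p M) \<Longrightarrow> (\<forall>j\<in>J. a j \<in> borel_measurable M) \<Longrightarrow>
    0 < c \<Longrightarrow> (\<forall>j\<in>J. \<forall>x. \<bar>a j x\<bar> \<le> c) \<Longrightarrow>
    rad2 p M J (\<lambda>j x. a j x *\<^sub>R \<xi> j x) \<le> A * c * rad2 p M J \<xi>"
    using rad2_contraction[OF p1] by blast
  have \<tau>: "1 \<le> \<tau>" "\<tau> \<le> 2" using type by (auto simp: has_type_def)
  from type obtain T where T: "0 \<le> T" and T0: "\<forall>k\<ge>1. \<forall>\<xi> :: nat \<Rightarrow> 'm \<Rightarrow> 'a. (\<forall>j<k. \<xi> j \<in> Lp_space p M) \<longrightarrow>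
      sqrt ((\<Sum>\<epsilon> \<in> {..<k} \<rightarrow>\<^sub>E {-1, 1}. (Lp_norm p M (\<lambda>x. \<Sum>j<k. \<epsilon> j *\<^sub>R \<xi> j x))\<^sup>2) / 2 ^ k)
        \<le> T * (\<Sum>j<k. Lp_norm p M (\<xi> j) powr \<tau>) powr (1 / \<tau>)"
    unfolding has_type_def by (elim conjE exE)
  have TI: "rad2 p M {..<k} \<xi> \<le> T * (\<Sum>j<k. Lp_norm p M (\<xi> j) powr \<tau>) powr (1 / \<tau>)"
    if "k \<ge> 1" "\<forall>j<k. \<xi> j \<in> Lp_space p M" for k and \<xi> :: "nat \<Rightarrow> 'm \<Rightarrow> 'a"
    using T0[THEN spec, THEN mp, OF that(1), THEN spec, THEN mp, OF that(2)]
    unfolding rad2_def sign_mean_def signs_def card_lessThan .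
  \<comment> \<open>With Hoelder's inequality the bound is quadratic on both sides, which is what survives the
    averages over \<open>\<epsilon>\<close>.\<close>
  have TI2: "(rad2 p M {..<k} \<xi>)\<^sup>2 \<le> T\<^sup>2 * (real k powr (2 / \<tau> - 1) * (\<Sum>j<k. (Lp_norm p M (\<xi> j))\<^sup>2))"
    if k: "k \<ge> 1" and \<xi>: "\<forall>j<k. \<xi> j \<in> Lp_space p M" for k and \<xi> :: "nat \<Rightarrow> 'm \<Rightarrow> 'a"
  proof -
    define s where "s = (\<Sum>j<k. Lp_norm p M (\<xi> j) powr \<tau>)"
    have s0: "0 \<le> s" by (simp add: s_def sum_nonneg)
    have "norm ((\<Sum>j<k. Lp_norm p M (\<xi> j) powr \<tau>) /\<^sub>R card {..<k}) powr (2 / \<tau>)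
        \<le> (\<Sum>j<k. norm (Lp_norm p M (\<xi> j) powr \<tau>) powr (2 / \<tau>)) / card {..<k}"
      using k \<tau> by (intro norm_mean_powr_le) (auto simp: lessThan_empty_iff)
    also have "norm ((\<Sum>j<k. Lp_norm p M (\<xi> j) powr \<tau>) /\<^sub>R card {..<k}) = s / real k"
      using s0 by (simp add: s_def[symmetric] divide_inverse mult.commute)
    also have "(\<Sum>j<k. norm (Lp_norm p M (\<xi> j) powr \<tau>) powr (2 / \<tau>)) = (\<Sum>j<k. (Lp_norm p M (\<xi> j))\<^sup>2)"
      using \<tau> by (intro sum.cong refl) (simp add: powr_powr)
    finally have "s powr (2 / \<tau>) \<le> real k powr (2 / \<tau>) * ((\<Sum>j<k. (Lp_norm p M (\<xi> j))\<^sup>2) / real k)"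
      using k s0 by (simp add: powr_divide field_simps)
    also have "\<dots> = real k powr (2 / \<tau> - 1) * (\<Sum>j<k. (Lp_norm p M (\<xi> j))\<^sup>2)"
      using k by (simp add: powr_diff)
    finally have sk: "s powr (2 / \<tau>) \<le> \<dots>" .
    have "(rad2 p M {..<k} \<xi>)\<^sup>2 \<le> (T * s powr (1 / \<tau>))\<^sup>2"
      using TI[OF k \<xi>] by (intro power_mono) (auto simp: s_def)
    also have "\<dots> = T\<^sup>2 * s powr (2 / \<tau>)"
      by (simp add: power_mult_distrib power2_eq_square flip: powr_add)
    also have "\<dots> \<le> T\<^sup>2 * (real k powr (2 / \<tau> - 1) * (\<Sum>j<k. (Lp_norm p M (\<xi> j))\<^sup>2))"
      by (intro mult_left_mono sk) auto
    finally show ?thesis .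
  qed
  have main: "rad2 p M J (\<lambda>j x. \<Sum>m<K. F m j x) \<le> (A * T) * real K powr (1 / \<tau>) * R"
    if J: "finite J" and K: "1 \<le> K" and F: "\<forall>m<K. \<forall>j\<in>J. F m j \<in> Lp_space p M"
      and disj: "\<forall>j\<in>J. \<forall>x. \<forall>m<K. \<forall>m'<K. F m j x \<noteq> 0 \<longrightarrow> F m' j x \<noteq> 0 \<longrightarrow> m = m'"
      and R: "\<forall>m<K. rad2 p M J (F m) \<le> R"
    for J :: "'j set" and K and F :: "nat \<Rightarrow> 'j \<Rightarrow> 'm \<Rightarrow> 'a" and R
  proof -
    have "0 \<le> rad2 p M J (F 0)" by simp
    also have "\<dots> \<le> R" using R K by auto
    finally have R0: "0 \<le> R" .
    let ?G = "\<lambda>\<delta> j x. \<Sum>m<K. \<delta> m *\<^sub>R F m j x"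
    have sgn: "(rad2 p M J (\<lambda>j x. \<Sum>m<K. F m j x))\<^sup>2 \<le> A\<^sup>2 * (rad2 p M J (?G \<delta>))\<^sup>2"
      if \<delta>: "\<delta> \<in> signs {..<K}" for \<delta>
    proof -
      have \<delta>1: "\<bar>\<delta> m\<bar> = 1" if "m < K" for m using signs_abs[OF \<delta>] that by simp
      define S where "S m j = {x \<in> space M. F m j x \<noteq> 0}" for m j
      define a where "a j x = (\<Sum>m<K. \<delta> m * indicator (S m j) x)" for j x
      have Sm: "S m j \<in> sets M" if "m < K" "j \<in> J" for m j
      proof -
        have "(\<lambda>x. norm (F m j x)) \<in> borel_measurable M"
          using F that by (intro strongly_measurable_norm) (auto simp: Lp_space_iff)
        then have "{x \<in> space M. norm (F m j x) \<noteq> 0} \<in> sets M" by measurable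
        then show ?thesis by (simp add: S_def)
      qed
      have am: "a j \<in> borel_measurable M" if "j \<in> J" for j
        unfolding a_def using Sm that by (intro borel_measurable_sum borel_measurable_times) auto
      have one: "a j x = \<delta> m" if "j \<in> J" "m < K" "x \<in> S m j" for j x m
      proof -
        have "a j x = (\<Sum>m'\<in>{m}. \<delta> m' * indicator (S m' j) x)"
          unfolding a_def
        proof (rule sum.mono_neutral_right)
          show "\<forall>i\<in>{..<K} - {m}. \<delta> i * indicator (S i j) x = 0"
          proof
            fix i assume "i \<in> {..<K} - {m}"
            then have "x \<notin> S i j" using disj that by (auto simp: S_def)
            then show "\<delta> i * indicator (S i j) x = 0" by simp
          qed
        qed (use that in auto)
        then show ?thesis using that by simp
      qed
      have zero: "a j x = 0" if "\<And>m. m < K \<Longrightarrow> x \<notin> S m j" for j x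
        unfolding a_def using that by (intro sum.neutral) auto
      have a1: "\<bar>a j x\<bar> \<le> 1" if "j \<in> J" for j x
      proof (cases "\<exists>m<K. x \<in> S m j")
        case True
        then show ?thesis using one[OF that] \<delta>1 by force
      next
        case False
        then show ?thesis using zero[of x j] by auto
      qed
      have a2: "a j x *\<^sub>R ?G \<delta> j x = (\<Sum>m<K. F m j x)" if "j \<in> J" "x \<in> space M" for j x
      proof (cases "\<exists>m<K. x \<in> S m j")
        case True
        then obtain m where m: "m < K" "x \<in> S m j" by blast
        have z: "F i j x = 0" if "i \<in> {..<K} - {m}" for i
          using disj m that \<open>j \<in> J\<close> by (auto simp: S_def)
        have "?G \<delta> j x = (\<Sum>i\<in>{m}. \<delta> i *\<^sub>R F i j x)"
          by (rule sum.mono_neutral_right) (use m z in auto)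
        moreover have "(\<Sum>i<K. F i j x) = (\<Sum>i\<in>{m}. F i j x)"
          by (rule sum.mono_neutral_right) (use m z in auto)
        moreover have "\<delta> m * \<delta> m = 1" using \<delta>1[OF m(1)] by (metis abs_mult_self_eq mult_1)
        ultimately show ?thesis using one[OF that(1) m] by simp
      next
        case False
        then have "F m j x = 0" if "m < K" for m using that \<open>x \<in> space M\<close> by (auto simp: S_def)
        then show ?thesis by simp
      qed
      have "Lp_norm p M (\<lambda>x. \<Sum>j\<in>J. \<epsilon> j *\<^sub>R (\<Sum>m<K. F m j x))
          = Lp_norm p M (\<lambda>x. \<Sum>j\<in>J. \<epsilon> j *\<^sub>R a j x *\<^sub>R ?G \<delta> j x)" for \<epsilon>
      proof -
        have "(\<integral>x. norm (\<Sum>j\<in>J. \<epsilon> j *\<^sub>R (\<Sum>m<K. F m j x)) powr p \<partial>M)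
            = (\<integral>x. norm (\<Sum>j\<in>J. \<epsilon> j *\<^sub>R a j x *\<^sub>R ?G \<delta> j x) powr p \<partial>M)"
        proof (rule Bochner_Integration.integral_cong[OF refl])
          fix x assume x: "x \<in> space M"
          have "(\<Sum>j\<in>J. \<epsilon> j *\<^sub>R (\<Sum>m<K. F m j x)) = (\<Sum>j\<in>J. \<epsilon> j *\<^sub>R a j x *\<^sub>R ?G \<delta> j x)"
            by (rule sum.cong[OF refl]) (simp only: a2 x)
          then show "norm (\<Sum>j\<in>J. \<epsilon> j *\<^sub>R (\<Sum>m<K. F m j x)) powr p
              = norm (\<Sum>j\<in>J. \<epsilon> j *\<^sub>R a j x *\<^sub>R ?G \<delta> j x) powr p"
            by (simp only:)
        qed
        then show ?thesis by (simp only: Lp_norm_def)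
      qed
      then have "rad2 p M J (\<lambda>j x. \<Sum>m<K. F m j x) = rad2 p M J (\<lambda>j x. a j x *\<^sub>R ?G \<delta> j x)"
        by (simp only: rad2_def)
      also have "\<dots> \<le> A * 1 * rad2 p M J (?G \<delta>)"
        using F a1 am by (intro contr J ballI Lp_space_lincomb p1) auto
      finally have "(rad2 p M J (\<lambda>j x. \<Sum>m<K. F m j x))\<^sup>2 \<le> (A * 1 * rad2 p M J (?G \<delta>))\<^sup>2"
        by (intro power_mono) auto
      then show ?thesis by (simp add: power_mult_distrib)
    qed
    let ?\<Phi> = "\<lambda>\<epsilon> m x. \<Sum>j\<in>J. \<epsilon> j *\<^sub>R F m j x"
    have \<Phi>: "\<forall>m<K. ?\<Phi> \<epsilon> m \<in> Lp_space p M" for \<epsilon>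
      using F by (auto intro!: Lp_space_lincomb p1)
    have "(rad2 p M J (\<lambda>j x. \<Sum>m<K. F m j x))\<^sup>2 = sign_mean {..<K} (\<lambda>\<delta>. (rad2 p M J (\<lambda>j x. \<Sum>m<K. F m j x))\<^sup>2)"
      by simp
    also have "\<dots> \<le> sign_mean {..<K} (\<lambda>\<delta>. A\<^sup>2 * (rad2 p M J (?G \<delta>))\<^sup>2)"
      by (rule sign_mean_mono) (rule sgn)
    also have "\<dots> = A\<^sup>2 * sign_mean J (\<lambda>\<epsilon>. sign_mean {..<K} (\<lambda>\<delta>. (Lp_norm p M (\<lambda>x. \<Sum>j\<in>J. \<epsilon> j *\<^sub>R ?G \<delta> j x))\<^sup>2))"
      unfolding sign_mean_cmult rad2_sq by (subst sign_mean_swap) simp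
    also have "\<dots> = A\<^sup>2 * sign_mean J (\<lambda>\<epsilon>. (rad2 p M {..<K} (?\<Phi> \<epsilon>))\<^sup>2)"
    proof -
      have "(\<Sum>j\<in>J. \<epsilon> j *\<^sub>R ?G \<delta> j x) = (\<Sum>m<K. \<delta> m *\<^sub>R ?\<Phi> \<epsilon> m x)" for \<epsilon> \<delta> x
        unfolding scaleR_sum_right by (subst sum.swap) (simp add: mult.commute)
      then show ?thesis by (simp add: rad2_sq)
    qed
    also have "\<dots> \<le> A\<^sup>2 * sign_mean J (\<lambda>\<epsilon>. T\<^sup>2 * (real K powr (2 / \<tau> - 1) * (\<Sum>m<K. (Lp_norm p M (?\<Phi> \<epsilon> m))\<^sup>2)))"
      by (intro mult_left_mono sign_mean_mono TI2 K \<Phi>) auto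
    also have "\<dots> = A\<^sup>2 * (T\<^sup>2 * (real K powr (2 / \<tau> - 1) * (\<Sum>m<K. (rad2 p M J (F m))\<^sup>2)))"
      unfolding sign_mean_cmult sign_mean_sum rad2_sq ..
    also have "\<dots> \<le> A\<^sup>2 * (T\<^sup>2 * (real K powr (2 / \<tau> - 1) * (\<Sum>m<K. R\<^sup>2)))"
      using R by (intro mult_left_mono sum_mono power_mono) auto
    also have "real K powr (2 / \<tau> - 1) * (\<Sum>m<K. R\<^sup>2) = (real K powr (1 / \<tau>))\<^sup>2 * R\<^sup>2"
    proof -
      have "real K powr (2 / \<tau> - 1) * real K = real K powr (2 / \<tau>)"
        using K by (simp add: powr_diff)
      moreover have "(real K powr (1 / \<tau>))\<^sup>2 = real K powr (2 / \<tau>)"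
        by (simp add: power2_eq_square flip: powr_add)
      ultimately show ?thesis by simp
    qed
    finally have "(rad2 p M J (\<lambda>j x. \<Sum>m<K. F m j x))\<^sup>2 \<le> ((A * T) * real K powr (1 / \<tau>) * R)\<^sup>2"
      by (simp add: power_mult_distrib mult_ac)
    then show ?thesis
      by (rule power2_le_imp_le) (use A T R0 in auto)
  qed
  show ?thesis
  proof (intro exI[of _ "A * T"] conjI allI impI)
    show "0 \<le> A * T" using A T by simp
  qed (rule main)
qed

section \<open>Homogeneous grids\<close>

lemma Lp_space_indicator:
  fixes y :: "'a::real_normed_vector"
  assumes p: "0 < p" and A: "A \<in> sets M" "emeasure M A < \<infinity>"
  shows "(\<lambda>x. indicator A x *\<^sub>R y) \<in> Lp_space p M"
proof -
  have "integrable M (\<lambda>x. indicator A x * norm y powr p)"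
    using A by (intro integrable_mult_left integrable_real_indicator) auto
  also have "(\<lambda>x. indicator A x * norm y powr p) = (\<lambda>x. norm (indicator A x *\<^sub>R y) powr p)"
    by (auto simp: indicator_def fun_eq_iff)
  finally show ?thesis
    using A by (auto simp: Lp_space_iff intro!: strongly_measurable_scaleR strongly_measurable_const)
qed

text \<open>\<open>\<kappa> i x\<close> is the label of the cell of generation \<open>i\<close> that contains \<open>x\<close>. Each cell is the union
  of \<open>K\<close> cells of the generation before, numbered by \<open>pos\<close>, and all cells of one generation have
  the same measure.\<close>

locale homogeneous_grid =
  fixes M :: "'e measure" and \<kappa> :: "nat \<Rightarrow> 'e \<Rightarrow> 'c" and par :: "'c \<Rightarrow> 'c" and pos :: "'c \<Rightarrow> nat"
    and K :: nat and v :: real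
  assumes space_UNIV: "space M = UNIV"
    and label_Suc: "\<kappa> (Suc i) x = par (\<kappa> i x)"
    and pos_bij: "bij_betw pos {z'. par z' = z} {..<K}"
    and cell0_sets: "\<kappa> 0 -` {z} \<in> sets M"
    and cell0_measure: "emeasure M (\<kappa> 0 -` {z}) = ennreal v"
    and v_pos: "0 < v"
begin

definition desc :: "nat \<Rightarrow> 'c \<Rightarrow> 'c set" where
  "desc i z = {w. (par ^^ i) w = z}"

text \<open>Reflecting the positions within the parent cell makes \<open>sib m\<close> an involution, so that the
  pairs \<open>{z, sib m z}\<close> partition the children of every cell.\<close>

definition sib :: "nat \<Rightarrow> 'c \<Rightarrow> 'c" where
  "sib m z = inv_into {z'. par z' = par z} pos ((m + (K - pos z)) mod K)"

lemma label_funpow: "\<kappa> i x = (par ^^ i) (\<kappa> 0 x)"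
  by (induction i) (auto simp: label_Suc)

lemma pos_less: "pos z < K"
  using bij_betwE[OF pos_bij[of "par z"]] by auto

lemma pos_inj: "par z = par z' \<Longrightarrow> pos z = pos z' \<Longrightarrow> z = z'"
  using bij_betw_imp_inj_on[OF pos_bij[of "par z'"]] by (auto simp: inj_on_def)

lemma K_pos: "0 < K"
  using pos_less[of undefined] by simp

lemma sib: "par (sib m z) = par z" "pos (sib m z) = (m + (K - pos z)) mod K"
proof -
  have "(m + (K - pos z)) mod K \<in> pos ` {z'. par z' = par z}"
    using bij_betw_imp_surj_on[OF pos_bij[of "par z"]] K_pos by simp
  from inv_into_into[OF this] f_inv_into_f[OF this]
  show "par (sib m z) = par z" "pos (sib m z) = (m + (K - pos z)) mod K"
    by (auto simp: sib_def)
qed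

lemma reflect_mod:
  fixes a k m :: nat
  assumes "a < k" "m < k"
  shows "(m + (k - (m + (k - a)) mod k)) mod k = a" and "(a + (m + (k - a)) mod k) mod k = m"
proof -
  have r: "(m + (k - a)) mod k = (if a \<le> m then m - a else m + (k - a))"
    using assms by (auto simp: mod_if)
  show "(m + (k - (m + (k - a)) mod k)) mod k = a"
    using assms unfolding r by (auto simp: mod_if)
  show "(a + (m + (k - a)) mod k) mod k = m"
    using assms unfolding r by (auto simp: mod_if)
qed

lemma sib_sib:
  assumes "m < K"
  shows "sib m (sib m z) = z"
  by (rule pos_inj) (simp_all only: sib reflect_mod(1)[OF pos_less assms])

lemma sib_cancel:
  assumes "m < K" "m' < K" "sib m z = sib m' z"
  shows "m = m'"
  using reflect_mod(2)[OF pos_less[of z] assms(1)] reflect_mod(2)[OF pos_less[of z] assms(2)]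
    sib(2)[of m z] sib(2)[of m' z] assms(3) by simp

lemma sib_surj:
  assumes "par z' = par z"
  shows "\<exists>m<K. sib m z = z'"
proof (intro exI conjI)
  let ?m = "(pos z' + pos z) mod K"
  show "?m < K" using K_pos by simp
  show "sib ?m z = z'"
  proof (rule pos_inj)
    have "pos (sib ?m z) = (pos z' + pos z + (K - pos z)) mod K"
      by (simp add: sib mod_add_left_eq)
    also have "\<dots> = pos z'"
      using pos_less[of z'] pos_less[of z] by simp
    finally show "pos (sib ?m z) = pos z'" .
  qed (simp add: sib assms)
qed

lemma desc_Suc: "desc (Suc i) z = (\<Union>z'\<in>{z'. par z' = z}. desc i z')"
  by (auto simp: desc_def)

lemma children: "finite {z'. par z' = z}" "card {z'. par z' = z} = K"
  using bij_betw_finite[OF pos_bij] bij_betw_same_card[OF pos_bij] by auto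

lemma finite_desc: "finite (desc i z)"
proof (induction i arbitrary: z)
  case 0
  have "desc 0 z = {z}" by (auto simp: desc_def)
  then show ?case by simp
qed (auto simp: desc_Suc children)

lemma card_desc: "card (desc i z) = K ^ i"
proof (induction i arbitrary: z)
  case 0
  have "desc 0 z = {z}" by (auto simp: desc_def)
  then show ?case by simp
next
  case (Suc i)
  have "card (desc (Suc i) z) = (\<Sum>z' | par z' = z. card (desc i z'))"
    unfolding desc_Suc by (rule card_UN_disjoint) (auto simp: children finite_desc, auto simp: desc_def)
  then show ?case by (simp add: Suc children)
qed

lemma cell_desc: "\<kappa> i -` {z} = (\<Union>w\<in>desc i z. \<kappa> 0 -` {w})"
  by (auto simp: desc_def label_funpow[of i])

lemma cell_sets: "\<kappa> i -` {z} \<in> sets M"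
  unfolding cell_desc[of i z] by (intro sets.finite_UN finite_desc cell0_sets)

lemma cell_emeasure: "emeasure M (\<kappa> i -` {z}) = ennreal (v * real K ^ i)"
proof -
  have "emeasure M (\<kappa> i -` {z}) = (\<Sum>w\<in>desc i z. emeasure M (\<kappa> 0 -` {w}))"
    unfolding cell_desc[of i z]
    by (rule sum_emeasure[symmetric]) (auto simp: disjoint_family_on_def finite_desc cell0_sets)
  also have "\<dots> = ennreal (v * real K ^ i)"
    using v_pos by (simp add: cell0_measure card_desc ennreal_mult'' mult.commute ennreal_of_nat_eq_real_of_nat)
  finally show ?thesis .
qed

lemma cell_measure: "measure M (\<kappa> i -` {z}) = v * real K ^ i"
  using v_pos by (simp add: measure_def cell_emeasure)

lemma indicator_cell_desc:
  "(indicator (\<kappa> i -` {z}) x :: real) = (\<Sum>w\<in>desc i z. indicator (\<kappa> 0 -` {w}) x)"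
  unfolding cell_desc[of i z]
  by (rule indicator_UN_disjoint) (auto simp: disjoint_family_on_def finite_desc)

lemma indicator_parent_cell:
  "(indicator (\<kappa> (Suc i) -` {par z}) x :: real) = (\<Sum>m<K. indicator (\<kappa> i -` {sib m z}) x)"
proof -
  have "\<kappa> (Suc i) -` {par z} = (\<Union>m\<in>{..<K}. \<kappa> i -` {sib m z})"
  proof (intro set_eqI iffI)
    fix x assume "x \<in> \<kappa> (Suc i) -` {par z}"
    then have "par (\<kappa> i x) = par z" by (simp add: label_Suc)
    then obtain m where "m < K" "sib m z = \<kappa> i x" using sib_surj by blast
    then show "x \<in> (\<Union>m\<in>{..<K}. \<kappa> i -` {sib m z})" by (intro UN_I[of m]) simp_all
  next
    fix x assume "x \<in> (\<Union>m\<in>{..<K}. \<kappa> i -` {sib m z})"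
    then show "x \<in> \<kappa> (Suc i) -` {par z}" by (auto simp: label_Suc sib)
  qed
  moreover have "disjoint_family_on (\<lambda>m. \<kappa> i -` {sib m z}) {..<K}"
    unfolding disjoint_family_on_def
  proof (intro ballI impI)
    fix m n assume "m \<in> {..<K}" "n \<in> {..<K}" "m \<noteq> n"
    then have "sib m z \<noteq> sib n z" using sib_cancel[of m n z] by auto
    then show "\<kappa> i -` {sib m z} \<inter> \<kappa> i -` {sib n z} = {}" by auto
  qed
  ultimately show ?thesis by (simp only: indicator_UN_disjoint finite_lessThan)
qed

definition cell_average :: "nat \<Rightarrow> 'c \<Rightarrow> ('e \<Rightarrow> 'a::real_normed_vector) \<Rightarrow> 'a" where
  "cell_average i z f = integral_over M (\<kappa> i -` {z}) f /\<^sub>R (v * real K ^ i)"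

end

text \<open>For one reflection, averages over \<open>z\<close> placed on \<open>sib m z\<close> are restrictions of conditional
  expectations with atoms \<open>{z, sib m z}\<close>, up to a factor of at most 2. The atoms of all
  generations are nested, because a pair lies inside one cell of the next generation, so Stein's
  inequality applies after averaging over the finest cells.\<close>

lemma reflected_average_bound:
  fixes M :: "'e measure"
  assumes umd: "umd TYPE('x::banach)" and p: "1 < p"
  shows "\<exists>C\<ge>0. \<forall>\<kappa> (par :: 'c \<Rightarrow> 'c) pos K v (J :: 'j set) lev z (f :: 'j \<Rightarrow> 'e \<Rightarrow> 'x) m.
    homogeneous_grid M \<kappa> par pos K v \<longrightarrow> finite J \<longrightarrow> m < K \<longrightarrow>
    (\<forall>j\<in>J. f j \<in> Lp_space p M) \<longrightarrow> (\<forall>j\<in>J. \<forall>x. \<kappa> (lev j) x \<noteq> z j \<longrightarrow> f j x = 0) \<longrightarrow>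
    radp p M J (\<lambda>j x. indicator (\<kappa> (lev j) -` {homogeneous_grid.sib par pos K m (z j)}) x *\<^sub>R
        homogeneous_grid.cell_average M \<kappa> K v (lev j) (z j) (f j))
    \<le> C * radp p M J f"
proof -
  have p1: "1 \<le> p" using p by simp
  obtain b where b: "0 \<le> b" and stein: "\<And>(\<Omega> :: 'c set) (J :: 'j set) (\<pi> :: nat \<Rightarrow> 'c \<Rightarrow> 'c set) (g :: 'j \<Rightarrow> 'c \<Rightarrow> 'x) l n.
    finite \<Omega> \<Longrightarrow> finite J \<Longrightarrow>
    (\<forall>s \<omega> \<omega>'. \<pi> (Suc s) \<omega> = \<pi> (Suc s) \<omega>' \<longrightarrow> \<pi> s \<omega> = \<pi> s \<omega>') \<Longrightarrow>
    (\<forall>j\<in>J. l j \<in> {1..n}) \<Longrightarrow>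
    sign_mean J (\<lambda>\<epsilon>. \<Sum>\<omega>\<in>\<Omega>. norm (\<Sum>j\<in>J. \<epsilon> j *\<^sub>R atom_mean \<Omega> (\<pi> (l j)) (g j) \<omega>) powr p)
    \<le> b * sign_mean J (\<lambda>\<epsilon>. \<Sum>\<omega>\<in>\<Omega>. norm (\<Sum>j\<in>J. \<epsilon> j *\<^sub>R g j \<omega>) powr p)"
    using stein_finite[OF umd p, where 'o = 'c and 'j = 'j and 'l = "'c set"] by blast
  show ?thesis
  proof (intro exI[of _ "2 powr p * b"] conjI allI impI)
    show "0 \<le> 2 powr p * b" using b by simp
  next
    fix \<kappa> and par :: "'c \<Rightarrow> 'c" and pos K v and J :: "'j set" and lev z
      and f :: "'j \<Rightarrow> 'e \<Rightarrow> 'x" and m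
    assume grid: "homogeneous_grid M \<kappa> par pos K v" and J: "finite J" and m: "m < K"
      and f: "\<forall>j\<in>J. f j \<in> Lp_space p M" and supp: "\<forall>j\<in>J. \<forall>x. \<kappa> (lev j) x \<noteq> z j \<longrightarrow> f j x = 0"
    interpret homogeneous_grid M \<kappa> par pos K v by (rule grid)
    let ?cell = "\<lambda>w. \<kappa> 0 -` {w}"
    have fin: "emeasure M (\<kappa> i -` {w}) < \<infinity>" for i w by (simp add: cell_emeasure)
    define \<Omega> where "\<Omega> = (\<Union>j\<in>J. desc (lev j) (z j) \<union> desc (lev j) (sib m (z j)))"
    have \<Omega>: "finite \<Omega>" unfolding \<Omega>_def using J finite_desc by auto
    define L where "L = Suc (Max (insert 0 (lev ` J)))"
    have L: "lev j < L" if "j \<in> J" for j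
      using J that by (simp add: L_def less_Suc_eq_le)
    \<comment> \<open>Generations count from fine to coarse, the levels of a filtration from coarse to fine. So
      level \<open>s\<close> is generation \<open>L - s\<close>. Points are the labels of the finest cells.\<close>
    define \<pi> where "\<pi> s \<omega> = {(par ^^ (L - s)) \<omega>, sib m ((par ^^ (L - s)) \<omega>)}" for s \<omega>
    define l where "l j = L - lev j" for j
    define g where "g j \<omega> = integral_over M (?cell \<omega>) (f j) /\<^sub>R v" for j \<omega>
    define E where "E j = desc (lev j) (z j) \<union> desc (lev j) (sib m (z j))" for j
    \<comment> \<open>Between 1 and 2: the atom \<open>E j\<close> has twice as many finest cells as \<open>z j\<close>, unless \<open>z j\<close> is its
      own reflection.\<close>
    define c where "c j = card (E j) / K ^ lev j" for j
    have E: "finite (E j)" "E j \<subseteq> \<Omega>" if "j \<in> J" for j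
      using that finite_desc by (auto simp: E_def \<Omega>_def)
    have ref: "\<pi> s \<omega> = \<pi> s \<omega>'" if eq: "\<pi> (Suc s) \<omega> = \<pi> (Suc s) \<omega>'" for s \<omega> \<omega>'
    proof (cases "s < L")
      case True
      then have Ls: "L - s = Suc (L - Suc s)" by simp
      have "(par ^^ (L - Suc s)) \<omega> = (par ^^ (L - Suc s)) \<omega>' \<or> (par ^^ (L - Suc s)) \<omega> = sib m ((par ^^ (L - Suc s)) \<omega>')"
        using eq unfolding \<pi>_def by blast
      then have "par ((par ^^ (L - Suc s)) \<omega>) = par ((par ^^ (L - Suc s)) \<omega>')"
        using sib(1) by auto
      then show ?thesis unfolding \<pi>_def Ls by simp
    qed (use eq in \<open>simp add: \<pi>_def\<close>)
    have atom: "{\<omega>'\<in>\<Omega>. \<pi> (l j) \<omega>' = \<pi> (l j) \<omega>} = E j"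
      if j: "j \<in> J" and \<omega>: "\<omega> \<in> E j" for j \<omega>
    proof -
      have Ll: "L - l j = lev j" using L[OF j] by (simp add: l_def)
      have \<pi>E: "\<pi> (l j) \<omega> = {z j, sib m (z j)} \<longleftrightarrow> \<omega> \<in> E j" for \<omega>
        unfolding \<pi>_def Ll E_def desc_def using sib_sib[OF m] by (auto simp: doubleton_eq_iff)
      have eq: "\<pi> (l j) \<omega> = {z j, sib m (z j)}" using \<omega> by (simp only: \<pi>E)
      have "{\<omega>'\<in>\<Omega>. \<pi> (l j) \<omega>' = \<pi> (l j) \<omega>} = {\<omega>'\<in>\<Omega>. \<omega>' \<in> E j}" unfolding eq \<pi>E ..
      then show ?thesis using E(2)[OF j] by auto
    qed
    have c: "0 \<le> c j" "c j \<le> 2" for j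
    proof -
      have "card (E j) \<le> 2 * K ^ lev j"
        unfolding E_def mult_2
        by (rule order_trans[OF card_Un_le]) (simp add: card_desc)
      then have "real (card (E j)) \<le> real (2 * K ^ lev j)" by (simp only: of_nat_le_iff)
      then show "c j \<le> 2" using K_pos by (simp add: c_def pos_divide_le_eq)
    qed (simp add: c_def)
    have hasint: "has_integral_in M (\<lambda>x. indicator (\<kappa> i -` {w}) x *\<^sub>R f j x) (integral_over M (\<kappa> i -` {w}) (f j))"
      if "j \<in> J" for i w j
      using that f by (intro Lp_space_integral_exists[OF p1] cell_sets fin) auto
    have int_split: "integral_over M (\<kappa> i -` {w}) (f j) = (\<Sum>\<omega>\<in>desc i w. integral_over M (?cell \<omega>) (f j))"
      if j: "j \<in> J" for i w j
    proof (rule integral_over_eq)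
      have "has_integral_in M (\<lambda>x. \<Sum>\<omega>\<in>desc i w. indicator (?cell \<omega>) x *\<^sub>R f j x)
          (\<Sum>\<omega>\<in>desc i w. integral_over M (?cell \<omega>) (f j))"
        by (intro has_integral_in_sum hasint j)
      then show "has_integral_in M (\<lambda>x. indicator (\<kappa> i -` {w}) x *\<^sub>R f j x)
          (\<Sum>\<omega>\<in>desc i w. integral_over M (?cell \<omega>) (f j))"
        by (simp only: indicator_cell_desc[of i w] scaleR_sum_left)
    qed
    have g0: "g j \<omega> = 0" if j: "j \<in> J" and \<omega>: "\<omega> \<notin> desc (lev j) (z j)" for j \<omega>
    proof -
      have "indicator (?cell \<omega>) x *\<^sub>R f j x = 0" for x
      proof (cases "\<kappa> 0 x = \<omega>")
        case True
        then have "\<kappa> (lev j) x \<noteq> z j" using \<omega> by (simp add: label_funpow[of "lev j"] desc_def)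
        then show ?thesis using supp j by simp
      qed simp
      then have "integral_over M (?cell \<omega>) (f j) = 0"
        by (intro integral_over_eq) (simp only: has_integral_in_zero)
      then show ?thesis by (simp add: g_def)
    qed
    have avg: "cell_average (lev j) (z j) (f j) = c j *\<^sub>R atom_mean \<Omega> (\<pi> (l j)) (g j) \<omega>"
      if j: "j \<in> J" and \<omega>: "\<omega> \<in> E j" for j \<omega>
    proof -
      have "E j \<noteq> {}" using \<omega> by auto
      then have cE: "real (card (E j)) > 0" using E(1)[OF j] by (simp add: card_gt_0_iff)
      have "(\<Sum>\<omega>\<in>E j. g j \<omega>) = (\<Sum>\<omega>\<in>desc (lev j) (z j). g j \<omega>)"
      proof (rule sum.mono_neutral_right[OF E(1)[OF j]])
        show "\<forall>\<omega>\<in>E j - desc (lev j) (z j). g j \<omega> = 0" using g0[OF j] by blast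
      qed (simp add: E_def)
      also have "\<dots> = integral_over M (\<kappa> (lev j) -` {z j}) (f j) /\<^sub>R v"
        unfolding int_split[OF j, of "lev j" "z j"] g_def by (rule scaleR_sum_right[symmetric])
      finally have am: "atom_mean \<Omega> (\<pi> (l j)) (g j) \<omega> = (integral_over M (\<kappa> (lev j) -` {z j}) (f j) /\<^sub>R v) /\<^sub>R card (E j)"
        unfolding atom_mean_def atom[OF j \<omega>] by (simp only:)
      have "c j * (inverse (real (card (E j))) * inverse v) = inverse (v * real K ^ lev j)"
        using cE v_pos K_pos by (simp add: c_def field_simps)
      then show ?thesis
        unfolding am cell_average_def scaleR_scaleR by (simp only: mult.assoc)
    qed
    define B where "B j \<omega> = c j * indicator (desc (lev j) (sib m (z j))) \<omega>" for j \<omega>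
    have B: "\<bar>B j \<omega>\<bar> \<le> 2" for j \<omega>
      using c[of j] by (simp add: B_def indicator_def)
    let ?F = "\<lambda>j x. indicator (\<kappa> (lev j) -` {sib m (z j)}) x *\<^sub>R cell_average (lev j) (z j) (f j)"
    let ?G = "\<lambda>\<epsilon> \<omega>. \<Sum>j\<in>J. \<epsilon> j *\<^sub>R B j \<omega> *\<^sub>R atom_mean \<Omega> (\<pi> (l j)) (g j) \<omega>"
    have F: "?F j x = B j (\<kappa> 0 x) *\<^sub>R atom_mean \<Omega> (\<pi> (l j)) (g j) (\<kappa> 0 x)" if j: "j \<in> J" for j x
    proof (cases "\<kappa> 0 x \<in> desc (lev j) (sib m (z j))")
      case True
      then have "\<kappa> (lev j) x = sib m (z j)" "\<kappa> 0 x \<in> E j"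
        by (auto simp: label_funpow[of "lev j"] desc_def E_def)
      then show ?thesis using avg[OF j, of "\<kappa> 0 x"] True by (simp add: B_def)
    next
      case False
      then have "\<kappa> (lev j) x \<noteq> sib m (z j)"
        by (auto simp: label_funpow[of "lev j"] desc_def)
      then show ?thesis using False by (simp add: B_def)
    qed
    have integ: "(\<integral>x. norm (\<Sum>j\<in>J. \<epsilon> j *\<^sub>R ?F j x) powr p \<partial>M) = (\<Sum>\<omega>\<in>\<Omega>. v * norm (?G \<epsilon> \<omega>) powr p)" for \<epsilon>
    proof -
      have "norm (\<Sum>j\<in>J. \<epsilon> j *\<^sub>R ?F j x) powr p = (\<Sum>\<omega>\<in>\<Omega>. indicator (?cell \<omega>) x * norm (?G \<epsilon> \<omega>) powr p)" for x
      proof -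
        have "(\<Sum>j\<in>J. \<epsilon> j *\<^sub>R ?F j x) = ?G \<epsilon> (\<kappa> 0 x)"
          by (intro sum.cong refl) (simp only: F)
        moreover have "(\<Sum>\<omega>\<in>\<Omega>. indicator (?cell \<omega>) x * norm (?G \<epsilon> \<omega>) powr p)
            = (if \<kappa> 0 x \<in> \<Omega> then norm (?G \<epsilon> (\<kappa> 0 x)) powr p else 0)"
        proof -
          have "(\<Sum>\<omega>\<in>\<Omega>. indicator (?cell \<omega>) x * norm (?G \<epsilon> \<omega>) powr p)
            = (\<Sum>\<omega>\<in>\<Omega>. if \<omega> = \<kappa> 0 x then norm (?G \<epsilon> \<omega>) powr p else 0)"
            by (intro sum.cong refl) (auto simp: indicator_def)
          then show ?thesis using \<Omega> by simp
        qed
        moreover have "?G \<epsilon> (\<kappa> 0 x) = 0" if "\<kappa> 0 x \<notin> \<Omega>"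
          by (rule sum.neutral) (use that in \<open>auto simp: B_def \<Omega>_def\<close>)
        ultimately show ?thesis by simp
      qed
      then have "(\<integral>x. norm (\<Sum>j\<in>J. \<epsilon> j *\<^sub>R ?F j x) powr p \<partial>M)
          = (\<integral>x. (\<Sum>\<omega>\<in>\<Omega>. indicator (?cell \<omega>) x * norm (?G \<epsilon> \<omega>) powr p) \<partial>M)"
        by (simp only:)
      also have "\<dots> = (\<Sum>\<omega>\<in>\<Omega>. (\<integral>x. indicator (?cell \<omega>) x * norm (?G \<epsilon> \<omega>) powr p \<partial>M))"
        by (intro Bochner_Integration.integral_sum integrable_mult_left integrable_real_indicator cell0_sets)
           (simp add: cell0_measure)
      also have "\<dots> = (\<Sum>\<omega>\<in>\<Omega>. v * norm (?G \<epsilon> \<omega>) powr p)"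
      proof (intro sum.cong refl)
        fix \<omega>
        have "(\<integral>x. indicator (?cell \<omega>) x * norm (?G \<epsilon> \<omega>) powr p \<partial>M) = measure M (?cell \<omega>) * norm (?G \<epsilon> \<omega>) powr p"
          using cell0_sets[of \<omega>] by (simp add: space_UNIV)
        then show "(\<integral>x. indicator (?cell \<omega>) x * norm (?G \<epsilon> \<omega>) powr p \<partial>M) = v * norm (?G \<epsilon> \<omega>) powr p"
          using cell_measure[of 0] by simp
      qed
      finally show ?thesis .
    qed
    have jens: "(\<Sum>\<omega>\<in>\<Omega>. v * norm (\<Sum>j\<in>J. \<epsilon> j *\<^sub>R g j \<omega>) powr p) \<le> (\<integral>x. norm (\<Sum>j\<in>J. \<epsilon> j *\<^sub>R f j x) powr p \<partial>M)" for \<epsilon>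
    proof -
      let ?f = "\<lambda>x. \<Sum>j\<in>J. \<epsilon> j *\<^sub>R f j x"
      have fLp: "?f \<in> Lp_space p M" using f by (intro Lp_space_lincomb p1) auto
      have fint: "integrable M (\<lambda>x. norm (?f x) powr p)" using fLp by (simp add: Lp_space_iff)
      have cint: "integrable M (\<lambda>x. indicator (?cell \<omega>) x * norm (?f x) powr p)" for \<omega>
        using integrable_mult_indicator[OF cell0_sets fint, of \<omega>] by simp
      have "(\<Sum>\<omega>\<in>\<Omega>. v * norm (\<Sum>j\<in>J. \<epsilon> j *\<^sub>R g j \<omega>) powr p) \<le> (\<Sum>\<omega>\<in>\<Omega>. \<integral>x. indicator (?cell \<omega>) x * norm (?f x) powr p \<partial>M)"
      proof (rule sum_mono)
        fix \<omega>
        have "has_integral_in M (\<lambda>x. \<Sum>j\<in>J. \<epsilon> j *\<^sub>R indicator (?cell \<omega>) x *\<^sub>R f j x)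
            (\<Sum>j\<in>J. \<epsilon> j *\<^sub>R integral_over M (?cell \<omega>) (f j))"
          by (intro has_integral_in_sum has_integral_in_scaleR hasint)
        then have "has_integral_in M (\<lambda>x. indicator (?cell \<omega>) x *\<^sub>R ?f x)
            (\<Sum>j\<in>J. \<epsilon> j *\<^sub>R integral_over M (?cell \<omega>) (f j))"
          by (simp add: scaleR_sum_right mult.commute)
        from has_integral_in_jensen[OF p1 fLp cell0_sets _ _ v_pos this]
        have "v * norm ((\<Sum>j\<in>J. \<epsilon> j *\<^sub>R integral_over M (?cell \<omega>) (f j)) /\<^sub>R v) powr p
            \<le> (\<integral>x. indicator (?cell \<omega>) x * norm (?f x) powr p \<partial>M)"
          using cell_measure[of 0 \<omega>] by (simp add: cell0_measure)
        also have "(\<Sum>j\<in>J. \<epsilon> j *\<^sub>R integral_over M (?cell \<omega>) (f j)) /\<^sub>R v = (\<Sum>j\<in>J. \<epsilon> j *\<^sub>R g j \<omega>)"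
          by (simp add: g_def scaleR_sum_right mult.commute)
        finally show "v * norm (\<Sum>j\<in>J. \<epsilon> j *\<^sub>R g j \<omega>) powr p
            \<le> (\<integral>x. indicator (?cell \<omega>) x * norm (?f x) powr p \<partial>M)" .
      qed
      also have "\<dots> = (\<integral>x. (\<Sum>\<omega>\<in>\<Omega>. indicator (?cell \<omega>) x * norm (?f x) powr p) \<partial>M)"
        by (rule Bochner_Integration.integral_sum[symmetric]) (rule cint)
      also have "\<dots> \<le> (\<integral>x. norm (?f x) powr p \<partial>M)"
      proof (rule integral_mono)
        fix x
        have "(\<Sum>\<omega>\<in>\<Omega>. indicator (?cell \<omega>) x * norm (?f x) powr p)
            = (\<Sum>\<omega>\<in>\<Omega>. if \<omega> = \<kappa> 0 x then norm (?f x) powr p else 0)"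
          by (intro sum.cong refl) (auto simp: indicator_def)
        also have "\<dots> \<le> norm (?f x) powr p"
          using \<Omega> by simp
        finally show "(\<Sum>\<omega>\<in>\<Omega>. indicator (?cell \<omega>) x * norm (?f x) powr p) \<le> norm (?f x) powr p" .
      qed (use cint fint in auto)
      finally show ?thesis .
    qed
    have "radp p M J ?F = sign_mean J (\<lambda>\<epsilon>. \<Sum>\<omega>\<in>\<Omega>. v * norm (?G \<epsilon> \<omega>) powr p)"
      unfolding radp_def integ ..
    also have "\<dots> = v * (\<Sum>\<omega>\<in>\<Omega>. sign_mean J (\<lambda>\<epsilon>. norm (?G \<epsilon> \<omega>) powr p))"
      unfolding sign_mean_sum sign_mean_cmult sum_distrib_left ..
    also have "\<dots> \<le> v * (\<Sum>\<omega>\<in>\<Omega>. 2 powr p * sign_mean J (\<lambda>\<epsilon>. norm (\<Sum>j\<in>J. \<epsilon> j *\<^sub>R atom_mean \<Omega> (\<pi> (l j)) (g j) \<omega>) powr p))"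
      using v_pos B by (intro mult_left_mono sum_mono sign_contraction_scaled[OF p1 J]) auto
    also have "\<dots> = v * 2 powr p * sign_mean J (\<lambda>\<epsilon>. \<Sum>\<omega>\<in>\<Omega>. norm (\<Sum>j\<in>J. \<epsilon> j *\<^sub>R atom_mean \<Omega> (\<pi> (l j)) (g j) \<omega>) powr p)"
      unfolding sign_mean_sum sum_distrib_left[symmetric] by simp
    also have "\<dots> \<le> v * 2 powr p * (b * sign_mean J (\<lambda>\<epsilon>. \<Sum>\<omega>\<in>\<Omega>. norm (\<Sum>j\<in>J. \<epsilon> j *\<^sub>R g j \<omega>) powr p))"
    proof (rule mult_left_mono)
      have l: "\<forall>j\<in>J. l j \<in> {1..L}" using L by (auto simp: l_def Suc_le_eq)
      have "\<forall>s \<omega> \<omega>'. \<pi> (Suc s) \<omega> = \<pi> (Suc s) \<omega>' \<longrightarrow> \<pi> s \<omega> = \<pi> s \<omega>'"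
        by (intro allI impI) (rule ref)
      from stein[OF \<Omega> J this l]
      show "sign_mean J (\<lambda>\<epsilon>. \<Sum>\<omega>\<in>\<Omega>. norm (\<Sum>j\<in>J. \<epsilon> j *\<^sub>R atom_mean \<Omega> (\<pi> (l j)) (g j) \<omega>) powr p)
        \<le> b * sign_mean J (\<lambda>\<epsilon>. \<Sum>\<omega>\<in>\<Omega>. norm (\<Sum>j\<in>J. \<epsilon> j *\<^sub>R g j \<omega>) powr p)" .
    qed (use v_pos in simp)
    also have "\<dots> = 2 powr p * b * sign_mean J (\<lambda>\<epsilon>. \<Sum>\<omega>\<in>\<Omega>. v * norm (\<Sum>j\<in>J. \<epsilon> j *\<^sub>R g j \<omega>) powr p)"
      unfolding sum_distrib_left[symmetric] sign_mean_cmult by simp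
    also have "\<dots> \<le> 2 powr p * b * radp p M J f"
      unfolding radp_def using b by (intro mult_left_mono sign_mean_mono jens) auto
    finally show "radp p M J ?F \<le> 2 powr p * b * radp p M J f" .
  qed
qed

text \<open>Summing over the \<open>K\<close> reflections costs only \<open>K powr (1 / \<tau>)\<close> because their images are
  disjoint.\<close>

lemma parent_average_bound:
  fixes M :: "'e measure"
  assumes umd: "umd TYPE('x::banach)" and p: "1 < p"
    and type: "has_type (Lp_space p M :: ('e \<Rightarrow> 'x) set) (Lp_norm p M) \<tau>"
  shows "\<exists>C\<ge>0. \<forall>\<kappa> (par :: 'c \<Rightarrow> 'c) pos K v (J :: 'j set) lev z (f :: 'j \<Rightarrow> 'e \<Rightarrow> 'x).
    homogeneous_grid M \<kappa> par pos K v \<longrightarrow> finite J \<longrightarrow>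
    (\<forall>j\<in>J. f j \<in> Lp_space p M) \<longrightarrow> (\<forall>j\<in>J. \<forall>x. \<kappa> (lev j) x \<noteq> z j \<longrightarrow> f j x = 0) \<longrightarrow>
    rad2 p M J (\<lambda>j x. indicator (\<kappa> (Suc (lev j)) -` {par (z j)}) x *\<^sub>R
        homogeneous_grid.cell_average M \<kappa> K v (lev j) (z j) (f j))
    \<le> C * real K powr (1 / \<tau>) * rad2 p M J f"
proof -
  have p1: "1 \<le> p" using p by simp
  obtain b where b: "0 \<le> b" and refl_bound:
    "\<And>\<kappa> (par :: 'c \<Rightarrow> 'c) pos K v (J :: 'j set) lev z (f :: 'j \<Rightarrow> 'e \<Rightarrow> 'x) m.
    homogeneous_grid M \<kappa> par pos K v \<Longrightarrow> finite J \<Longrightarrow> m < K \<Longrightarrow>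
    (\<forall>j\<in>J. f j \<in> Lp_space p M) \<Longrightarrow> (\<forall>j\<in>J. \<forall>x. \<kappa> (lev j) x \<noteq> z j \<longrightarrow> f j x = 0) \<Longrightarrow>
    radp p M J (\<lambda>j x. indicator (\<kappa> (lev j) -` {homogeneous_grid.sib par pos K m (z j)}) x *\<^sub>R
        homogeneous_grid.cell_average M \<kappa> K v (lev j) (z j) (f j))
    \<le> b * radp p M J f"
    using reflected_average_bound[OF umd p, of M, where 'c = 'c and 'j = 'j] by blast
  obtain A where A: "A \<ge> 1" and kah: "\<And>(M :: 'e measure) (J :: 'j set) (\<xi> :: 'j \<Rightarrow> 'e \<Rightarrow> 'x).
    finite J \<Longrightarrow> (\<forall>j\<in>J. \<xi> j \<in> Lp_space p M) \<Longrightarrow>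
    radp p M J \<xi> powr (1 / p) \<le> A * rad2 p M J \<xi> \<and> rad2 p M J \<xi> \<le> A * radp p M J \<xi> powr (1 / p)"
    using kahane_Lp[OF p1] by blast
  obtain T where T: "0 \<le> T" and disj: "\<And>(J :: 'j set) (K :: nat) (F :: nat \<Rightarrow> 'j \<Rightarrow> 'e \<Rightarrow> 'x) R.
    finite J \<Longrightarrow> 1 \<le> K \<Longrightarrow> (\<forall>m<K. \<forall>j\<in>J. F m j \<in> Lp_space p M) \<Longrightarrow>
    (\<forall>j\<in>J. \<forall>x. \<forall>m<K. \<forall>m'<K. F m j x \<noteq> 0 \<longrightarrow> F m' j x \<noteq> 0 \<longrightarrow> m = m') \<Longrightarrow>
    (\<forall>m<K. rad2 p M J (F m) \<le> R) \<Longrightarrow>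
    rad2 p M J (\<lambda>j x. \<Sum>m<K. F m j x) \<le> T * real K powr (1 / \<tau>) * R"
    using rad2_disjoint_sum_type[OF p type, where 'j = 'j] by blast
  define B where "B = A * b powr (1 / p) * A"
  have B: "0 \<le> B" using A by (simp add: B_def)
  show ?thesis
  proof (intro exI[of _ "T * B"] conjI allI impI)
    show "0 \<le> T * B" using T B by simp
  next
    fix \<kappa> and par :: "'c \<Rightarrow> 'c" and pos K v and J :: "'j set" and lev z and f :: "'j \<Rightarrow> 'e \<Rightarrow> 'x"
    assume grid: "homogeneous_grid M \<kappa> par pos K v" and J: "finite J"
      and f: "\<forall>j\<in>J. f j \<in> Lp_space p M" and supp: "\<forall>j\<in>J. \<forall>x. \<kappa> (lev j) x \<noteq> z j \<longrightarrow> f j x = 0"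
    interpret homogeneous_grid M \<kappa> par pos K v by (rule grid)
    define F where "F m j x = indicator (\<kappa> (lev j) -` {sib m (z j)}) x *\<^sub>R cell_average (lev j) (z j) (f j)" for m j x
    have FLp: "F m j \<in> Lp_space p M" for m j
      unfolding F_def using p by (intro Lp_space_indicator cell_sets) (auto simp: cell_emeasure)
    have R: "rad2 p M J (F m) \<le> B * rad2 p M J f" if m: "m < K" for m
    proof -
      have "rad2 p M J (F m) \<le> A * radp p M J (F m) powr (1 / p)"
        using kah[OF J, of "F m" M] FLp by simp
      also have "\<dots> \<le> A * (b * radp p M J f) powr (1 / p)"
        using A p refl_bound[OF grid J m f supp] unfolding F_def
        by (intro mult_left_mono powr_mono2) auto
      also have "\<dots> = A * b powr (1 / p) * radp p M J f powr (1 / p)"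
        using b by (simp add: powr_mult)
      also have "\<dots> \<le> A * b powr (1 / p) * (A * rad2 p M J f)"
        using A kah[OF J f] by (intro mult_left_mono) auto
      finally show ?thesis by (simp add: B_def mult_ac)
    qed
    have "rad2 p M J (\<lambda>j x. indicator (\<kappa> (Suc (lev j)) -` {par (z j)}) x *\<^sub>R cell_average (lev j) (z j) (f j))
        = rad2 p M J (\<lambda>j x. \<Sum>m<K. F m j x)"
      unfolding F_def indicator_parent_cell scaleR_sum_left ..
    also have "\<dots> \<le> T * real K powr (1 / \<tau>) * (B * rad2 p M J f)"
    proof (rule disj[OF J])
      show "1 \<le> K" using K_pos by simp
      show "\<forall>j\<in>J. \<forall>x. \<forall>m<K. \<forall>m'<K. F m j x \<noteq> 0 \<longrightarrow> F m' j x \<noteq> 0 \<longrightarrow> m = m'"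
      proof (intro ballI allI impI)
        fix j x m m' assume "m < K" "m' < K" "F m j x \<noteq> 0" "F m' j x \<noteq> 0"
        then have "sib m (z j) = sib m' (z j)"
          by (auto simp: F_def indicator_def split: if_splits)
        then show "m = m'" using sib_cancel \<open>m < K\<close> \<open>m' < K\<close> by blast
      qed
    qed (use FLp R in auto)
    finally show "rad2 p M J (\<lambda>j x. indicator (\<kappa> (Suc (lev j)) -` {par (z j)}) x *\<^sub>R cell_average (lev j) (z j) (f j))
      \<le> T * B * real K powr (1 / \<tau>) * rad2 p M J f"
      by (simp add: mult_ac)
  qed
qed

section \<open>Shifted cubes\<close>

text \<open>Cubes of side \<open>s * b ^ i\<close>, shifted by half of their own side in the directions marked by \<open>\<theta>\<close>.
  For odd \<open>b\<close> the shifted cubes of successive generations are nested as well.\<close>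

definition cube_label :: "nat \<Rightarrow> ('n::finite \<Rightarrow> bool) \<Rightarrow> real \<Rightarrow> nat \<Rightarrow> real ^ 'n \<Rightarrow> 'n \<Rightarrow> int" where
  "cube_label b \<theta> s i x = (\<lambda>k. \<lfloor>x $ k / (s * real b ^ i) - (if \<theta> k then 1 / 2 else 0)\<rfloor>)"

definition cube_shift :: "nat \<Rightarrow> ('n \<Rightarrow> bool) \<Rightarrow> 'n \<Rightarrow> int" where
  "cube_shift b \<theta> k = (if \<theta> k then (int b - 1) div 2 else 0)"

definition cube_parent :: "nat \<Rightarrow> ('n \<Rightarrow> bool) \<Rightarrow> ('n \<Rightarrow> int) \<Rightarrow> 'n \<Rightarrow> int" where
  "cube_parent b \<theta> z = (\<lambda>k. (z k - cube_shift b \<theta> k) div int b)"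

lemma cube_label_Suc:
  fixes x :: "real ^ 'n"
  assumes b: "odd b" and s: "0 < s"
  shows "cube_label b \<theta> s (Suc i) x = cube_parent b \<theta> (cube_label b \<theta> s i x)"
proof
  fix k
  define y where "y = x $ k / (s * real b ^ i)"
  define o' :: real where "o' = (if \<theta> k then 1 / 2 else 0)"
  have b0: "0 < b" using b by (rule odd_pos)
  have sh: "real_of_int (cube_shift b \<theta> k) = o' * (real b - 1)"
  proof -
    obtain m where "b = 2 * m + 1" using b by (elim oddE)
    then show ?thesis by (simp add: cube_shift_def o'_def)
  qed
  have "x $ k / (s * real b ^ Suc i) - o' = (y - o' - real_of_int (cube_shift b \<theta> k)) / real_of_int (int b)"
    using b0 s unfolding sh y_def by (simp add: field_simps)
  then have "\<lfloor>x $ k / (s * real b ^ Suc i) - o'\<rfloor> = (\<lfloor>y - o'\<rfloor> - cube_shift b \<theta> k) div int b"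
    by (simp only: floor_divide_real_eq_div[OF of_nat_0_le_iff] floor_diff_of_int)
  then show "cube_label b \<theta> s (Suc i) x k = cube_parent b \<theta> (cube_label b \<theta> s i x) k"
    by (simp add: cube_label_def cube_parent_def y_def o'_def)
qed

lemma cube_label_vimage:
  fixes z :: "'n::finite \<Rightarrow> int"
  assumes s: "0 < s" and b: "0 < b"
  shows "cube_label b \<theta> s i -` {z} = {x. \<forall>k.
    s * real b ^ i * (real_of_int (z k) + (if \<theta> k then 1 / 2 else 0)) \<le> x $ k \<and>
    x $ k < s * real b ^ i * (real_of_int (z k) + (if \<theta> k then 1 / 2 else 0)) + s * real b ^ i}"
proof (intro set_eqI)
  fix x :: "real ^ 'n"
  define t where "t = s * real b ^ i"
  have t: "0 < t" using s b by (simp add: t_def)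
  have "(\<lfloor>x $ k / t - c\<rfloor> = z k) \<longleftrightarrow> (t * (real_of_int (z k) + c) \<le> x $ k \<and> x $ k < t * (real_of_int (z k) + c) + t)"
    for c and k
  proof -
    have "(\<lfloor>x $ k / t - c\<rfloor> = z k) \<longleftrightarrow> (real_of_int (z k) + c \<le> x $ k / t \<and> x $ k / t < real_of_int (z k) + c + 1)"
      unfolding floor_eq_iff by auto
    also have "\<dots> \<longleftrightarrow> (t * (real_of_int (z k) + c) \<le> x $ k \<and> x $ k < t * (real_of_int (z k) + c) + t)"
      using t by (simp add: pos_le_divide_eq pos_divide_less_eq algebra_simps)
    finally show ?thesis .
  qed
  then show "x \<in> cube_label b \<theta> s i -` {z} \<longleftrightarrow> x \<in> {x. \<forall>k.
    s * real b ^ i * (real_of_int (z k) + (if \<theta> k then 1 / 2 else 0)) \<le> x $ k \<and>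
    x $ k < s * real b ^ i * (real_of_int (z k) + (if \<theta> k then 1 / 2 else 0)) + s * real b ^ i}"
    by (simp add: cube_label_def t_def fun_eq_iff)
qed

lemma half_open_cube:
  fixes a :: "'n::finite \<Rightarrow> real"
  assumes t: "0 < t"
  shows "{x :: real ^ 'n. \<forall>k. a k \<le> x $ k \<and> x $ k < a k + t} \<in> sets lborel" (is "?S \<in> _")
    and "emeasure lborel {x :: real ^ 'n. \<forall>k. a k \<le> x $ k \<and> x $ k < a k + t} = ennreal (t ^ CARD('n))"
proof -
  have S: "?S = (\<Inter>k. {x. a k \<le> x $ k} \<inter> {x. x $ k < a k + t})" by auto
  have "{x :: real ^ 'n. a k \<le> x $ k} \<in> sets borel" "{x :: real ^ 'n. x $ k < a k + t} \<in> sets borel" for k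
    by (intro borel_closed borel_open closed_Collect_le open_Collect_less continuous_intros)+
  then show meas: "?S \<in> sets lborel" unfolding S by auto
  define l u where "l = (\<chi> k. a k)" and "u = (\<chi> k. a k + t)"
  have sub: "box l u \<subseteq> ?S" "?S \<subseteq> cbox l u"
    by (auto simp: l_def u_def mem_box_cart less_imp_le)
  have d: "(u - l) \<bullet> e = t" if "e \<in> Basis" for e
    using that by (auto simp: Basis_vec_def l_def u_def inner_axis)
  then have lu: "l \<bullet> e \<le> u \<bullet> e" if "e \<in> Basis" for e
    using t that by (metis diff_ge_0_iff_ge inner_diff_left less_imp_le)
  have prod: "(\<Prod>e\<in>Basis. (u - l) \<bullet> e) = t ^ CARD('n)"
    using d by simp
  have "emeasure lborel ?S \<le> emeasure lborel (cbox l u)" by (intro emeasure_mono sub) simp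
  moreover have "emeasure lborel (box l u) \<le> emeasure lborel ?S" by (intro emeasure_mono sub meas)
  ultimately show "emeasure lborel ?S = ennreal (t ^ CARD('n))"
    using lu prod by (simp add: antisym)
qed

lemma homogeneous_grid_cubes:
  fixes \<theta> :: "'n::finite \<Rightarrow> bool"
  assumes b: "odd b" and s: "0 < s"
  shows "\<exists>pos. homogeneous_grid (lborel :: (real ^ 'n) measure) (cube_label b \<theta> s) (cube_parent b \<theta>) pos
    (b ^ CARD('n)) (s ^ CARD('n))"
proof -
  have b0: "0 < b" using b by (rule odd_pos)
  let ?P = "(UNIV :: 'n set) \<rightarrow>\<^sub>E {0..<int b}"
  have "card ?P = b ^ CARD('n)" by (simp add: card_PiE)
  moreover have "finite ?P" by (intro finite_PiE) auto
  ultimately obtain q where q: "bij_betw q ?P {..<b ^ CARD('n)}"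
    by (metis bij_betw_iff_card card_lessThan finite_lessThan)
  define rem where "rem z = (\<lambda>k. (z k - cube_shift b \<theta> k) mod int b)" for z :: "'n \<Rightarrow> int"
  have rem: "bij_betw rem {z'. cube_parent b \<theta> z' = z} ?P" for z
  proof (rule bij_betw_byWitness[where f' = "\<lambda>t k. cube_shift b \<theta> k + int b * z k + t k"])
    show "\<forall>z'\<in>{z'. cube_parent b \<theta> z' = z}. (\<lambda>k. cube_shift b \<theta> k + int b * z k + rem z' k) = z'"
    proof (intro ballI ext)
      fix z' k assume "z' \<in> {z'. cube_parent b \<theta> z' = z}"
      then have "z k = (z' k - cube_shift b \<theta> k) div int b" by (auto simp: cube_parent_def)
      moreover have "int b * ((z' k - cube_shift b \<theta> k) div int b) + rem z' k = z' k - cube_shift b \<theta> k"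
        unfolding rem_def by (rule mult_div_mod_eq)
      ultimately show "cube_shift b \<theta> k + int b * z k + rem z' k = z' k" by simp
    qed
    show "\<forall>t\<in>?P. rem (\<lambda>k. cube_shift b \<theta> k + int b * z k + t k) = t"
    proof (intro ballI ext)
      fix t k assume "t \<in> ?P"
      then have "t k \<in> {0..<int b}" by (rule PiE_mem) simp
      then show "rem (\<lambda>k. cube_shift b \<theta> k + int b * z k + t k) k = t k" by (simp add: rem_def)
    qed
    show "rem ` {z'. cube_parent b \<theta> z' = z} \<subseteq> ?P"
      using b0 by (auto simp: rem_def)
    show "(\<lambda>t k. cube_shift b \<theta> k + int b * z k + t k) ` ?P \<subseteq> {z'. cube_parent b \<theta> z' = z}"
    proof
      fix z' assume "z' \<in> (\<lambda>t k. cube_shift b \<theta> k + int b * z k + t k) ` ?P"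
      then obtain t where t: "t \<in> ?P" and z': "z' = (\<lambda>k. cube_shift b \<theta> k + int b * z k + t k)" by blast
      have "cube_parent b \<theta> z' k = z k" for k
      proof -
        have "t k \<in> {0..<int b}" using t by (rule PiE_mem) simp
        then show ?thesis by (simp add: cube_parent_def z')
      qed
      then show "z' \<in> {z'. cube_parent b \<theta> z' = z}" by auto
    qed
  qed
  have "homogeneous_grid (lborel :: (real ^ 'n) measure) (cube_label b \<theta> s) (cube_parent b \<theta>) (q \<circ> rem)
    (b ^ CARD('n)) (s ^ CARD('n))"
  proof
    show "space (lborel :: (real ^ 'n) measure) = UNIV" by simp
    show "cube_label b \<theta> s (Suc i) x = cube_parent b \<theta> (cube_label b \<theta> s i x)" for i x
      by (rule cube_label_Suc[OF b s])
    show "bij_betw (q \<circ> rem) {z'. cube_parent b \<theta> z' = z} {..<b ^ CARD('n)}" for z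
      by (rule bij_betw_trans[OF rem q])
    show "cube_label b \<theta> s 0 -` {z} \<in> sets lborel" for z
      unfolding cube_label_vimage[OF s b0] using s by (intro half_open_cube(1)) simp
    show "emeasure lborel (cube_label b \<theta> s 0 -` {z}) = ennreal (s ^ CARD('n))" for z
      unfolding cube_label_vimage[OF s b0] using s by (simp add: half_open_cube(2))
    show "0 < s ^ CARD('n)" using s by simp
  qed
  then show ?thesis by (rule exI[of _ "q \<circ> rem"])
qed

text \<open>The integers and the half-integers are at distance \<open>1 / 2\<close>, so an interval of length
  \<open>1 / 2\<close> avoids one of these sets.\<close>

lemma floor_shift_constant:
  fixes t :: real
  shows "\<exists>\<theta>. \<forall>y. \<bar>y - t\<bar> < 1 / 4 \<longrightarrow> \<lfloor>y - (if \<theta> then 1 / 2 else 0)\<rfloor> = \<lfloor>t - (if \<theta> then 1 / 2 else 0)\<rfloor>"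
proof -
  define m where "m = real_of_int \<lfloor>t\<rfloor>"
  have m: "m \<le> t" "t < m + 1" by (simp_all add: m_def)
  consider "m + 1 / 4 \<le> t" "t \<le> m + 3 / 4" | "t < m + 1 / 4" | "m + 3 / 4 < t" by linarith
  then show ?thesis
  proof cases
    case 1
    have fl: "\<lfloor>y\<rfloor> = \<lfloor>t\<rfloor>" if "\<bar>y - t\<bar> < 1 / 4" for y
    proof (rule floor_unique)
      show "real_of_int \<lfloor>t\<rfloor> \<le> y" "y < real_of_int \<lfloor>t\<rfloor> + 1"
        using 1 that unfolding m_def[symmetric] abs_less_iff by linarith+
    qed
    show ?thesis
    proof (intro exI[of _ False] allI impI)
      fix y assume "\<bar>y - t\<bar> < 1 / 4"
      from fl[OF this] show "\<lfloor>y - (if False then 1 / 2 else 0)\<rfloor> = \<lfloor>t - (if False then 1 / 2 else 0)\<rfloor>" by simp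
    qed
  next
    case 2
    have fl: "\<lfloor>y - 1 / 2\<rfloor> = \<lfloor>t\<rfloor> - 1" if "\<bar>y - t\<bar> < 1 / 4" for y
    proof (rule floor_unique)
      show "real_of_int (\<lfloor>t\<rfloor> - 1) \<le> y - 1 / 2" "y - 1 / 2 < real_of_int (\<lfloor>t\<rfloor> - 1) + 1"
        using 2 m that unfolding of_int_diff of_int_1 m_def[symmetric] abs_less_iff by linarith+
    qed
    show ?thesis
    proof (intro exI[of _ True] allI impI)
      fix y assume "\<bar>y - t\<bar> < 1 / 4"
      from fl[OF this] fl[of t] show "\<lfloor>y - (if True then 1 / 2 else 0)\<rfloor> = \<lfloor>t - (if True then 1 / 2 else 0)\<rfloor>" by simp
    qed
  next
    case 3
    have fl: "\<lfloor>y - 1 / 2\<rfloor> = \<lfloor>t\<rfloor>" if "\<bar>y - t\<bar> < 1 / 4" for y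
    proof (rule floor_unique)
      show "real_of_int \<lfloor>t\<rfloor> \<le> y - 1 / 2" "y - 1 / 2 < real_of_int \<lfloor>t\<rfloor> + 1"
        using 3 m that unfolding m_def[symmetric] abs_less_iff by linarith+
    qed
    show ?thesis
    proof (intro exI[of _ True] allI impI)
      fix y assume "\<bar>y - t\<bar> < 1 / 4"
      from fl[OF this] fl[of t] show "\<lfloor>y - (if True then 1 / 2 else 0)\<rfloor> = \<lfloor>t - (if True then 1 / 2 else 0)\<rfloor>" by simp
    qed
  qed
qed

lemma ball_in_shifted_cube:
  fixes c :: "real ^ 'n"
  assumes s: "0 < s" and b: "0 < b" and r: "4 * R \<le> s * real b ^ i"
  shows "\<exists>\<theta>. \<forall>x\<in>ball c R. cube_label b \<theta> s i x = cube_label b \<theta> s i c"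
proof -
  define t where "t = s * real b ^ i"
  have t: "0 < t" using s b by (simp add: t_def)
  have "\<forall>k. \<exists>\<theta>. \<forall>y. \<bar>y - c $ k / t\<bar> < 1 / 4 \<longrightarrow> \<lfloor>y - (if \<theta> then 1 / 2 else 0)\<rfloor> = \<lfloor>c $ k / t - (if \<theta> then 1 / 2 else 0)\<rfloor>"
    using floor_shift_constant by blast
  then obtain \<theta> where \<theta>: "\<And>k y. \<bar>y - c $ k / t\<bar> < 1 / 4 \<Longrightarrow>
      \<lfloor>y - (if \<theta> k then 1 / 2 else 0)\<rfloor> = \<lfloor>c $ k / t - (if \<theta> k then 1 / 2 else 0)\<rfloor>"
    by metis
  have "cube_label b \<theta> s i x = cube_label b \<theta> s i c" if x: "x \<in> ball c R" for x
  proof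
    fix k
    have "\<bar>(x - c) $ k\<bar> \<le> norm (x - c)" by (rule component_le_norm_cart)
    also have "\<dots> < R" using x by (simp add: dist_norm norm_minus_commute)
    finally have "\<bar>x $ k - c $ k\<bar> < t / 4" using r by (simp add: t_def)
    then have "\<bar>x $ k - c $ k\<bar> / t < 1 / 4" using t by (simp add: divide_less_eq)
    also have "\<bar>x $ k - c $ k\<bar> / t = \<bar>x $ k / t - c $ k / t\<bar>"
      using t by (simp add: diff_divide_distrib[symmetric])
    finally show "cube_label b \<theta> s i x k = cube_label b \<theta> s i c k"
      unfolding cube_label_def t_def[symmetric] by (rule \<theta>)
  qed
  then show ?thesis by blast
qed

text \<open>The ball extends over less than 6 sides in each direction.\<close>

lemma ball_label_range:
  fixes c :: "real ^ 'n"
  assumes s: "0 < s" and b: "0 < b" and r: "r < 3 * (s * real b ^ i)" and x: "x \<in> ball c r"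
  shows "cube_label b \<theta> s i x k - \<lfloor>(c $ k - r) / (s * real b ^ i) - (if \<theta> k then 1 / 2 else 0)\<rfloor> \<in> {0..6}"
proof -
  define t where "t = s * real b ^ i"
  have t: "0 < t" using s b by (simp add: t_def)
  define o' :: real where "o' = (if \<theta> k then 1 / 2 else 0)"
  have "\<bar>(x - c) $ k\<bar> \<le> norm (x - c)" by (rule component_le_norm_cart)
  also have "\<dots> < r" using x by (simp add: dist_norm norm_minus_commute)
  finally have xc: "c $ k - r < x $ k" "x $ k < (c $ k - r) + 6 * t"
    using r by (auto simp: t_def[symmetric] abs_less_iff)
  have 1: "(c $ k - r) / t \<le> x $ k / t" using xc(1) t by (simp add: divide_right_mono)
  have "x $ k / t < ((c $ k - r) + 6 * t) / t" using xc(2) t by (rule divide_strict_right_mono)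
  also have "\<dots> = (c $ k - r) / t + 6" using t by (simp add: add_divide_distrib)
  finally have 2: "x $ k / t < (c $ k - r) / t + 6" .
  have "\<lfloor>(c $ k - r) / t - o'\<rfloor> \<le> \<lfloor>x $ k / t - o'\<rfloor>" using 1 by (intro floor_mono) simp
  moreover have "\<lfloor>x $ k / t - o'\<rfloor> \<le> \<lfloor>(c $ k - r) / t - o'\<rfloor> + 6" using 2 by linarith
  ultimately show ?thesis unfolding cube_label_def t_def[symmetric] o'_def by simp
qed

section \<open>Gaussian and Rademacher sums\<close>

lemma std_normal_uminus:
  "distr std_normal_distribution std_normal_distribution uminus = std_normal_distribution"
proof (rule measure_eqI)
  fix A assume "A \<in> sets (distr std_normal_distribution std_normal_distribution uminus)"
  then have A: "A \<in> sets borel" by simp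
  have "emeasure (distr std_normal_distribution std_normal_distribution uminus) A
      = emeasure std_normal_distribution (uminus -` A)"
    using A by (subst emeasure_distr) auto
  also have "\<dots> = (\<integral>\<^sup>+x. ennreal (std_normal_density x) * indicator A (- x) \<partial>lborel)"
    using A by (subst emeasure_density)
      (auto intro!: nn_integral_cong simp: indicator_def measurable_sets_borel[of uminus borel])
  also have "\<dots> = (\<integral>\<^sup>+x. ennreal (std_normal_density x) * indicator A x \<partial>lborel)"
    using A by (subst nn_integral_real_affine[of _ "-1" 0]) (auto simp: normal_density_def)
  also have "\<dots> = emeasure std_normal_distribution A"
    using A by (simp add: emeasure_density)
  finally show "emeasure (distr std_normal_distribution std_normal_distribution uminus) A = emeasure std_normal_distribution A" .
qed simp

lemma gaussian_sign_invariant: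
  assumes J: "finite J" and \<epsilon>: "\<epsilon> \<in> signs J"
    and F: "F \<in> borel_measurable (\<Pi>\<^sub>M j\<in>J. std_normal_distribution)"
  shows "(\<integral>\<^sup>+\<gamma>. F (\<lambda>j\<in>J. \<epsilon> j * \<gamma> j) \<partial>(\<Pi>\<^sub>M j\<in>J. std_normal_distribution))
    = (\<integral>\<^sup>+\<gamma>. F \<gamma> \<partial>(\<Pi>\<^sub>M j\<in>J. std_normal_distribution))"
proof -
  let ?N = "std_normal_distribution"
  let ?P = "\<Pi>\<^sub>M j\<in>J. ?N"
  let ?f = "\<lambda>\<gamma>. \<lambda>j\<in>J. \<epsilon> j * \<gamma> j"
  interpret prob_space ?N by (rule prob_space_normal_density) simp
  interpret P: product_prob_space "\<lambda>_. ?N" J by standard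
  have f: "?f \<in> measurable ?P ?P"
    by (intro measurable_restrict) simp
  have "distr ?P ?P ?f = ?P"
  proof (rule P.PiM_eqI[OF J])
    fix A assume A: "\<And>j. j \<in> J \<Longrightarrow> A j \<in> sets ?N"
    have pre: "(\<lambda>x. \<epsilon> j * x) -` A j \<in> sets ?N" and pre_eq: "emeasure ?N ((\<lambda>x. \<epsilon> j * x) -` A j) = emeasure ?N (A j)" if j: "j \<in> J" for j
    proof -
      have Aj: "A j \<in> sets borel" using A[OF j] by simp
      have um: "uminus -` A j \<in> sets borel"
      proof -
        have "uminus \<in> borel_measurable (borel :: real measure)" by simp
        from measurable_sets_borel[OF this Aj] show ?thesis .
      qed
      have "emeasure ?N (uminus -` A j) = emeasure (distr ?N ?N uminus) (A j)"
        using Aj by (subst emeasure_distr) auto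
      then have um_eq: "emeasure ?N (uminus -` A j) = emeasure ?N (A j)" by (simp add: std_normal_uminus)
      have "\<epsilon> j = 1 \<or> \<epsilon> j = -1" using \<epsilon> j unfolding signs_def by (auto dest: PiE_mem)
      then have "(\<lambda>x. \<epsilon> j * x) -` A j = A j \<or> (\<lambda>x. \<epsilon> j * x) -` A j = uminus -` A j"
        by (auto simp: vimage_def)
      then show "(\<lambda>x. \<epsilon> j * x) -` A j \<in> sets ?N" "emeasure ?N ((\<lambda>x. \<epsilon> j * x) -` A j) = emeasure ?N (A j)"
        using Aj um um_eq by auto
    qed
    have "emeasure (distr ?P ?P ?f) (Pi\<^sub>E J A) = emeasure ?P (?f -` Pi\<^sub>E J A \<inter> space ?P)"
      using A J by (intro emeasure_distr f sets_PiM_I_finite) auto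
    also have "?f -` Pi\<^sub>E J A \<inter> space ?P = Pi\<^sub>E J (\<lambda>j. (\<lambda>x. \<epsilon> j * x) -` A j)"
      by (auto simp: space_PiM PiE_iff)
    also have "emeasure ?P \<dots> = (\<Prod>j\<in>J. emeasure ?N ((\<lambda>x. \<epsilon> j * x) -` A j))"
      using J pre by (intro P.emeasure_PiM) auto
    also have "\<dots> = (\<Prod>j\<in>J. emeasure ?N (A j))" by (intro prod.cong refl pre_eq)
    finally show "emeasure (distr ?P ?P ?f) (Pi\<^sub>E J A) = (\<Prod>j\<in>J. emeasure ?N (A j))" .
  qed simp
  then have "(\<integral>\<^sup>+\<gamma>. F \<gamma> \<partial>?P) = (\<integral>\<^sup>+\<gamma>. F \<gamma> \<partial>(distr ?P ?P ?f))" by simp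
  also have "\<dots> = (\<integral>\<^sup>+\<gamma>. F (?f \<gamma>) \<partial>?P)" using f F by (intro nn_integral_distr) auto
  finally show ?thesis ..
qed

lemma coeff_seminorm_sum_le:
  assumes \<phi>: "coeff_seminorm \<phi>" and J: "finite J"
  shows "\<phi> (\<lambda>j. \<Sum>i\<in>J. a i * e i j) \<le> (\<Sum>i\<in>J. \<bar>a i\<bar> * \<phi> (e i))"
proof -
  have tri: "\<phi> (\<lambda>j. a j + b j) \<le> \<phi> a + \<phi> b" and hom: "\<phi> (\<lambda>j. t * a j) = \<bar>t\<bar> * \<phi> a" for t a b
    using \<phi> unfolding coeff_seminorm_def by blast+
  show ?thesis
    using J
  proof (induction J rule: finite_induct)
    case empty
    show ?case using hom[of 0 "\<lambda>_. 0"] by simp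
  next
    case (insert k J)
    have "\<phi> (\<lambda>j. a k * e k j + (\<Sum>i\<in>J. a i * e i j)) \<le> \<phi> (\<lambda>j. a k * e k j) + \<phi> (\<lambda>j. \<Sum>i\<in>J. a i * e i j)"
      by (rule tri)
    with insert show ?case by (simp add: hom[of "a k" "e k"])
  qed
qed

text \<open>The seminorm is Lipschitz continuous in the coefficients from \<open>J\<close>.\<close>

lemma coeff_seminorm_measurable:
  fixes \<phi> :: "('j \<Rightarrow> real) \<Rightarrow> real"
  assumes \<phi>: "coeff_seminorm \<phi>" "depends_on J \<phi>" and J: "finite J"
  shows "\<phi> \<in> borel_measurable (\<Pi>\<^sub>M j\<in>J. (borel :: real measure))"
proof -
  let ?P = "\<Pi>\<^sub>M j\<in>J. (borel :: real measure)"
  have tri: "\<phi> (\<lambda>j. a j + b j) \<le> \<phi> a + \<phi> b" for a b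
    using \<phi>(1) unfolding coeff_seminorm_def by blast
  define S where "S = (\<Sum>i\<in>J. \<phi> (\<lambda>j. if j = i then 1 else 0))"
  have nn: "0 \<le> \<phi> a" for a using \<phi>(1) unfolding coeff_seminorm_def by blast
  have agree: "\<phi> a = \<phi> b" if "\<And>j. j \<in> J \<Longrightarrow> a j = b j" for a b
    using \<phi>(2) that unfolding depends_on_def by blast
  have lip: "\<phi> a - \<phi> b \<le> (\<Sum>i\<in>J. \<bar>a i - b i\<bar> * \<phi> (\<lambda>j. if j = i then 1 else 0))" for a b
  proof -
    have "\<phi> a = \<phi> (\<lambda>j. b j + (\<Sum>i\<in>J. (a i - b i) * (if j = i then 1 else 0)))"
    proof (rule agree)
      fix j assume "j \<in> J"
      have "(\<Sum>i\<in>J. (a i - b i) * (if j = i then 1 else 0)) = (\<Sum>i\<in>J. if i = j then a i - b i else 0)"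
        by (intro sum.cong refl) auto
      then show "a j = b j + (\<Sum>i\<in>J. (a i - b i) * (if j = i then 1 else 0))"
        using J \<open>j \<in> J\<close> by simp
    qed
    also have "\<dots> \<le> \<phi> b + \<phi> (\<lambda>j. \<Sum>i\<in>J. (a i - b i) * (if j = i then 1 else 0))"
      by (rule tri)
    also have "\<phi> (\<lambda>j. \<Sum>i\<in>J. (a i - b i) * (if j = i then 1 else 0))
        \<le> (\<Sum>i\<in>J. \<bar>a i - b i\<bar> * \<phi> (\<lambda>j. if j = i then 1 else 0))"
      using coeff_seminorm_sum_le[OF \<phi>(1) J, of "\<lambda>i. a i - b i" "\<lambda>i j. if j = i then 1 else 0"] .
    finally show ?thesis by simp
  qed
  \<comment> \<open>Rounding the coefficients to multiples of \<open>1 / Suc n\<close> gives functions of countably many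
    integer vectors; they converge to the seminorm.\<close>
  define \<rho> where "\<rho> n a = (\<lambda>j\<in>J. real_of_int \<lfloor>real (Suc n) * a j\<rfloor> / real (Suc n))" for n and a :: "'j \<Rightarrow> real"
  define z where "z n a = (\<lambda>j\<in>J. \<lfloor>real (Suc n) * a j\<rfloor>)" for n and a :: "'j \<Rightarrow> real"
  show ?thesis
  proof (rule borel_measurable_LIMSEQ_metric)
    fix n
    have z: "z n \<in> measurable ?P (count_space (J \<rightarrow>\<^sub>E UNIV))"
    proof -
      have "z n \<in> measurable ?P (\<Pi>\<^sub>M j\<in>J. count_space (UNIV :: int set))"
        unfolding z_def by measurable
      moreover have "(\<Pi>\<^sub>M j\<in>J. count_space (UNIV :: int set)) = count_space (J \<rightarrow>\<^sub>E UNIV)"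
        using J by (intro count_space_PiM_finite) auto
      ultimately show ?thesis by simp
    qed
    have "(\<lambda>a. \<phi> (\<lambda>j\<in>J. real_of_int (z n a j) / real (Suc n))) \<in> borel_measurable ?P"
      by (rule measurable_compose[OF z]) simp
    also have "(\<lambda>a. \<phi> (\<lambda>j\<in>J. real_of_int (z n a j) / real (Suc n))) = (\<lambda>a. \<phi> (\<rho> n a))"
    proof (rule ext)
      fix a
      show "\<phi> (\<lambda>j\<in>J. real_of_int (z n a j) / real (Suc n)) = \<phi> (\<rho> n a)"
        by (rule agree) (simp add: \<rho>_def z_def)
    qed
    finally show "(\<lambda>a. \<phi> (\<rho> n a)) \<in> borel_measurable ?P" .
  next
    fix a :: "'j \<Rightarrow> real"
    have \<rho>: "\<bar>\<rho> n a j - a j\<bar> \<le> 1 / real (Suc n)" if "j \<in> J" for n j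
    proof -
      have "\<bar>real_of_int \<lfloor>real (Suc n) * a j\<rfloor> - real (Suc n) * a j\<bar> \<le> 1" by linarith
      then have "\<bar>real_of_int \<lfloor>real (Suc n) * a j\<rfloor> - real (Suc n) * a j\<bar> / real (Suc n) \<le> 1 / real (Suc n)"
        by (rule divide_right_mono) simp
      also have "\<bar>real_of_int \<lfloor>real (Suc n) * a j\<rfloor> - real (Suc n) * a j\<bar> / real (Suc n)
          = \<bar>(real_of_int \<lfloor>real (Suc n) * a j\<rfloor> - real (Suc n) * a j) / real (Suc n)\<bar>"
        by (simp only: abs_divide abs_of_nat)
      also have "(real_of_int \<lfloor>real (Suc n) * a j\<rfloor> - real (Suc n) * a j) / real (Suc n) = \<rho> n a j - a j"
        using that by (simp add: \<rho>_def diff_divide_distrib del: of_nat_Suc)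
      finally show ?thesis .
    qed
    have "\<bar>\<phi> (\<rho> n a) - \<phi> a\<bar> \<le> S * (1 / real (Suc n))" for n
    proof -
      have "(\<Sum>i\<in>J. \<bar>\<rho> n a i - a i\<bar> * \<phi> (\<lambda>j. if j = i then 1 else 0))
          \<le> (\<Sum>i\<in>J. (1 / real (Suc n)) * \<phi> (\<lambda>j. if j = i then 1 else 0))"
        by (intro sum_mono mult_right_mono \<rho> nn)
      also have "\<dots> = S * (1 / real (Suc n))" by (simp add: S_def sum_divide_distrib)
      finally have le: "(\<Sum>i\<in>J. \<bar>\<rho> n a i - a i\<bar> * \<phi> (\<lambda>j. if j = i then 1 else 0)) \<le> S * (1 / real (Suc n))" .
      have comm: "\<bar>a i - \<rho> n a i\<bar> = \<bar>\<rho> n a i - a i\<bar>" for i by (rule abs_minus_commute)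
      show ?thesis
        using lip[of "\<rho> n a" a] lip[of a "\<rho> n a"] le unfolding comm by linarith
    qed
    then have le: "\<forall>n. norm (\<phi> (\<rho> n a) - \<phi> a) \<le> S * (1 / real (Suc n))" by (simp only: real_norm_def simp_thms)
    have "(\<lambda>n. 1 / real (Suc n)) \<longlonglongrightarrow> 0" by (rule LIMSEQ_Suc[OF lim_1_over_n])
    then have "(\<lambda>n. S * (1 / real (Suc n))) \<longlonglongrightarrow> 0" by (rule tendsto_mult_right_zero)
    then have "(\<lambda>n. \<phi> (\<rho> n a) - \<phi> a) \<longlonglongrightarrow> 0"
      by (rule Lim_null_comparison[OF always_eventually[OF le]])
    then show "(\<lambda>n. \<phi> (\<rho> n a)) \<longlonglongrightarrow> \<phi> a" by (rule LIM_zero_cancel)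
  qed
qed

text \<open>Gaussian sums are symmetric, so their second moment is the average over signs of the
  second moments of the signed sums, to which a bound for Rademacher sums applies for each fixed
  value of the Gaussian variables.\<close>

lemma gaussian_square_mean_le:
  fixes \<xi> \<eta> :: "nat \<Rightarrow> 'm \<Rightarrow> 'a::real_normed_vector"
  assumes p: "1 \<le> p" and \<xi>: "\<And>j. j < k \<Longrightarrow> \<xi> j \<in> Lp_space p M" and \<eta>: "\<And>j. j < k \<Longrightarrow> \<eta> j \<in> Lp_space p M"
    and le: "\<And>a. rad2 p M {..<k} (\<lambda>j x. a j *\<^sub>R \<eta> j x) \<le> C * rad2 p M {..<k} (\<lambda>j x. a j *\<^sub>R \<xi> j x)"
  shows "gaussian_square_mean (Lp_norm p M) k \<eta> \<le> ennreal (C\<^sup>2) * gaussian_square_mean (Lp_norm p M) k \<xi>"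
proof -
  let ?J = "{..<k}"
  let ?P = "\<Pi>\<^sub>M j\<in>?J. std_normal_distribution"
  let ?\<phi> = "\<lambda>\<zeta> \<gamma>. Lp_norm p M (\<lambda>x. \<Sum>j\<in>?J. \<gamma> j *\<^sub>R \<zeta> j x)"
  have sets_eq: "sets ?P = sets (\<Pi>\<^sub>M j\<in>?J. (borel :: real measure))"
    by (intro sets_PiM_cong) auto
  have avg: "gaussian_square_mean (Lp_norm p M) k \<zeta>
      = (\<integral>\<^sup>+\<gamma>. ennreal ((rad2 p M ?J (\<lambda>j x. \<gamma> j *\<^sub>R \<zeta> j x))\<^sup>2) \<partial>?P)"
    and meas: "(\<lambda>\<gamma>. ennreal ((rad2 p M ?J (\<lambda>j x. \<gamma> j *\<^sub>R \<zeta> j x))\<^sup>2)) \<in> borel_measurable ?P"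
    if \<zeta>: "\<And>j. j < k \<Longrightarrow> \<zeta> j \<in> Lp_space p M" for \<zeta> :: "nat \<Rightarrow> 'm \<Rightarrow> 'a"
  proof -
    have "?\<phi> \<zeta> \<in> borel_measurable (\<Pi>\<^sub>M j\<in>?J. (borel :: real measure))"
      using \<zeta> coeff_seminorm_Lp[OF p, of ?J \<zeta> M] by (intro coeff_seminorm_measurable) auto
    then have m: "?\<phi> \<zeta> \<in> borel_measurable ?P"
      by (simp add: measurable_cong_sets[OF sets_eq refl])
    define F where "F \<gamma> = ennreal ((?\<phi> \<zeta> \<gamma>)\<^sup>2)" for \<gamma>
    have F: "F \<in> borel_measurable ?P" unfolding F_def using m by measurable
    have F\<epsilon>: "(\<lambda>\<gamma>. F (\<lambda>j\<in>?J. \<epsilon> j * \<gamma> j)) \<in> borel_measurable ?P" for \<epsilon>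
    proof (rule measurable_compose[OF _ F])
      show "(\<lambda>\<gamma>. \<lambda>j\<in>?J. \<epsilon> j * \<gamma> j) \<in> measurable ?P ?P" by (intro measurable_restrict) simp
    qed
    have eq: "ennreal ((rad2 p M ?J (\<lambda>j x. \<gamma> j *\<^sub>R \<zeta> j x))\<^sup>2)
        = (\<Sum>\<epsilon>\<in>signs ?J. F (\<lambda>j\<in>?J. \<epsilon> j * \<gamma> j)) * ennreal (1 / 2 ^ k)" for \<gamma>
    proof -
      have "(\<Sum>j\<in>?J. \<epsilon> j *\<^sub>R \<gamma> j *\<^sub>R \<zeta> j x) = (\<Sum>j\<in>?J. (\<lambda>j\<in>?J. \<epsilon> j * \<gamma> j) j *\<^sub>R \<zeta> j x)" for \<epsilon> x
        by (intro sum.cong) auto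
      then have "(rad2 p M ?J (\<lambda>j x. \<gamma> j *\<^sub>R \<zeta> j x))\<^sup>2
          = (\<Sum>\<epsilon>\<in>signs ?J. (?\<phi> \<zeta> (\<lambda>j\<in>?J. \<epsilon> j * \<gamma> j))\<^sup>2) * (1 / 2 ^ k)"
        by (simp add: rad2_sq sign_mean_def)
      also have "ennreal \<dots> = ennreal (\<Sum>\<epsilon>\<in>signs ?J. (?\<phi> \<zeta> (\<lambda>j\<in>?J. \<epsilon> j * \<gamma> j))\<^sup>2) * ennreal (1 / 2 ^ k)"
        by (intro ennreal_mult) (auto intro: sum_nonneg)
      also have "ennreal (\<Sum>\<epsilon>\<in>signs ?J. (?\<phi> \<zeta> (\<lambda>j\<in>?J. \<epsilon> j * \<gamma> j))\<^sup>2) = (\<Sum>\<epsilon>\<in>signs ?J. F (\<lambda>j\<in>?J. \<epsilon> j * \<gamma> j))"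
        unfolding F_def by (rule sum_ennreal[symmetric]) simp
      finally show ?thesis .
    qed
    show "(\<lambda>\<gamma>. ennreal ((rad2 p M ?J (\<lambda>j x. \<gamma> j *\<^sub>R \<zeta> j x))\<^sup>2)) \<in> borel_measurable ?P"
      unfolding eq using F\<epsilon> by (intro borel_measurable_times_ennreal borel_measurable_sum) auto
    have "(\<integral>\<^sup>+\<gamma>. ennreal ((rad2 p M ?J (\<lambda>j x. \<gamma> j *\<^sub>R \<zeta> j x))\<^sup>2) \<partial>?P)
        = (\<Sum>\<epsilon>\<in>signs ?J. (\<integral>\<^sup>+\<gamma>. F (\<lambda>j\<in>?J. \<epsilon> j * \<gamma> j) \<partial>?P)) * ennreal (1 / 2 ^ k)"
      unfolding eq using F\<epsilon>
      by (subst nn_integral_multc) (auto intro!: borel_measurable_sum simp: nn_integral_sum)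
    also have "\<dots> = (\<Sum>\<epsilon>\<in>signs ?J. (\<integral>\<^sup>+\<gamma>. F \<gamma> \<partial>?P)) * ennreal (1 / 2 ^ k)"
      using F by (intro arg_cong2[where f = "(*)"] sum.cong refl gaussian_sign_invariant) auto
    also have "\<dots> = (\<integral>\<^sup>+\<gamma>. F \<gamma> \<partial>?P) * (ennreal (2 ^ k) * ennreal (1 / 2 ^ k))"
      by (simp add: mult_ac flip: ennreal_power)
    also have "ennreal (2 ^ k) * ennreal (1 / 2 ^ k) = 1"
      by (simp flip: ennreal_mult)
    finally show "gaussian_square_mean (Lp_norm p M) k \<zeta>
      = (\<integral>\<^sup>+\<gamma>. ennreal ((rad2 p M ?J (\<lambda>j x. \<gamma> j *\<^sub>R \<zeta> j x))\<^sup>2) \<partial>?P)"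
      by (simp add: gaussian_square_mean_def F_def)
  qed
  have avg\<eta>: "gaussian_square_mean (Lp_norm p M) k \<eta>
      = (\<integral>\<^sup>+\<gamma>. ennreal ((rad2 p M ?J (\<lambda>j x. \<gamma> j *\<^sub>R \<eta> j x))\<^sup>2) \<partial>?P)"
    by (rule avg) (rule \<eta>)
  have avg\<xi>: "gaussian_square_mean (Lp_norm p M) k \<xi>
      = (\<integral>\<^sup>+\<gamma>. ennreal ((rad2 p M ?J (\<lambda>j x. \<gamma> j *\<^sub>R \<xi> j x))\<^sup>2) \<partial>?P)"
    by (rule avg) (rule \<xi>)
  have "gaussian_square_mean (Lp_norm p M) k \<eta>
      \<le> (\<integral>\<^sup>+\<gamma>. ennreal (C\<^sup>2) * ennreal ((rad2 p M ?J (\<lambda>j x. \<gamma> j *\<^sub>R \<xi> j x))\<^sup>2) \<partial>?P)"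
    unfolding avg\<eta>
  proof (rule nn_integral_mono)
    fix \<gamma>
    have "(rad2 p M ?J (\<lambda>j x. \<gamma> j *\<^sub>R \<eta> j x))\<^sup>2 \<le> (C * rad2 p M ?J (\<lambda>j x. \<gamma> j *\<^sub>R \<xi> j x))\<^sup>2"
      by (intro power_mono le) simp
    then show "ennreal ((rad2 p M ?J (\<lambda>j x. \<gamma> j *\<^sub>R \<eta> j x))\<^sup>2)
        \<le> ennreal (C\<^sup>2) * ennreal ((rad2 p M ?J (\<lambda>j x. \<gamma> j *\<^sub>R \<xi> j x))\<^sup>2)"
      by (simp add: power_mult_distrib ennreal_leI flip: ennreal_mult)
  qed
  also have "\<dots> = ennreal (C\<^sup>2) * gaussian_square_mean (Lp_norm p M) k \<xi>"
    unfolding avg\<xi> by (rule nn_integral_cmult) (rule meas, rule \<xi>)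
  finally show ?thesis .
qed

section \<open>Averages over balls\<close>

definition offsets :: "('n \<Rightarrow> int) set" where
  "offsets = UNIV \<rightarrow>\<^sub>E {0..6}"

text \<open>The label of the cube that contains the lower corner of the cube circumscribed to the ball. The
  labels of the cubes that meet the ball are obtained by adding elements of \<open>offsets\<close>.\<close>

definition corner_label :: "nat \<Rightarrow> ('n::finite \<Rightarrow> bool) \<Rightarrow> real \<Rightarrow> nat \<Rightarrow> real ^ 'n \<Rightarrow> real \<Rightarrow> 'n \<Rightarrow> int" where
  "corner_label b \<theta> s i c r = (\<lambda>k. \<lfloor>(c $ k - r) / (s * real b ^ i) - (if \<theta> k then 1 / 2 else 0)\<rfloor>)"

lemma finite_offsets: "finite (offsets :: ('n::finite \<Rightarrow> int) set)"
  unfolding offsets_def by (intro finite_PiE) auto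

text \<open>If the dilated ball lies in one cube of the next generation, that cube is the parent of each
  small cube that meets the ball. So restricting the summand of \<open>z u\<close> to the parent of \<open>z u\<close> changes
  nothing: if \<open>z u\<close> does not meet the ball, the summand vanishes.\<close>

lemma ball_average_cubes:
  fixes c :: "real ^ 'n" and \<xi> :: "real ^ 'n \<Rightarrow> 'x::banach"
  assumes p: "1 \<le> p" and \<xi>: "\<xi> \<in> Lp_space p lborel" and b: "odd b" and s: "0 < s" and \<alpha>: "1 \<le> \<alpha>" and r: "0 < r"
    and r3: "r < 3 * (s * real b ^ i)"
    and inside: "\<forall>x\<in>ball c (\<alpha> * r). cube_label b \<theta> s (Suc i) x = cube_label b \<theta> s (Suc i) c"
  defines "z u \<equiv> \<lambda>k. corner_label b \<theta> s i c r k + u k"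
  defines "f u \<equiv> \<lambda>x. (indicator (ball c r) x * indicator (cube_label b \<theta> s i -` {z u}) x) *\<^sub>R \<xi> x"
  shows "ball_average \<alpha> c r \<xi> x = (\<Sum>u\<in>offsets.
    ((s * real b ^ i) ^ CARD('n) / measure lborel (ball c r) * indicator (ball c (\<alpha> * r)) x) *\<^sub>R
    indicator (cube_label b \<theta> s (Suc i) -` {cube_parent b \<theta> (z u)}) x *\<^sub>R
    homogeneous_grid.cell_average lborel (cube_label b \<theta> s) (b ^ CARD('n)) (s ^ CARD('n)) i (z u) (f u))"
proof -
  have b0: "0 < b" using b by (rule odd_pos)
  obtain pos where "homogeneous_grid (lborel :: (real ^ 'n) measure) (cube_label b \<theta> s) (cube_parent b \<theta>) pos
      (b ^ CARD('n)) (s ^ CARD('n))"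
    using homogeneous_grid_cubes[OF b s] by blast
  then interpret homogeneous_grid "lborel :: (real ^ 'n) measure" "cube_label b \<theta> s" "cube_parent b \<theta>" pos
    "b ^ CARD('n)" "s ^ CARD('n)" .
  let ?cell = "\<lambda>u. cube_label b \<theta> s i -` {z u}"
  define y where "y u = integral_over lborel (?cell u) (f u)" for u
  define B where "B = measure lborel (ball c r)"
  define w where "w = (s * real b ^ i) ^ CARD('n)"
  have B: "0 < B" using r by (simp add: B_def)
  have w: "0 < w" using s b0 by (simp add: w_def)
  have w_eq: "s ^ CARD('n) * real (b ^ CARD('n)) ^ i = w"
    by (simp add: w_def power_mult_distrib mult.commute flip: power_mult)
  have f: "f u \<in> Lp_space p lborel" for u
    unfolding f_def using p
    by (intro Lp_space_mult[where c = 1] \<xi> borel_measurable_times borel_measurable_indicator cell_sets)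
       (auto simp: indicator_def)
  have cf: "indicator (?cell u) x *\<^sub>R f u x = f u x" for u x
    by (simp add: f_def indicator_def)
  have hy: "has_integral_in lborel (f u) (y u)" for u
    using Lp_space_integral_exists[OF p f cell_sets, of i "z u" u] by (simp add: cf y_def cell_emeasure)
  have cover: "(\<Sum>u\<in>offsets. f u x) = indicator (ball c r) x *\<^sub>R \<xi> x" for x
  proof (cases "x \<in> ball c r")
    case True
    define u0 where "u0 k = cube_label b \<theta> s i x k - corner_label b \<theta> s i c r k" for k
    have "u0 k \<in> {0..6}" for k
      unfolding u0_def corner_label_def using s b0 r3 True by (rule ball_label_range)
    then have u0: "u0 \<in> offsets" unfolding offsets_def by (intro PiE_I) auto
    have "(\<Sum>u\<in>offsets. f u x) = (\<Sum>u\<in>offsets. if u = u0 then \<xi> x else 0)"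
    proof (intro sum.cong refl)
      fix u :: "'n \<Rightarrow> int"
      have "x \<in> ?cell u \<longleftrightarrow> u = u0" by (auto simp: z_def u0_def fun_eq_iff)
      then show "f u x = (if u = u0 then \<xi> x else 0)" using True by (auto simp: f_def indicator_def)
    qed
    then show ?thesis using u0 True by (simp add: finite_offsets)
  qed (simp add: f_def)
  have "has_integral_in lborel (\<lambda>x. \<Sum>u\<in>offsets. f u x) (\<Sum>u\<in>offsets. y u)"
    by (intro has_integral_in_sum hy)
  then have int: "integral_over lborel (ball c r) \<xi> = (\<Sum>u\<in>offsets. y u)"
    unfolding cover by (rule integral_over_eq)
  have drop: "indicator (ball c (\<alpha> * r)) x *\<^sub>R indicator (cube_label b \<theta> s (Suc i) -` {cube_parent b \<theta> (z u)}) x *\<^sub>R y u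
      = indicator (ball c (\<alpha> * r)) x *\<^sub>R y u" for u
  proof (cases "x \<in> ball c (\<alpha> * r) \<and> y u \<noteq> 0")
    case True
    have "\<exists>x'. f u x' \<noteq> 0"
    proof (rule ccontr)
      assume "\<nexists>x'. f u x' \<noteq> 0"
      then have "f u = (\<lambda>x. 0)" by auto
      then have "has_integral_in lborel (f u) 0" by (simp only: has_integral_in_zero)
      then show False using has_integral_in_unique[OF hy] True by blast
    qed
    then obtain x' where x': "f u x' \<noteq> 0" ..
    then have "x' \<in> ball c r" "cube_label b \<theta> s i x' = z u"
      by (auto simp: f_def indicator_def split: if_splits)
    moreover have "ball c r \<subseteq> ball c (\<alpha> * r)" using \<alpha> r by (intro subset_ball) simp
    ultimately have "x' \<in> ball c (\<alpha> * r)" "cube_label b \<theta> s (Suc i) x' = cube_parent b \<theta> (z u)"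
      by (blast, simp only: label_Suc)
    then have "cube_label b \<theta> s (Suc i) x' = cube_label b \<theta> s (Suc i) c"
      "cube_label b \<theta> s (Suc i) x' = cube_parent b \<theta> (z u)"
      using inside by blast+
    then have "cube_label b \<theta> s (Suc i) x = cube_parent b \<theta> (z u)" using inside True by simp
    then show ?thesis by simp
  qed auto
  have "ball_average \<alpha> c r \<xi> x = (\<Sum>u\<in>offsets. (1 / B) *\<^sub>R indicator (ball c (\<alpha> * r)) x *\<^sub>R y u)"
    unfolding ball_average_def int B_def[symmetric] by (simp add: scaleR_sum_right mult.commute)
  also have "\<dots> = (\<Sum>u\<in>offsets. (w / B * indicator (ball c (\<alpha> * r)) x) *\<^sub>R
      indicator (cube_label b \<theta> s (Suc i) -` {cube_parent b \<theta> (z u)}) x *\<^sub>R cell_average i (z u) (f u))"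
  proof (intro sum.cong refl)
    fix u :: "'n \<Rightarrow> int"
    have ca: "cell_average i (z u) (f u) = (1 / w) *\<^sub>R y u"
      unfolding cell_average_def w_eq y_def by (simp add: divide_inverse)
    have "(1 / B) *\<^sub>R indicator (ball c (\<alpha> * r)) x *\<^sub>R y u
      = (w / B * (1 / w)) *\<^sub>R (indicator (ball c (\<alpha> * r)) x *\<^sub>R indicator (cube_label b \<theta> s (Suc i) -` {cube_parent b \<theta> (z u)}) x *\<^sub>R y u)"
      unfolding drop using w by simp
    also have "\<dots> = (w / B * indicator (ball c (\<alpha> * r)) x) *\<^sub>R
      indicator (cube_label b \<theta> s (Suc i) -` {cube_parent b \<theta> (z u)}) x *\<^sub>R cell_average i (z u) (f u)"
      unfolding ca scaleR_scaleR by (simp only: mult_ac)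
    finally show "(1 / B) *\<^sub>R indicator (ball c (\<alpha> * r)) x *\<^sub>R y u = \<dots>" .
  qed
  finally show ?thesis unfolding w_def B_def .
qed

text \<open>The radii are sorted by their order of magnitude in base 3. The sides \<open>3 powr e\<close> with a
  fixed residue \<open>a\<close> of \<open>e\<close> modulo \<open>L\<close> belong to one grid of ratio \<open>3 ^ L\<close>, where \<open>3 ^ L\<close> is of the
  order of \<open>\<alpha>\<close>; summing over the \<open>L\<close> residues costs the logarithm. The shift \<open>\<theta>\<close> of the grid and
  the offset \<open>u\<close> of the small cube take boundedly many values. For fixed \<open>(a, \<theta>, u)\<close> the balls are
  averaged in a single grid, with one small cube for each ball.\<close>

lemma rad2_ball_averages:
  assumes umd: "umd TYPE('x::banach)" and p: "1 < p"
    and type: "has_type (Lp_space p lborel :: (real ^ 'n \<Rightarrow> 'x) set) (Lp_norm p lborel) \<tau>"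
  shows "\<exists>C\<ge>0. \<forall>\<alpha>\<ge>1. \<forall>(J :: nat set) c r (\<xi> :: nat \<Rightarrow> real ^ 'n \<Rightarrow> 'x).
    finite J \<longrightarrow> (\<forall>j\<in>J. 0 < r j) \<longrightarrow> (\<forall>j\<in>J. \<xi> j \<in> Lp_space p lborel) \<longrightarrow>
    rad2 p lborel J (\<lambda>j. ball_average \<alpha> (c j) (r j) (\<xi> j))
      \<le> C * (1 + ln \<alpha>) * \<alpha> powr (real CARD('n) / \<tau>) * rad2 p lborel J \<xi>"
proof -
  have p1: "1 \<le> p" using p by simp
  have \<tau>: "1 \<le> \<tau>" using type by (simp add: has_type_def)
  let ?d = "CARD('n)"
  from parent_average_bound[OF umd p type, where 'c = "'n \<Rightarrow> int" and 'j = nat]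
  obtain C1 where C1: "0 \<le> C1" and pab0: "\<forall>\<kappa> (par :: ('n \<Rightarrow> int) \<Rightarrow> 'n \<Rightarrow> int) pos K v (J :: nat set) lev z (f :: nat \<Rightarrow> real ^ 'n \<Rightarrow> 'x).
    homogeneous_grid lborel \<kappa> par pos K v \<longrightarrow> finite J \<longrightarrow>
    (\<forall>j\<in>J. f j \<in> Lp_space p lborel) \<longrightarrow> (\<forall>j\<in>J. \<forall>x. \<kappa> (lev j) x \<noteq> z j \<longrightarrow> f j x = 0) \<longrightarrow>
    rad2 p lborel J (\<lambda>j x. indicator (\<kappa> (Suc (lev j)) -` {par (z j)}) x *\<^sub>R
        homogeneous_grid.cell_average lborel \<kappa> K v (lev j) (z j) (f j))
    \<le> C1 * real K powr (1 / \<tau>) * rad2 p lborel J f"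
    by (elim exE conjE)
  note pab = pab0[THEN spec, THEN spec, THEN spec, THEN spec, THEN spec, THEN spec, THEN spec, THEN spec,
      THEN spec, THEN mp, THEN mp, THEN mp, THEN mp]
  from rad2_contraction[OF p1, where 'm = "real ^ 'n" and 'j = nat and 'a = 'x]
  obtain A where A: "A \<ge> 1" and contr0:
    "\<forall>(M :: (real ^ 'n) measure) (J :: nat set) (\<xi> :: nat \<Rightarrow> real ^ 'n \<Rightarrow> 'x) a c.
    finite J \<longrightarrow> (\<forall>j\<in>J. \<xi> j \<in> Lp_space p M) \<longrightarrow> (\<forall>j\<in>J. a j \<in> borel_measurable M) \<longrightarrow>
    0 < c \<longrightarrow> (\<forall>j\<in>J. \<forall>x. \<bar>a j x\<bar> \<le> c) \<longrightarrow>
    rad2 p M J (\<lambda>j x. a j x *\<^sub>R \<xi> j x) \<le> A * c * rad2 p M J \<xi>"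
    by (elim exE conjE)
  note contr = contr0[THEN spec, THEN spec, THEN spec, THEN spec, THEN spec, THEN mp, THEN mp, THEN mp,
      THEN mp, THEN mp]
  define \<omega> where "\<omega> = unit_ball_vol (real ?d)"
  have \<omega>: "0 < \<omega>" by (simp add: \<omega>_def)
  define D where "D = real (card (UNIV \<times> offsets :: (('n \<Rightarrow> bool) \<times> ('n \<Rightarrow> int)) set))"
  have D: "0 \<le> D" by (simp add: D_def)
  define C where "C = 4 * D * (A * (1 / \<omega>) * (C1 * 36 powr (real ?d / \<tau>) * A))"
  have C: "0 \<le> C" using D A \<omega> C1 by (simp add: C_def)
  have main: "rad2 p lborel J (\<lambda>j. ball_average \<alpha> (c j) (r j) (\<xi> j))
      \<le> C * (1 + ln \<alpha>) * \<alpha> powr (real ?d / \<tau>) * rad2 p lborel J \<xi>"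
    if \<alpha>: "1 \<le> \<alpha>" and J: "finite J" and r: "\<forall>j\<in>J. 0 < r j" and \<xi>: "\<forall>j\<in>J. \<xi> j \<in> Lp_space p lborel"
    for \<alpha> and J :: "nat set" and c r and \<xi> :: "nat \<Rightarrow> real ^ 'n \<Rightarrow> 'x"
  proof (cases "J = {}")
    case True
    then show ?thesis by (simp add: rad2_def Lp_norm_def)
  next
    case False
    \<comment> \<open>The radius is less than 3 sides of the small cubes. Hence \<open>3 ^ L \<ge> 12 * \<alpha>\<close> makes the side of the
      next generation at least four times the radius \<open>\<alpha> * r j\<close> of the dilated ball. The factor 36
      below comes from rounding \<open>L\<close> up.\<close>
    define L where "L = nat \<lceil>log 3 (12 * \<alpha>)\<rceil>"
    define b where "b = (3::nat) ^ L"
    have log_pos: "0 < log 3 (12 * \<alpha>)" using \<alpha> by simp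
    have L1: "1 \<le> L" using log_pos by (simp add: L_def Suc_le_eq)
    have L_lo: "log 3 (12 * \<alpha>) \<le> real L" unfolding L_def by (rule real_nat_ceiling_ge)
    have L_hi: "real L \<le> log 3 (12 * \<alpha>) + 1" using log_pos unfolding L_def by linarith
    have bp: "real b = 3 powr real L" by (simp add: b_def powr_realpow)
    have b_lo: "12 * \<alpha> \<le> real b"
    proof -
      have "12 * \<alpha> = 3 powr log 3 (12 * \<alpha>)" using \<alpha> by simp
      also have "\<dots> \<le> 3 powr real L" using L_lo by (intro powr_mono) auto
      finally show ?thesis by (simp add: bp)
    qed
    have b_hi: "real b \<le> 36 * \<alpha>"
    proof -
      have "real b \<le> 3 powr (log 3 (12 * \<alpha>) + 1)" unfolding bp using L_hi by (intro powr_mono) auto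
      also have "\<dots> = 36 * \<alpha>" using \<alpha> by (simp add: powr_add)
      finally show ?thesis .
    qed
    have L_ln: "real L \<le> 4 * (1 + ln \<alpha>)"
    proof -
      have "exp 1 \<le> (3::real)" by (rule exp_le)
      then have ln3: "1 \<le> ln (3::real)" by (simp add: ln_ge_iff)
      have "log 3 (12 * \<alpha>) \<le> log 3 (3 ^ 3 * \<alpha>)" using \<alpha> by (intro log_mono) auto
      also have "\<dots> = log 3 (3 ^ 3) + log 3 \<alpha>" using \<alpha> by (subst log_mult) auto
      also have "log 3 (3 ^ 3) = (3 :: real)" by (subst log_nat_power) simp_all
      finally have "log 3 (12 * \<alpha>) \<le> 3 + log 3 \<alpha>" .
      moreover have "log 3 \<alpha> \<le> ln \<alpha>"
        unfolding log_def using ln3 \<alpha> by (simp add: divide_le_eq mult_left_mono[of 1 "ln 3" "ln \<alpha>", simplified])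
      ultimately have "real L \<le> 4 + ln \<alpha>" using L_hi by argo
      moreover have "0 \<le> ln \<alpha>" using \<alpha> by simp
      ultimately show ?thesis by argo
    qed
    have b_odd: "odd b" by (simp add: b_def)
    have b0: "0 < b" by (simp add: b_def)
    define e where "e j = \<lfloor>log 3 (r j)\<rfloor>" for j
    define i where "i j = e j div int L" for j
    define a where "a j = nat (e j mod int L)" for j
    define i0 where "i0 = Min (i ` J)"
    define lev where "lev j = nat (i j - i0)" for j
    define s where "s m = 3 powr (real m + real L * real_of_int i0)" for m :: nat
    have s0: "0 < s m" for m by (simp add: s_def)
    have aL: "a j < L" for j
    proof -
      have "0 \<le> e j mod int L" "e j mod int L < int L" using L1 by auto
      then show ?thesis by (simp add: a_def nat_less_iff)
    qed
    have side: "s (a j) * real b ^ lev j = 3 powr real_of_int (e j)" if j: "j \<in> J" for j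
    proof -
      have "i0 \<le> i j" unfolding i0_def using J j by (intro Min_le) auto
      then have l: "int (lev j) = i j - i0" by (simp add: lev_def)
      have am: "int (a j) = e j mod int L" using L1 by (simp add: a_def)
      have "int (a j) + int L * i0 + int L * int (lev j) = e j"
        unfolding l am by (simp add: i_def right_diff_distrib)
      then have eq: "real (a j) + real L * real_of_int i0 + real L * real (lev j) = real_of_int (e j)"
        by (metis of_int_add of_int_mult of_int_of_nat_eq)
      have "real b ^ lev j = 3 powr (real L * real (lev j))"
        unfolding bp by (simp add: powr_powr flip: powr_realpow)
      then have "s (a j) * real b ^ lev j = 3 powr (real (a j) + real L * real_of_int i0 + real L * real (lev j))"
        by (simp add: s_def powr_add)
      then show ?thesis by (simp only: eq)
    qed
    have side_r: "s (a j) * real b ^ lev j \<le> r j" "r j < 3 * (s (a j) * real b ^ lev j)" if j: "j \<in> J" for j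
    proof -
      have rj: "0 < r j" using r j by simp
      then have req: "r j = 3 powr log 3 (r j)" by simp
      have "3 powr real_of_int (e j) \<le> 3 powr log 3 (r j)" unfolding e_def by (intro powr_mono) auto
      then show "s (a j) * real b ^ lev j \<le> r j" using req side[OF j] by simp
      have "3 powr log 3 (r j) < 3 powr (real_of_int (e j) + 1)"
        unfolding e_def by (intro powr_less_mono) auto
      then show "r j < 3 * (s (a j) * real b ^ lev j)" using req side[OF j] by (simp add: powr_add)
    qed
    have "\<exists>\<theta>. \<forall>x\<in>ball (c j) (\<alpha> * r j). cube_label b \<theta> (s (a j)) (Suc (lev j)) x = cube_label b \<theta> (s (a j)) (Suc (lev j)) (c j)"
      if j: "j \<in> J" for j
    proof (rule ball_in_shifted_cube[OF s0 b0])
      have "4 * (\<alpha> * r j) \<le> 4 * (\<alpha> * (3 * (s (a j) * real b ^ lev j)))"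
        using \<alpha> side_r(2)[OF j] by (intro mult_left_mono) auto
      also have "\<dots> = (12 * \<alpha>) * (s (a j) * real b ^ lev j)" by simp
      also have "\<dots> \<le> real b * (s (a j) * real b ^ lev j)"
        using b_lo s0 by (intro mult_right_mono) (auto simp: less_imp_le)
      finally show "4 * (\<alpha> * r j) \<le> s (a j) * real b ^ Suc (lev j)" by (simp add: mult_ac)
    qed
    then obtain \<theta> where \<theta>: "\<forall>j\<in>J. \<forall>x\<in>ball (c j) (\<alpha> * r j).
        cube_label b (\<theta> j) (s (a j)) (Suc (lev j)) x = cube_label b (\<theta> j) (s (a j)) (Suc (lev j)) (c j)"
      by metis
    define I where "I = {..<L} \<times> (UNIV :: ('n \<Rightarrow> bool) set) \<times> (offsets :: ('n \<Rightarrow> int) set)"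
    have I: "finite I" "real (card I) = real L * D"
      by (simp_all add: I_def D_def card_cartesian_product finite_cartesian_product finite_offsets)
    \<comment> \<open>Indices outside the class \<open>t\<close> get the zero function, so that all classes share the set \<open>J\<close>.\<close>
    define cls where "cls t j \<longleftrightarrow> a j = fst t \<and> \<theta> j = fst (snd t)"
      for t :: "nat \<times> ('n \<Rightarrow> bool) \<times> ('n \<Rightarrow> int)" and j
    define \<kappa> where "\<kappa> t = cube_label b (fst (snd t)) (s (fst t))" for t :: "nat \<times> ('n \<Rightarrow> bool) \<times> ('n \<Rightarrow> int)"
    define par where "par t = cube_parent b (fst (snd t))" for t :: "nat \<times> ('n \<Rightarrow> bool) \<times> ('n \<Rightarrow> int)"
    define z where "z t j = (\<lambda>k. corner_label b (fst (snd t)) (s (fst t)) (lev j) (c j) (r j) k + snd (snd t) k)"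
      for t :: "nat \<times> ('n \<Rightarrow> bool) \<times> ('n \<Rightarrow> int)" and j
    define q where "q t j x = (if cls t j then indicator (ball (c j) (r j)) x * indicator (\<kappa> t (lev j) -` {z t j}) x else 0 :: real)" for t j x
    define f where "f t j x = q t j x *\<^sub>R \<xi> j x" for t j x
    define G where "G t j x = indicator (\<kappa> t (Suc (lev j)) -` {par t (z t j)}) x *\<^sub>R
        homogeneous_grid.cell_average lborel (\<kappa> t) (b ^ ?d) (s (fst t) ^ ?d) (lev j) (z t j) (f t j)" for t j x
    define \<mu> where "\<mu> t j x = (if cls t j then (s (fst t) * real b ^ lev j) ^ ?d / measure lborel (ball (c j) (r j))
        * indicator (ball (c j) (\<alpha> * r j)) x else 0 :: real)" for t j x
    have grid: "\<exists>pos. homogeneous_grid (lborel :: (real ^ 'n) measure) (\<kappa> t) (par t) pos (b ^ ?d) (s (fst t) ^ ?d)" for t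
      unfolding \<kappa>_def par_def by (rule homogeneous_grid_cubes[OF b_odd s0])
    have cells: "\<kappa> t l -` {w} \<in> sets lborel" "emeasure lborel (\<kappa> t l -` {w}) < \<infinity>" for t l w
    proof -
      obtain pos where g: "homogeneous_grid (lborel :: (real ^ 'n) measure) (\<kappa> t) (par t) pos (b ^ ?d) (s (fst t) ^ ?d)"
        using grid by blast
      show "\<kappa> t l -` {w} \<in> sets lborel" by (rule homogeneous_grid.cell_sets[OF g])
      show "emeasure lborel (\<kappa> t l -` {w}) < \<infinity>" by (simp add: homogeneous_grid.cell_emeasure[OF g])
    qed
    have q: "q t j \<in> borel_measurable lborel" "\<bar>q t j x\<bar> \<le> 1" for t j x
    proof -
      show "q t j \<in> borel_measurable lborel"
        unfolding q_def using cells(1) by (cases "cls t j") (simp_all add: borel_measurable_times borel_measurable_indicator)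
      show "\<bar>q t j x\<bar> \<le> 1" by (auto simp: q_def indicator_def)
    qed
    have fLp: "\<forall>j\<in>J. f t j \<in> Lp_space p lborel" for t
      unfolding f_def using p \<xi> q by (intro ballI Lp_space_mult[where c = 1]) auto
    have GLp: "G t j \<in> Lp_space p lborel" for t j
      unfolding G_def using p by (intro Lp_space_indicator cells) auto
    have \<mu>1: "\<mu> t j \<in> borel_measurable lborel" for t j
    proof -
      have "(\<lambda>x. k * indicator (ball (c j) (\<alpha> * r j)) x) \<in> borel_measurable lborel" for k :: real
        by (intro borel_measurable_times borel_measurable_const borel_measurable_indicator) simp
      then show ?thesis
        unfolding \<mu>_def by (cases "cls t j") (simp_all only: if_True if_False borel_measurable_const)
    qed
    have \<mu>2: "\<bar>\<mu> t j x\<bar> \<le> 1 / \<omega>" if j: "j \<in> J" for t j x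
    proof (cases "cls t j")
      case True
      then have s_eq: "s (fst t) = s (a j)" by (simp add: cls_def)
      define w where "w = s (a j) * real b ^ lev j"
      have w: "0 < w" using s0 b0 by (simp add: w_def)
      have rj: "0 < r j" using r j by simp
      have m: "measure lborel (ball (c j) (r j)) = \<omega> * r j ^ ?d"
        using rj by (simp add: content_ball \<omega>_def)
      have "w ^ ?d \<le> r j ^ ?d" using w side_r(1)[OF j] by (intro power_mono) (auto simp: w_def)
      then have "\<omega> * w ^ ?d \<le> \<omega> * r j ^ ?d" using \<omega> by simp
      then have "w ^ ?d / (\<omega> * r j ^ ?d) \<le> 1 / \<omega>" using \<omega> rj by (simp add: field_simps)
      moreover have "0 \<le> w ^ ?d / (\<omega> * r j ^ ?d)" using w \<omega> rj by simp
      moreover have "\<mu> t j x = w ^ ?d / (\<omega> * r j ^ ?d) * indicator (ball (c j) (\<alpha> * r j)) x"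
        using True by (simp add: \<mu>_def m s_eq w_def)
      ultimately show ?thesis using \<omega> by (auto simp: indicator_def)
    qed (use \<omega> in \<open>simp add: \<mu>_def\<close>)
    have decomp: "ball_average \<alpha> (c j) (r j) (\<xi> j) x = (\<Sum>t\<in>I. \<mu> t j x *\<^sub>R G t j x)" if j: "j \<in> J" for j x
    proof -
      let ?t = "\<lambda>u. (a j, \<theta> j, u)"
      have cls: "cls (?t u) j" for u by (simp add: cls_def)
      have "(\<Sum>t\<in>I. \<mu> t j x *\<^sub>R G t j x) = (\<Sum>t\<in>?t ` offsets. \<mu> t j x *\<^sub>R G t j x)"
      proof (rule sum.mono_neutral_right[OF I(1)])
        show "?t ` offsets \<subseteq> I" using aL by (auto simp: I_def)
        show "\<forall>t\<in>I - ?t ` offsets. \<mu> t j x *\<^sub>R G t j x = 0"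
        proof
          fix t assume t: "t \<in> I - ?t ` offsets"
          have "\<not> cls t j"
          proof
            assume "cls t j"
            then have "t = ?t (snd (snd t))" by (auto simp: cls_def prod_eq_iff)
            moreover have "snd (snd t) \<in> offsets" using t by (auto simp: I_def)
            ultimately show False using t by blast
          qed
          then show "\<mu> t j x *\<^sub>R G t j x = 0" by (simp add: \<mu>_def)
        qed
      qed
      also have "\<dots> = (\<Sum>u\<in>offsets. \<mu> (?t u) j x *\<^sub>R G (?t u) j x)"
        by (subst sum.reindex) (auto simp: inj_on_def)
      also have "\<dots> = ball_average \<alpha> (c j) (r j) (\<xi> j) x"
      proof -
        have \<xi>j: "\<xi> j \<in> Lp_space p lborel" and rj: "0 < r j" using \<xi> r j by auto
        have fj: "f (?t u) j = (\<lambda>x. (indicator (ball (c j) (r j)) x * indicator (cube_label b (\<theta> j) (s (a j)) (lev j) -` {z (?t u) j}) x) *\<^sub>R \<xi> j x)" for u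
          by (rule ext) (simp add: f_def q_def cls \<kappa>_def)
        show ?thesis
          unfolding ball_average_cubes[OF p1 \<xi>j b_odd s0 \<alpha> rj side_r(2)[OF j] \<theta>[THEN bspec, OF j], of x]
            \<mu>_def G_def fj
          by (simp only: cls if_True \<kappa>_def par_def z_def fst_conv snd_conv)
      qed
      finally show ?thesis ..
    qed
    have summand: "rad2 p lborel J (\<lambda>j x. \<mu> t j x *\<^sub>R G t j x)
        \<le> A * (1 / \<omega>) * (C1 * real (b ^ ?d) powr (1 / \<tau>) * (A * rad2 p lborel J \<xi>))" for t
    proof -
      obtain pos where g: "homogeneous_grid (lborel :: (real ^ 'n) measure) (\<kappa> t) (par t) pos (b ^ ?d) (s (fst t) ^ ?d)"
        using grid by blast
      have "rad2 p lborel J (f t) \<le> A * 1 * rad2 p lborel J \<xi>"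
        unfolding f_def by (rule contr[OF J \<xi>]) (use q in auto)
      then have "C1 * real (b ^ ?d) powr (1 / \<tau>) * rad2 p lborel J (f t)
          \<le> C1 * real (b ^ ?d) powr (1 / \<tau>) * (A * rad2 p lborel J \<xi>)"
        using C1 by (intro mult_left_mono) auto
      moreover have "rad2 p lborel J (G t) \<le> C1 * real (b ^ ?d) powr (1 / \<tau>) * rad2 p lborel J (f t)"
        unfolding G_def
        by (rule pab[OF g J fLp]) (auto simp: f_def q_def)
      ultimately have G_le: "rad2 p lborel J (G t) \<le> C1 * real (b ^ ?d) powr (1 / \<tau>) * (A * rad2 p lborel J \<xi>)"
        by linarith
      have "rad2 p lborel J (\<lambda>j x. \<mu> t j x *\<^sub>R G t j x) \<le> A * (1 / \<omega>) * rad2 p lborel J (G t)"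
        by (rule contr[OF J]) (use GLp \<mu>1 \<mu>2 \<omega> in auto)
      also have "\<dots> \<le> A * (1 / \<omega>) * (C1 * real (b ^ ?d) powr (1 / \<tau>) * (A * rad2 p lborel J \<xi>))"
        by (rule mult_left_mono[OF G_le]) (use A \<omega> in simp)
      finally show ?thesis .
    qed
    have "rad2 p lborel J (\<lambda>j. ball_average \<alpha> (c j) (r j) (\<xi> j)) = rad2 p lborel J (\<lambda>j x. \<Sum>t\<in>I. \<mu> t j x *\<^sub>R G t j x)"
      by (rule rad2_cong) (rule decomp)
    also have "\<dots> \<le> (\<Sum>t\<in>I. rad2 p lborel J (\<lambda>j x. \<mu> t j x *\<^sub>R G t j x))"
      using p \<mu>1 \<mu>2 GLp by (intro rad2_sum p1 J Lp_space_mult[where c = "1 / \<omega>"]) auto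
    also have "\<dots> \<le> (\<Sum>t\<in>I. A * (1 / \<omega>) * (C1 * real (b ^ ?d) powr (1 / \<tau>) * (A * rad2 p lborel J \<xi>)))"
      by (rule sum_mono) (rule summand)
    also have "\<dots> = real L * D * (A * (1 / \<omega>) * (C1 * real (b ^ ?d) powr (1 / \<tau>) * (A * rad2 p lborel J \<xi>)))"
      by (simp only: sum_constant I(2))
    also have "\<dots> \<le> (4 * (1 + ln \<alpha>)) * D * (A * (1 / \<omega>) * (C1 * (36 powr (real ?d / \<tau>) * \<alpha> powr (real ?d / \<tau>)) * (A * rad2 p lborel J \<xi>)))"
    proof (intro mult_mono)
      show "real L \<le> 4 * (1 + ln \<alpha>)" by (rule L_ln)
      have "real (b ^ ?d) powr (1 / \<tau>) = real b powr (real ?d / \<tau>)"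
        using b0 by (simp add: powr_powr flip: powr_realpow)
      also have "\<dots> \<le> (36 * \<alpha>) powr (real ?d / \<tau>)"
        using b_hi \<tau> by (intro powr_mono2) auto
      also have "\<dots> = 36 powr (real ?d / \<tau>) * \<alpha> powr (real ?d / \<tau>)"
        using \<alpha> by (simp add: powr_mult)
      finally show "real (b ^ ?d) powr (1 / \<tau>) \<le> 36 powr (real ?d / \<tau>) * \<alpha> powr (real ?d / \<tau>)" .
    qed (use A \<omega> C1 D \<alpha> in auto)
    also have "\<dots> = C * (1 + ln \<alpha>) * \<alpha> powr (real ?d / \<tau>) * rad2 p lborel J \<xi>"
      unfolding C_def by (simp only: mult_ac)
    finally show ?thesis .
  qed
  show ?thesis
  proof (intro exI[of _ C] conjI allI impI)
    show "0 \<le> C" by (rule C)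
  qed (rule main)
qed

lemma ball_average_linear:
  fixes f g :: "real ^ 'n \<Rightarrow> 'x::banach"
  assumes p: "1 \<le> p" and f: "f \<in> Lp_space p lborel"
  shows "ball_average \<alpha> c r (\<lambda>x. a *\<^sub>R f x) = (\<lambda>x. a *\<^sub>R ball_average \<alpha> c r f x)"
    and "g \<in> Lp_space p lborel \<Longrightarrow>
      ball_average \<alpha> c r (\<lambda>x. f x + g x) = (\<lambda>x. ball_average \<alpha> c r f x + ball_average \<alpha> c r g x)"
proof -
  have fin: "emeasure lborel (ball c r) < \<infinity>" by (rule emeasure_bounded_finite) simp
  have I: "has_integral_in lborel (\<lambda>x. indicator (ball c r) x *\<^sub>R h x) (integral_over lborel (ball c r) h)"
    if "h \<in> Lp_space p lborel" for h :: "real ^ 'n \<Rightarrow> 'x"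
    by (rule Lp_space_integral_exists[OF p that _ fin]) simp
  have "integral_over lborel (ball c r) (\<lambda>x. a *\<^sub>R f x) = a *\<^sub>R integral_over lborel (ball c r) f"
    using has_integral_in_scaleR[OF I[OF f], of a] by (intro integral_over_eq) (simp add: mult.commute)
  then show "ball_average \<alpha> c r (\<lambda>x. a *\<^sub>R f x) = (\<lambda>x. a *\<^sub>R ball_average \<alpha> c r f x)"
    by (simp add: ball_average_def mult_ac)
  assume g: "g \<in> Lp_space p lborel"
  have "integral_over lborel (ball c r) (\<lambda>x. f x + g x)
      = integral_over lborel (ball c r) f + integral_over lborel (ball c r) g"
    using has_integral_in_add[OF I[OF f] I[OF g]] by (intro integral_over_eq) (simp add: scaleR_add_right)
  then show "ball_average \<alpha> c r (\<lambda>x. f x + g x) = (\<lambda>x. ball_average \<alpha> c r f x + ball_average \<alpha> c r g x)"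
    by (simp add: ball_average_def scaleR_add_right)
qed

lemma ball_average_Lp_space:
  assumes "0 < p"
  shows "ball_average \<alpha> c r f \<in> Lp_space p lborel"
  unfolding ball_average_def using assms
  by (intro Lp_space_indicator emeasure_bounded_finite) auto

lemma rad2_single:
  assumes p: "0 < p"
  shows "rad2 p M {..<Suc 0} (\<lambda>j. g) = Lp_norm p M g"
proof -
  have "rad2 p M {..<Suc 0} (\<lambda>j. g) = sqrt (sign_mean {..<Suc 0} (\<lambda>\<epsilon>. (Lp_norm p M g)\<^sup>2))"
    unfolding rad2_def
  proof (intro arg_cong[where f = sqrt] sign_mean_cong)
    fix \<epsilon> :: "nat \<Rightarrow> real" assume "\<epsilon> \<in> signs {..<Suc 0}"
    then have "\<bar>\<epsilon> 0\<bar> = 1" by (rule signs_abs) simp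
    then show "(Lp_norm p M (\<lambda>x. \<Sum>j<Suc 0. \<epsilon> j *\<^sub>R g x))\<^sup>2 = (Lp_norm p M g)\<^sup>2"
      using p by (simp add: Lp_norm_scaleR)
  qed
  then show ?thesis by simp
qed

theorem proposition3p5:
  fixes p \<tau> :: real
    and V :: "(real ^ 'n \<Rightarrow> 'x::banach) set"
    and N :: "(real ^ 'n \<Rightarrow> 'x) \<Rightarrow> real"
  defines "V \<equiv> Lp_space p lborel"
    and "N \<equiv> Lp_norm p lborel"
  assumes "umd TYPE('x)"
    and "1 < p"
    and "has_type V N \<tau>"
  shows "\<exists>C. \<forall>\<alpha>\<ge>1. gamma_bounded V N (ball_averages \<alpha>) \<and>
           gamma_bound V N (ball_averages \<alpha>)
             \<le> C * (1 + ln \<alpha>) * \<alpha> powr (real CARD('n) / \<tau>)"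
proof -
  have p: "0 < p" "1 \<le> p" using \<open>1 < p\<close> by auto
  from rad2_ball_averages[OF assms(3,4) assms(5)[unfolded V_def N_def]]
  obtain C where C: "0 \<le> C" and bound0: "\<forall>\<alpha>\<ge>1. \<forall>(J :: nat set) c r (\<xi> :: nat \<Rightarrow> real ^ 'n \<Rightarrow> 'x).
      finite J \<longrightarrow> (\<forall>j\<in>J. 0 < r j) \<longrightarrow> (\<forall>j\<in>J. \<xi> j \<in> Lp_space p lborel) \<longrightarrow>
      rad2 p lborel J (\<lambda>j. ball_average \<alpha> (c j) (r j) (\<xi> j))
        \<le> C * (1 + ln \<alpha>) * \<alpha> powr (real CARD('n) / \<tau>) * rad2 p lborel J \<xi>"
    by (elim exE conjE)
  note bound = bound0[folded V_def, THEN spec, THEN mp, THEN spec, THEN spec, THEN spec, THEN spec,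
      THEN mp, THEN mp, THEN mp]
  have "gamma_bounded V N (ball_averages \<alpha>) \<and>
      gamma_bound V N (ball_averages \<alpha>) \<le> C * (1 + ln \<alpha>) * \<alpha> powr (real CARD('n) / \<tau>)"
    if \<alpha>: "1 \<le> \<alpha>" for \<alpha>
  proof -
    define B where "B = C * (1 + ln \<alpha>) * \<alpha> powr (real CARD('n) / \<tau>)"
    have B: "0 \<le> B" using C \<alpha> by (simp add: B_def)
    have op: "bounded_linear_operator V N (ball_average \<alpha> c r)" if r: "0 < r" for c r
      unfolding bounded_linear_operator_def
    proof (intro conjI ballI allI exI[of _ B])
      fix f assume f: "f \<in> V"
      show "ball_average \<alpha> c r f \<in> V"
        unfolding V_def by (rule ball_average_Lp_space) (rule p)
      show "N (\<lambda>x. ball_average \<alpha> c r (\<lambda>y. a *\<^sub>R f y) x - a *\<^sub>R ball_average \<alpha> c r f x) = 0" for a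
        using f p ball_average_linear(1)[of p f] by (simp add: V_def N_def Lp_norm_def)
      show "N (\<lambda>x. ball_average \<alpha> c r (\<lambda>y. f y + g y) x - (ball_average \<alpha> c r f x + ball_average \<alpha> c r g x)) = 0"
        if "g \<in> V" for g
        using f that p ball_average_linear(2)[of p f g] by (simp add: V_def N_def Lp_norm_def)
      show "N (ball_average \<alpha> c r f) \<le> B * N f"
        using bound[OF \<alpha>, of "{..<Suc 0}" "\<lambda>_. r" "\<lambda>_. f" "\<lambda>_. c"] f r p
        by (simp only: rad2_single N_def B_def) simp
    qed
    have const: "B \<in> gamma_constants V N (ball_averages \<alpha>)"
      unfolding gamma_constants_def
    proof (intro CollectI conjI allI impI B)
      fix k and T :: "nat \<Rightarrow> (real ^ 'n \<Rightarrow> 'x) \<Rightarrow> real ^ 'n \<Rightarrow> 'x" and \<xi> :: "nat \<Rightarrow> real ^ 'n \<Rightarrow> 'x"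
      assume T: "\<forall>j<k. T j \<in> ball_averages \<alpha> \<and> \<xi> j \<in> V"
      have "\<forall>j<k. \<exists>c r. 0 < r \<and> T j = ball_average \<alpha> c r"
        using T unfolding ball_averages_def by blast
      then obtain c r where cr: "\<And>j. j < k \<Longrightarrow> 0 < r j \<and> T j = ball_average \<alpha> (c j) (r j)"
        by metis
      show "gaussian_square_mean N k (\<lambda>j. T j (\<xi> j)) \<le> ennreal (B\<^sup>2) * gaussian_square_mean N k \<xi>"
        unfolding N_def
      proof (rule gaussian_square_mean_le[OF p(2)])
        show "\<xi> j \<in> Lp_space p lborel" if "j < k" for j using T that by (simp add: V_def)
        show "T j (\<xi> j) \<in> Lp_space p lborel" if "j < k" for j
          using cr[OF that] ball_average_Lp_space[OF p(1)] by simp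
        fix a
        have "rad2 p lborel {..<k} (\<lambda>j x. a j *\<^sub>R T j (\<xi> j) x)
            = rad2 p lborel {..<k} (\<lambda>j. ball_average \<alpha> (c j) (r j) (\<lambda>x. a j *\<^sub>R \<xi> j x))"
        proof (rule rad2_cong)
          fix j x assume "j \<in> {..<k}"
          then have j: "j < k" by simp
          then have "\<xi> j \<in> Lp_space p lborel" using T by (simp add: V_def)
          from ball_average_linear(1)[OF p(2) this] cr[OF j]
          show "a j *\<^sub>R T j (\<xi> j) x = ball_average \<alpha> (c j) (r j) (\<lambda>x. a j *\<^sub>R \<xi> j x) x" by simp
        qed
        also have "\<dots> \<le> B * rad2 p lborel {..<k} (\<lambda>j x. a j *\<^sub>R \<xi> j x)"
          unfolding B_def using cr T p
          by (intro bound \<alpha>) (auto simp: V_def intro: Lp_space_scaleR)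
        finally show "rad2 p lborel {..<k} (\<lambda>j x. a j *\<^sub>R T j (\<xi> j) x)
            \<le> B * rad2 p lborel {..<k} (\<lambda>j x. a j *\<^sub>R \<xi> j x)" .
      qed
    qed
    have "gamma_bounded V N (ball_averages \<alpha>)"
      unfolding gamma_bounded_def using const op by (auto simp: ball_averages_def)
    moreover have "gamma_bound V N (ball_averages \<alpha>) \<le> B"
      unfolding gamma_bound_def
      by (intro cInf_lower const) (auto simp: bdd_below_def gamma_constants_def)
    ultimately show ?thesis by (simp add: B_def)
  qed
  then show ?thesis by blast
qed

end
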